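(* The capacity region of the injective deterministic state-dependent Z-channel with state known noncausally at encoder 1 only (defined in the context) is the set of rate triples $(R_{1},R_{21},R_{2})$ that satisfy $$\begin{aligned} R_{1} & \leq H(Y_1|S,Q),\\ R_{2} & \leq H(Y_2|T_1,Q),\\ R_{21} & \leq H(T_1|S,Q),\\ R_{1} + R_{21} & \leq H(T_1,Y_1|S,Q),\\ R_{2} + R_{21} & \leq H(Y_2|Q) - I(T_1;S|Q),\\ R_{1} + R_{2} + R_{21} & \leq H(Y_1|T_1,S,Q)+H(Y_2|Q)-I(T_1;S|Q), \end{aligned}$$ for some pmf $p(q)\,p(x_1|s,q)\,p(x_2|q)$, where $|\mathcal{Q}|\leq 6$ and the quantities are evaluated under the joint pmf $p(s)p(q)p(x_1|s,q)p(x_2|q)$ with $T_1=t_1(X_1,S)$, $Y_1=y_1(X_1,S)$, $Y_2=y_2(X_2,T_1)$.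
   Context: Channel: finite alphabets; the state $S^n$ is i.i.d. according to $p(s)$, independent of the messages, and known noncausally at encoder 1 only. Receiver 1 observes $Y_1=y_1(X_1,S)$, a deterministic function. The interference is $T_1=t_1(X_1,S)$, a deterministic function, and receiver 2 observes $Y_2=y_2(X_2,T_1)$, a deterministic function. Injectivity: for each fixed $x_2$, $t_1\mapsto y_2(x_2,t_1)$ is injective, i.e. there is a function $g$ with $t_1=g(y_2,x_2)$. All functions act letter by letter over $n$ channel uses. Z-channel messages: there are three independent messages $M_1,M_{21},M_2$, uniform on $[1:2^{nR_1}]$, $[1:2^{nR_{21}}]$, $[1:2^{nR_2}]$, where $[1:2^{nR}]$ denotes $\{1,\dots,\lceil 2^{nR}\rceil\}$. Transmitter 1 sends $M_1$ to receiver 1 and $M_{21}$ to receiver 2; transmitter 2 sends $M_2$ to receiver 2. A code consists of encoding functions giving $X_{1i}$ as a function of $(M_1,M_{21},S^n)$ and $X_{2i}$ as a function of $M_2$, $1\le i\le n$, a decoder 1 mapping $Y_1^n$ to an estimate of $M_1$, and a decoder 2 mapping $Y_2^n$ to an estimate of $(M_{21},M_2)$. A triple $(R_1,R_{21},R_2)$ of nonnegative reals is achievable if for every $\epsilon>0$ there exists, for all sufficiently large $n$, a code for which each decoder's probability of error is at most $\epsilon$. The capacity region is the closure of the set of achievable rate triples. *)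

theory Defs
  imports "HOL-Probability.Probability" "HOL-Library.Numeral_Type"
begin

text \<open>
  A channel is given by the state pmf \<open>ps\<close> and the letter maps
  \<open>y1 :: 'x1 \<Rightarrow> 's \<Rightarrow> 'y1\<close>, \<open>t1 :: 'x1 \<Rightarrow> 's \<Rightarrow> 't\<close> and \<open>y2 :: 'x2 \<Rightarrow> 't \<Rightarrow> 'y2\<close>, whose
  argument and result types are the alphabets.  Messages are natural numbers, sequences over
  \<open>n\<close> channel uses are lists of length \<open>n\<close>, and positions are counted from 0.
\<close>

definition message_set :: "nat \<Rightarrow> real \<Rightarrow> nat set" where
  "message_set n R = {1..nat \<lceil>2 powr (real n * R)\<rceil>}"

text \<open>The joint law of \<open>(M\<^sub>1, M\<^sub>2\<^sub>1, M\<^sub>2, S\<^sup>n)\<close>: all four components are independent.\<close>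

definition source_pmf ::
  "'s pmf \<Rightarrow> nat \<Rightarrow> real \<Rightarrow> real \<Rightarrow> real \<Rightarrow> (nat \<times> nat \<times> nat \<times> 's list) pmf" where
  "source_pmf ps n R1 R21 R2 =
     pair_pmf (pmf_of_set (message_set n R1))
       (pair_pmf (pmf_of_set (message_set n R21))
         (pair_pmf (pmf_of_set (message_set n R2)) (replicate_pmf n ps)))"

text \<open>
  \<open>enc1 m1 m21 s i\<close> and \<open>enc2 m2 i\<close> are the letters sent in channel use \<open>i < n\<close>; \<open>enc1\<close> sees the
  whole state sequence \<open>s\<close>, which is the noncausal state knowledge.
\<close>

definition received1 ::
  "('x1 \<Rightarrow> 's \<Rightarrow> 'y1) \<Rightarrow> nat \<Rightarrow> (nat \<Rightarrow> nat \<Rightarrow> 's list \<Rightarrow> nat \<Rightarrow> 'x1) \<Rightarrow>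
   nat \<Rightarrow> nat \<Rightarrow> 's list \<Rightarrow> 'y1 list" where
  "received1 y1 n enc1 m1 m21 s = map (\<lambda>i. y1 (enc1 m1 m21 s i) (s ! i)) [0..<n]"

definition received2 ::
  "('x1 \<Rightarrow> 's \<Rightarrow> 't) \<Rightarrow> ('x2 \<Rightarrow> 't \<Rightarrow> 'y2) \<Rightarrow> nat \<Rightarrow>
   (nat \<Rightarrow> nat \<Rightarrow> 's list \<Rightarrow> nat \<Rightarrow> 'x1) \<Rightarrow> (nat \<Rightarrow> nat \<Rightarrow> 'x2) \<Rightarrow>
   nat \<Rightarrow> nat \<Rightarrow> nat \<Rightarrow> 's list \<Rightarrow> 'y2 list" where
  "received2 t1 y2 n enc1 enc2 m1 m21 m2 s =
     map (\<lambda>i. y2 (enc2 m2 i) (t1 (enc1 m1 m21 s i) (s ! i))) [0..<n]"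

definition error_prob1 ::
  "'s pmf \<Rightarrow> ('x1 \<Rightarrow> 's \<Rightarrow> 'y1) \<Rightarrow> nat \<Rightarrow> real \<Rightarrow> real \<Rightarrow> real \<Rightarrow>
   (nat \<Rightarrow> nat \<Rightarrow> 's list \<Rightarrow> nat \<Rightarrow> 'x1) \<Rightarrow> ('y1 list \<Rightarrow> nat) \<Rightarrow> real" where
  "error_prob1 ps y1 n R1 R21 R2 enc1 dec1 =
     measure_pmf.prob (source_pmf ps n R1 R21 R2)
       {(m1, m21, m2, s). dec1 (received1 y1 n enc1 m1 m21 s) \<noteq> m1}"

definition error_prob2 ::
  "'s pmf \<Rightarrow> ('x1 \<Rightarrow> 's \<Rightarrow> 't) \<Rightarrow> ('x2 \<Rightarrow> 't \<Rightarrow> 'y2) \<Rightarrow> nat \<Rightarrow> real \<Rightarrow> real \<Rightarrow> real \<Rightarrow>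
   (nat \<Rightarrow> nat \<Rightarrow> 's list \<Rightarrow> nat \<Rightarrow> 'x1) \<Rightarrow> (nat \<Rightarrow> nat \<Rightarrow> 'x2) \<Rightarrow>
   ('y2 list \<Rightarrow> nat \<times> nat) \<Rightarrow> real" where
  "error_prob2 ps t1 y2 n R1 R21 R2 enc1 enc2 dec2 =
     measure_pmf.prob (source_pmf ps n R1 R21 R2)
       {(m1, m21, m2, s). dec2 (received2 t1 y2 n enc1 enc2 m1 m21 m2 s) \<noteq> (m21, m2)}"

definition achievable ::
  "'s pmf \<Rightarrow> ('x1 \<Rightarrow> 's \<Rightarrow> 'y1) \<Rightarrow> ('x1 \<Rightarrow> 's \<Rightarrow> 't) \<Rightarrow> ('x2 \<Rightarrow> 't \<Rightarrow> 'y2) \<Rightarrow>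
   real \<Rightarrow> real \<Rightarrow> real \<Rightarrow> bool" where
  "achievable ps y1 t1 y2 R1 R21 R2 \<longleftrightarrow>
     0 \<le> R1 \<and> 0 \<le> R21 \<and> 0 \<le> R2 \<and>
     (\<forall>\<epsilon>>0. \<forall>\<^sub>F n in sequentially. \<exists>enc1 enc2 dec1 dec2.
        error_prob1 ps y1 n R1 R21 R2 enc1 dec1 \<le> \<epsilon> \<and>
        error_prob2 ps t1 y2 n R1 R21 R2 enc1 enc2 dec2 \<le> \<epsilon>)"

definition capacity_region ::
  "'s pmf \<Rightarrow> ('x1 \<Rightarrow> 's \<Rightarrow> 'y1) \<Rightarrow> ('x1 \<Rightarrow> 's \<Rightarrow> 't) \<Rightarrow> ('x2 \<Rightarrow> 't \<Rightarrow> 'y2) \<Rightarrow>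
   (real \<times> real \<times> real) set" where
  "capacity_region ps y1 t1 y2 = closure {(R1, R21, R2). achievable ps y1 t1 y2 R1 R21 R2}"

text \<open>
  The joint pmf \<open>p(q) p(s) p(x\<^sub>1|s,q) p(x\<^sub>2|q)\<close> of \<open>(Q, S, X\<^sub>1, X\<^sub>2)\<close>.
\<close>

definition joint_pmf ::
  "'q pmf \<Rightarrow> 's pmf \<Rightarrow> ('s \<Rightarrow> 'q \<Rightarrow> 'x1 pmf) \<Rightarrow> ('q \<Rightarrow> 'x2 pmf) \<Rightarrow>
   ('q \<times> 's \<times> 'x1 \<times> 'x2) pmf" where
  "joint_pmf pq ps px1 px2 =
     do {q \<leftarrow> pq; s \<leftarrow> ps; x1 \<leftarrow> px1 s q; x2 \<leftarrow> px2 q; return_pmf (q, s, x1, x2)}"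

text \<open>
  The library's entropies in bits, for discrete random variables on the probability space \<open>P\<close>;
  these are the locale abbreviations \<open>\<H>(X | Y)\<close> and \<open>\<I>(X ; Y | Z)\<close> of \<^locale>\<open>information_space\<close>
  for \<open>M = measure_pmf P\<close> and \<open>b = 2\<close>.
\<close>

abbreviation cond_entropy :: "'a pmf \<Rightarrow> ('a \<Rightarrow> 'b) \<Rightarrow> ('a \<Rightarrow> 'c) \<Rightarrow> real" where
  "cond_entropy P X Y \<equiv>
     prob_space.conditional_entropy (measure_pmf P) 2
       (count_space (range X)) (count_space (range Y)) X Y"

abbreviation cond_mutual_info ::
  "'a pmf \<Rightarrow> ('a \<Rightarrow> 'b) \<Rightarrow> ('a \<Rightarrow> 'c) \<Rightarrow> ('a \<Rightarrow> 'd) \<Rightarrow> real" where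
  "cond_mutual_info P X Y Z \<equiv>
     prob_space.conditional_mutual_information (measure_pmf P) 2
       (count_space (range X)) (count_space (range Y)) (count_space (range Z)) X Y Z"

text \<open>
  The single-letter constraints for one choice of the input pmfs.  The time-sharing alphabet is
  the type \<open>'q\<close>; smaller alphabets are covered, since \<open>pq\<close> need not have full support.
\<close>

definition rate_constraints ::
  "'s::finite pmf \<Rightarrow> ('x1::finite \<Rightarrow> 's \<Rightarrow> 'y1) \<Rightarrow> ('x1 \<Rightarrow> 's \<Rightarrow> 't) \<Rightarrow>
   ('x2::finite \<Rightarrow> 't \<Rightarrow> 'y2) \<Rightarrow>
   'q::finite pmf \<Rightarrow> ('s \<Rightarrow> 'q \<Rightarrow> 'x1 pmf) \<Rightarrow> ('q \<Rightarrow> 'x2 pmf) \<Rightarrow>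
   real \<Rightarrow> real \<Rightarrow> real \<Rightarrow> bool" where
  "rate_constraints ps y1 t1 y2 pq px1 px2 R1 R21 R2 \<longleftrightarrow>
    (let P  = joint_pmf pq ps px1 px2;
         Q  = (\<lambda>(q, s, x1, x2). q);
         S  = (\<lambda>(q, s, x1, x2). s);
         T1 = (\<lambda>(q, s, x1, x2). t1 x1 s);
         Y1 = (\<lambda>(q, s, x1, x2). y1 x1 s);
         Y2 = (\<lambda>(q, s, x1, x2). y2 x2 (t1 x1 s))
     in R1 \<le> cond_entropy P Y1 (\<lambda>\<omega>. (S \<omega>, Q \<omega>)) \<and>
        R2 \<le> cond_entropy P Y2 (\<lambda>\<omega>. (T1 \<omega>, Q \<omega>)) \<and>
        R21 \<le> cond_entropy P T1 (\<lambda>\<omega>. (S \<omega>, Q \<omega>)) \<and>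
        R1 + R21 \<le> cond_entropy P (\<lambda>\<omega>. (T1 \<omega>, Y1 \<omega>)) (\<lambda>\<omega>. (S \<omega>, Q \<omega>)) \<and>
        R2 + R21 \<le> cond_entropy P Y2 Q - cond_mutual_info P T1 S Q \<and>
        R1 + R2 + R21 \<le> cond_entropy P Y1 (\<lambda>\<omega>. (T1 \<omega>, S \<omega>, Q \<omega>))
          + cond_entropy P Y2 Q - cond_mutual_info P T1 S Q)"

end

theory Submission
  imports Defs "HOL-Real_Asymp.Real_Asymp"
begin

text \<open>
  \<^emph>\<open>Converse.\<close> The time-sharing variable is the time index.  Fano's inequality and submodularity of
  entropy bound the rates by \<open>n\<close>-letter entropies; the key step is
  \<open>H(T\<^sup>n|M\<^sub>2\<^sub>1) \<ge> I(T\<^sup>n;S\<^sup>n) + H(T\<^sup>n|S\<^sup>n,M\<^sub>2\<^sub>1)\<close>, as \<open>S\<^sup>n\<close> is independent of the message.  The \<open>n\<close> time points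
  are reduced to six: a point of a convex hull in \<open>\<real>\<^sup>6\<close> can be pushed in direction \<open>(1,\<dots>,1)\<close> until one of
  seven weights vanishes.  A compactness argument removes the vanishing slack.

  \<^emph>\<open>Achievability.\<close> The sequences \<open>y\<^sub>1\<close> are hashed to messages \<open>m\<^sub>1\<close>, and the sequences \<open>t\<^sub>1\<close> to a set
  of \<open>K\<close> values that contains the messages \<open>m\<^sub>2\<^sub>1\<close>.  Encoder 1 looks for a pair \<open>(t\<^sub>1, y\<^sub>1)\<close>
  that is typical given the state and has the right hash values, so receiver 1 never errs
  when the search succeeds.  By injectivity receiver 2 recovers \<open>t\<^sub>1\<close> from its output once it has found \<open>m\<^sub>2\<close>.
  Choosing the pair with its conditional probability given the state (a likelihood encoder) keeps its law within a
  constant factor of the target law, so that all errors are controlled by probabilities under the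
  single-letter product law.
\<close>


section \<open>Finite expectations\<close>

text \<open>The obstacle sits at receiver 2: it does not know the state, yet must resolve an
  interference that depends on it. The cure is a hash rate \<open>k \<ge> R21\<close> that is kept
  free. Only the fraction \<open>L21 / K\<close> of the interference sequences carries a message,
  and counting the false pairs of second input and interference asks for
  \<open>R2 + R21 - k \<le> H(Y2) - H(T)\<close>: a large \<open>k\<close> helps the receiver. The
  search of encoder 1 limits it by \<open>k \<le> H(T|S)\<close> and
  \<open>k + R1 \<le> H(T,Y1|S)\<close>. Eliminating \<open>k\<close> produces the constraints with
  \<open>I(T;S)\<close>. No auxiliary variable appears in the converse because
  \<open>I(T^n;S^n)\<close> is superadditive over the letters when the state is memoryless, which is
  the direction needed. All six right-hand sides are then linear in the law of the time index. Only
  lower bounds on them have to survive its reduction, hence six points where Caratheodory's theorem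
  alone would give seven.\<close>

text \<open>The sum is 0 if the support is infinite; the linear laws hold even then.\<close>
definition ex :: "'a pmf \<Rightarrow> ('a \<Rightarrow> real) \<Rightarrow> real" where
  "ex P f = (\<Sum>x\<in>set_pmf P. pmf P x * f x)"

lemma ex_cong: "(\<And>x. x \<in> set_pmf P \<Longrightarrow> f x = g x) \<Longrightarrow> ex P f = ex P g"
  by (simp add: ex_def)

lemma ex_mono: "(\<And>x. x \<in> set_pmf P \<Longrightarrow> f x \<le> g x) \<Longrightarrow> ex P f \<le> ex P g"
  by (auto simp: ex_def intro!: sum_mono mult_left_mono)

lemma ex_add: "ex P (\<lambda>x. f x + g x) = ex P f + ex P g"
  by (simp add: ex_def sum.distrib algebra_simps)

lemma ex_diff: "ex P (\<lambda>x. f x - g x) = ex P f - ex P g"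
  by (simp add: ex_def sum_subtractf algebra_simps)

lemma ex_minus: "ex P (\<lambda>x. - f x) = - ex P f"
  by (simp add: ex_def sum_negf)

lemma ex_cmult: "ex P (\<lambda>x. c * f x) = c * ex P f"
  by (simp add: ex_def sum_distrib_left algebra_simps)

lemma ex_cmult_right: "ex P (\<lambda>x. f x * c) = ex P f * c"
  using ex_cmult[of P c f] by (simp add: mult.commute)

lemma ex_sum: "ex P (\<lambda>x. \<Sum>i\<in>A. f i x) = (\<Sum>i\<in>A. ex P (f i))"
  unfolding ex_def sum_distrib_left by (rule sum.swap)

lemma ex_const: "finite (set_pmf P) \<Longrightarrow> ex P (\<lambda>_. c) = c"
  by (simp add: ex_def flip: sum_distrib_right) (simp add: sum_pmf_eq_1)

lemma ex_zero [simp]: "ex P (\<lambda>_. 0) = 0"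
  by (simp add: ex_def)

lemma ex_nonneg: "(\<And>x. x \<in> set_pmf P \<Longrightarrow> 0 \<le> f x) \<Longrightarrow> 0 \<le> ex P f"
  by (auto simp: ex_def intro!: sum_nonneg)

lemma ex_return [simp]: "ex (return_pmf x) f = f x"
  by (simp add: ex_def)

lemma ex_superset: "finite A \<Longrightarrow> set_pmf P \<subseteq> A \<Longrightarrow> ex P f = (\<Sum>x\<in>A. pmf P x * f x)"
  unfolding ex_def by (rule sum.mono_neutral_left) (auto simp: set_pmf_eq)

lemma ex_expectation: "finite (set_pmf P) \<Longrightarrow> ex P f = measure_pmf.expectation P f"
  by (subst integral_measure_pmf_real[of "set_pmf P"]) (auto simp: ex_def mult.commute)

lemma ex_map: "finite (set_pmf P) \<Longrightarrow> ex (map_pmf g P) f = ex P (\<lambda>x. f (g x))"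
  by (simp add: ex_expectation)

lemma ex_bind:
  assumes "finite (set_pmf P)" "\<And>x. x \<in> set_pmf P \<Longrightarrow> finite (set_pmf (K x))"
  shows "ex (bind_pmf P K) f = ex P (\<lambda>x. ex (K x) f)"
proof -
  have "ex (bind_pmf P K) f = measure_pmf.expectation (bind_pmf P K) f"
    using assms by (intro ex_expectation) auto
  also have "\<dots> = (\<Sum>a\<in>set_pmf P. pmf P a *\<^sub>R measure_pmf.expectation (K a) f)"
    using assms by (intro pmf_expectation_bind) auto
  also have "\<dots> = ex P (\<lambda>x. ex (K x) f)"
    unfolding ex_def[of P] using assms by (intro sum.cong) (auto simp: ex_expectation)
  finally show ?thesis .
qed

lemma ex_of_bool: "finite (set_pmf P) \<Longrightarrow> ex P (\<lambda>x. of_bool (x \<in> A)) = measure_pmf.prob P A"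
proof -
  assume "finite (set_pmf P)"
  then have "ex P (\<lambda>x. of_bool (x \<in> A)) = measure_pmf.expectation P (indicator A)"
    by (simp add: ex_expectation indicator_def[abs_def])
  then show ?thesis by simp
qed

lemma prob_cong_set:
  assumes "\<And>x. x \<in> set_pmf P \<Longrightarrow> x \<in> A \<longleftrightarrow> x \<in> B"
  shows "measure_pmf.prob P A = measure_pmf.prob P B"
  by (rule measure_pmf.finite_measure_eq_AE) (auto simp: AE_measure_pmf_iff assms)

lemma prob_mono_set:
  assumes "\<And>x. x \<in> set_pmf P \<Longrightarrow> x \<in> A \<Longrightarrow> x \<in> B"
  shows "measure_pmf.prob P A \<le> measure_pmf.prob P B"
  by (rule measure_pmf.finite_measure_mono_AE) (auto simp: AE_measure_pmf_iff assms)

lemma pmf_map_self: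
  "pmf (map_pmf X P) (X \<omega>) = measure_pmf.prob P {\<omega>'. X \<omega>' = X \<omega>}"
  by (simp add: pmf_map vimage_def)

lemma pmf_map_pos: "\<omega> \<in> set_pmf P \<Longrightarrow> 0 < pmf (map_pmf X P) (X \<omega>)"
  by (rule pmf_positive) auto

section \<open>Entropy\<close>

definition ent :: "'a pmf \<Rightarrow> ('a \<Rightarrow> 'b) \<Rightarrow> real" where
  "ent P X = ex P (\<lambda>\<omega>. - log 2 (pmf (map_pmf X P) (X \<omega>)))"

text \<open>With the chain rule as definition, relations between conditional entropies become linear
  arithmetic in \<open>ent\<close>. Agreement with the library's notion is
  \<open>cond_entropy_cent\<close>.\<close>

definition cent :: "'a pmf \<Rightarrow> ('a \<Rightarrow> 'b) \<Rightarrow> ('a \<Rightarrow> 'c) \<Rightarrow> real" where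
  "cent P X Y = ent P (\<lambda>\<omega>. (X \<omega>, Y \<omega>)) - ent P Y"

text \<open>Each fibre of \<open>X\<close> on the support lies in a fibre of \<open>Y\<close>, so
  the inequality already holds pointwise under the expectation. Functional dependence is phrased as
  an implication between sample points, which spares naming the function.\<close>

lemma ent_mono:
  assumes "\<And>\<omega> \<omega>'. \<omega> \<in> set_pmf P \<Longrightarrow> \<omega>' \<in> set_pmf P \<Longrightarrow> X \<omega> = X \<omega>' \<Longrightarrow> Y \<omega> = Y \<omega>'"
  shows "ent P Y \<le> ent P X"
  unfolding ent_def
proof (rule ex_mono)
  fix \<omega> assume w: "\<omega> \<in> set_pmf P"
  have "pmf (map_pmf X P) (X \<omega>) \<le> pmf (map_pmf Y P) (Y \<omega>)"
    unfolding pmf_map_self using assms[OF _ w] by (intro prob_mono_set) blast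
  then show "- log 2 (pmf (map_pmf Y P) (Y \<omega>)) \<le> - log 2 (pmf (map_pmf X P) (X \<omega>))"
    using pmf_map_pos[OF w, where X = X] pmf_map_pos[OF w, where X = Y] by simp
qed

lemma ent_cong:
  assumes "\<And>\<omega> \<omega>'. \<omega> \<in> set_pmf P \<Longrightarrow> \<omega>' \<in> set_pmf P \<Longrightarrow> X \<omega> = X \<omega>' \<longleftrightarrow> Y \<omega> = Y \<omega>'"
  shows "ent P Y = ent P X"
  by (intro antisym ent_mono) (use assms in blast)+

lemma cent_nonneg: "0 \<le> cent P X Y"
  unfolding cent_def using ent_mono[of P "\<lambda>\<omega>. (X \<omega>, Y \<omega>)" Y] by auto

lemma ent_map: "finite (set_pmf P) \<Longrightarrow> ent (map_pmf g P) X = ent P (\<lambda>\<omega>. X (g \<omega>))"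
  by (simp add: ent_def ex_map map_pmf_comp)

lemma ent_unit: "finite (set_pmf P) \<Longrightarrow> ent P (\<lambda>_. c) = 0"
  by (simp add: ent_def map_pmf_const ex_const)

lemma cent_unit: "finite (set_pmf P) \<Longrightarrow> cent P X (\<lambda>_. ()) = ent P X"
  unfolding cent_def by (simp add: ent_unit) (rule ent_cong, auto)

text \<open>Gibbs' inequality, from \<open>ln r \<le> r - 1\<close>.\<close>

lemma ex_log_ratio_le:
  assumes "finite (set_pmf P)" "\<And>\<omega>. \<omega> \<in> set_pmf P \<Longrightarrow> 0 < r \<omega>" "ex P r \<le> 1"
  shows "ex P (\<lambda>\<omega>. log 2 (r \<omega>)) \<le> 0"
proof -
  have "ex P (\<lambda>\<omega>. log 2 (r \<omega>)) \<le> ex P (\<lambda>\<omega>. 1 / ln 2 * (r \<omega> - 1))"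
    using assms(2) by (intro ex_mono) (auto simp: log_def divide_right_mono ln_le_minus_one)
  also have "\<dots> = 1 / ln 2 * (ex P r - 1)"
    by (simp only: ex_cmult ex_diff) (simp add: ex_const assms)
  also have "\<dots> \<le> 0"
    using assms(3) by (simp add: field_simps)
  finally show ?thesis .
qed

text \<open>Gibbs' inequality for the ratio \<open>q(x,y) p(y) / p(x,y)\<close>: the cross entropy
  with any test kernel \<open>q\<close> of mass at most 1 dominates. The cardinality bound,
  submodularity and Fano's inequality below differ only in the choice of \<open>q\<close>.\<close>

lemma cent_le_cross:
  assumes fin: "finite (set_pmf P)"
    and nonneg: "\<And>x y. 0 \<le> q x y"
    and pos: "\<And>\<omega>. \<omega> \<in> set_pmf P \<Longrightarrow> 0 < q (X \<omega>) (Y \<omega>)"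
    and sub: "\<And>y. y \<in> Y ` set_pmf P \<Longrightarrow> (\<Sum>x\<in>X ` set_pmf P. q x y) \<le> 1"
  shows "cent P X Y \<le> ex P (\<lambda>\<omega>. - log 2 (q (X \<omega>) (Y \<omega>)))"
proof -
  define XY where "XY = (\<lambda>\<omega>. (X \<omega>, Y \<omega>))"
  define r where "r = (\<lambda>(x, y). q x y * pmf (map_pmf Y P) y / pmf (map_pmf XY P) (x, y))"
  have r: "r (XY \<omega>) = q (X \<omega>) (Y \<omega>) * pmf (map_pmf Y P) (Y \<omega>) / pmf (map_pmf XY P) (XY \<omega>)" for \<omega>
    by (simp add: r_def XY_def)
  have "ex P (\<lambda>\<omega>. r (XY \<omega>)) = ex (map_pmf XY P) r"
    by (simp add: ex_map fin)
  also have "\<dots> = (\<Sum>(x, y)\<in>XY ` set_pmf P. q x y * pmf (map_pmf Y P) y)"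
    unfolding ex_def set_map_pmf
    by (intro sum.cong) (auto simp: r_def XY_def set_pmf_iff[symmetric] simp flip: set_map_pmf)
  also have "\<dots> \<le> (\<Sum>(x, y)\<in>X ` set_pmf P \<times> Y ` set_pmf P. q x y * pmf (map_pmf Y P) y)"
    using fin nonneg by (intro sum_mono2) (auto simp: XY_def)
  also have "\<dots> = (\<Sum>y\<in>Y ` set_pmf P. (\<Sum>x\<in>X ` set_pmf P. q x y) * pmf (map_pmf Y P) y)"
    by (simp add: sum.cartesian_product[symmetric] sum_distrib_right)
      (rule sum.swap)
  also have "\<dots> \<le> (\<Sum>y\<in>Y ` set_pmf P. 1 * pmf (map_pmf Y P) y)"
    using sub by (intro sum_mono mult_right_mono) auto
  also have "\<dots> = 1"
    using fin by (simp add: sum_pmf_eq_1)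
  finally have le1: "ex P (\<lambda>\<omega>. r (XY \<omega>)) \<le> 1" .
  have rpos: "0 < r (XY \<omega>)" if "\<omega> \<in> set_pmf P" for \<omega>
    unfolding r by (intro divide_pos_pos mult_pos_pos pos pmf_map_pos that)
  have "cent P X Y - ex P (\<lambda>\<omega>. - log 2 (q (X \<omega>) (Y \<omega>))) =
      ex P (\<lambda>\<omega>. - log 2 (pmf (map_pmf XY P) (XY \<omega>)) + log 2 (pmf (map_pmf Y P) (Y \<omega>))
        + log 2 (q (X \<omega>) (Y \<omega>)))"
    by (simp add: cent_def ent_def ex_add ex_diff ex_minus XY_def)
  also have "\<dots> = ex P (\<lambda>\<omega>. log 2 (r (XY \<omega>)))"
  proof (rule ex_cong)
    fix \<omega> assume w: "\<omega> \<in> set_pmf P"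
    show "- log 2 (pmf (map_pmf XY P) (XY \<omega>)) + log 2 (pmf (map_pmf Y P) (Y \<omega>))
        + log 2 (q (X \<omega>) (Y \<omega>)) = log 2 (r (XY \<omega>))"
      unfolding r using pos[OF w] pmf_map_pos[OF w, where X = XY] pmf_map_pos[OF w, where X = Y]
      by (simp add: log_divide_pos log_mult_pos)
  qed
  also have "\<dots> \<le> 0"
    using fin rpos le1 by (rule ex_log_ratio_le)
  finally show ?thesis by simp
qed

lemma cent_le_log_card:
  assumes fin: "finite (set_pmf P)" and "X ` set_pmf P \<subseteq> A" "finite A"
  shows "cent P X Y \<le> log 2 (card A)"
proof -
  have ne: "card A > 0"
    using assms set_pmf_not_empty[of P] by (auto simp: card_gt_0_iff)
  have "card (X ` set_pmf P) \<le> card A"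
    using assms by (intro card_mono) auto
  then have "cent P X Y \<le> ex P (\<lambda>\<omega>. - log 2 ((\<lambda>x y. 1 / card A) (X \<omega>) (Y \<omega>)))"
    using fin ne by (intro cent_le_cross) (auto simp: field_simps)
  also have "\<dots> = log 2 (card A)"
    using ne by (simp add: ex_const fin log_divide)
  finally show ?thesis .
qed

text \<open>Submodularity: the conditional law of \<open>X\<close> given the coarser variable \<open>B\<close> is the test kernel.\<close>
lemma cent_antimono:
  assumes fin: "finite (set_pmf P)"
    and AB: "\<And>\<omega> \<omega>'. \<omega> \<in> set_pmf P \<Longrightarrow> \<omega>' \<in> set_pmf P \<Longrightarrow> A \<omega> = A \<omega>' \<Longrightarrow> B \<omega> = B \<omega>'"
  shows "cent P X A \<le> cent P X B"
proof -
  \<comment> \<open>\<open>b\<close> is the map with \<open>B = b(A)\<close> on the support; outside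
    the values attained there it is arbitrary.\<close>
  define b where "b a = B (SOME \<omega>. \<omega> \<in> set_pmf P \<and> A \<omega> = a)" for a
  have b: "b (A \<omega>) = B \<omega>" if "\<omega> \<in> set_pmf P" for \<omega>
    unfolding b_def using AB that by (metis (mono_tags, lifting) someI_ex)
  define XB where "XB = (\<lambda>\<omega>. (X \<omega>, B \<omega>))"
  define q where "q x a = pmf (map_pmf XB P) (x, b a) / pmf (map_pmf B P) (b a)" for x a
  have q: "q (X \<omega>) (A \<omega>) = pmf (map_pmf XB P) (XB \<omega>) / pmf (map_pmf B P) (B \<omega>)"
    if "\<omega> \<in> set_pmf P" for \<omega>
    using b[OF that] by (simp add: q_def XB_def)
  have "cent P X A \<le> ex P (\<lambda>\<omega>. - log 2 (q (X \<omega>) (A \<omega>)))"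
  proof (rule cent_le_cross[OF fin])
    show "0 < q (X \<omega>) (A \<omega>)" if "\<omega> \<in> set_pmf P" for \<omega>
      unfolding q[OF that] by (intro divide_pos_pos pmf_map_pos that)
    show "(\<Sum>x\<in>X ` set_pmf P. q x a) \<le> 1" for a
    proof -
      have "(\<Sum>x\<in>X ` set_pmf P. pmf (map_pmf XB P) (x, b a)) =
          measure_pmf.prob (map_pmf XB P) ((\<lambda>x. (x, b a)) ` X ` set_pmf P)"
        using fin by (subst measure_measure_pmf_finite)
          (auto simp: sum.reindex inj_on_def)
      also have "\<dots> \<le> pmf (map_pmf B P) (b a)"
        by (simp add: pmf_map) (rule prob_mono_set, auto simp: XB_def)
      finally show ?thesis
        unfolding q_def sum_divide_distrib[symmetric] by (intro divide_le_eq_1[THEN iffD2])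
          (use pmf_nonneg[of "map_pmf B P" "b a"] in linarith)
    qed
  qed (simp add: q_def)
  also have "\<dots> = ex P (\<lambda>\<omega>. - log 2 (pmf (map_pmf XB P) (XB \<omega>)) - - log 2 (pmf (map_pmf B P) (B \<omega>)))"
  proof (rule ex_cong)
    fix \<omega> assume w: "\<omega> \<in> set_pmf P"
    show "- log 2 (q (X \<omega>) (A \<omega>)) =
        - log 2 (pmf (map_pmf XB P) (XB \<omega>)) - - log 2 (pmf (map_pmf B P) (B \<omega>))"
      unfolding q[OF w] using pmf_map_pos[OF w, where X = XB] pmf_map_pos[OF w, where X = B]
      by (simp add: log_divide)
  qed
  also have "\<dots> = cent P X B"
    by (simp only: ex_diff cent_def ent_def XB_def)
  finally show ?thesis .
qed

lemma cent_mono: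
  assumes "\<And>\<omega> \<omega>'. \<omega> \<in> set_pmf P \<Longrightarrow> \<omega>' \<in> set_pmf P \<Longrightarrow> X \<omega> = X \<omega>' \<Longrightarrow> Z \<omega> = Z \<omega>' \<Longrightarrow> Y \<omega> = Y \<omega>'"
  shows "cent P Y Z \<le> cent P X Z"
  unfolding cent_def by (intro diff_right_mono ent_mono) (use assms in blast)

lemma cent_chain: "cent P (\<lambda>\<omega>. (X \<omega>, Y \<omega>)) Z = cent P Y Z + cent P X (\<lambda>\<omega>. (Y \<omega>, Z \<omega>))"
proof -
  have "ent P (\<lambda>\<omega>. ((X \<omega>, Y \<omega>), Z \<omega>)) = ent P (\<lambda>\<omega>. (X \<omega>, Y \<omega>, Z \<omega>))"
    by (rule ent_cong) auto
  then show ?thesis by (simp add: cent_def)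
qed

text \<open>Every rate bound of the converse passes from a message to a channel output in this way;
  the last term is left to Fano's inequality.\<close>

lemma cent_decode:
  assumes "finite (set_pmf P)"
  shows "cent P M Z \<le> cent P Y Z + cent P M Y"
proof -
  have "cent P M Z \<le> cent P (\<lambda>\<omega>. (M \<omega>, Y \<omega>)) Z"
    by (rule cent_mono) auto
  moreover have "cent P M (\<lambda>\<omega>. (Y \<omega>, Z \<omega>)) \<le> cent P M Y"
    by (rule cent_antimono[OF assms]) auto
  ultimately show ?thesis by (simp add: cent_chain)
qed

text \<open>Fano's inequality; the test kernel puts mass 1/2 on the estimate and spreads the rest.\<close>
lemma cent_fano:
  assumes fin: "finite (set_pmf P)" and MA: "M ` set_pmf P \<subseteq> A" "finite A"
    and err: "measure_pmf.prob P {\<omega>. g (Y \<omega>) \<noteq> M \<omega>} \<le> e"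
  shows "cent P M Y \<le> 1 + e * log 2 (card A)"
proof -
  have ne: "card A > 0"
    using assms set_pmf_not_empty[of P] by (auto simp: card_gt_0_iff)
  then have c1: "real (card A) \<ge> 1" by simp
  define q where "q m y = (if m = g y then 1 / 2 else 1 / (2 * real (card A)))" for m y
  have "cent P M Y \<le> ex P (\<lambda>\<omega>. - log 2 (q (M \<omega>) (Y \<omega>)))"
  proof (rule cent_le_cross[OF fin])
    show "(\<Sum>x\<in>M ` set_pmf P. q x y) \<le> 1" for y
    proof -
      have "(\<Sum>x\<in>M ` set_pmf P. q x y) \<le> (\<Sum>x\<in>M ` set_pmf P. (if x = g y then 1 / 2 else 0) + 1 / (2 *
        real (card A)))"
        using ne by (intro sum_mono) (auto simp: q_def)
      also have "\<dots> \<le> 1 / 2 + real (card (M ` set_pmf P)) / (2 * real (card A))"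
        using fin by (simp add: sum.distrib)
      also have "\<dots> \<le> 1 / 2 + real (card A) / (2 * real (card A))"
        using MA by (intro add_left_mono divide_right_mono) (auto intro: card_mono)
      also have "\<dots> = 1" using ne by simp
      finally show ?thesis .
    qed
  qed (use ne in \<open>auto simp: q_def\<close>)
  \<comment> \<open>Minus the logarithm of \<open>q\<close> is 1 when the estimate is right and
    \<open>1 + log 2 (card A)\<close> when it is wrong.\<close>
  also have "\<dots> \<le> ex P (\<lambda>\<omega>. 1 + of_bool (\<omega> \<in> {\<omega>. g (Y \<omega>) \<noteq> M \<omega>}) * log 2 (card A))"
    using ne by (intro ex_mono) (auto simp: q_def log_divide log_mult)
  also have "\<dots> = 1 + measure_pmf.prob P {\<omega>. g (Y \<omega>) \<noteq> M \<omega>} * log 2 (card A)"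
    by (simp only: ex_add ex_cmult_right ex_const[OF fin] ex_of_bool[OF fin])
  also have "\<dots> \<le> 1 + e * log 2 (card A)"
    using err c1 by (intro add_left_mono mult_right_mono) auto
  finally show ?thesis .
qed

text \<open>The grouping property of entropy: \<open>L\<close> names the component of the mixture,
  so the joint probability is \<open>pmf M m\<close> times the probability within that component.
  With the time-sharing law as \<open>M\<close>, conditioning on \<open>Q\<close> becomes an
  average.\<close>

lemma ent_mixture:
  assumes fin: "finite (set_pmf M)" "\<And>m. m \<in> set_pmf M \<Longrightarrow> finite (set_pmf (K m))"
    and L: "\<And>m \<omega>. m \<in> set_pmf M \<Longrightarrow> \<omega> \<in> set_pmf (K m) \<Longrightarrow> L \<omega> = m"
  shows "ent (bind_pmf M K) (\<lambda>\<omega>. (X \<omega>, L \<omega>)) = ent M (\<lambda>m. m) + ex M (\<lambda>m. ent (K m) X)"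
proof -
  have pr: "pmf (map_pmf (\<lambda>\<omega>. (X \<omega>, L \<omega>)) (bind_pmf M K)) (x, m) = pmf M m * pmf (map_pmf X (K m))
    x"
    if m: "m \<in> set_pmf M" for x m
  proof -
    have "pmf (map_pmf (\<lambda>\<omega>. (X \<omega>, L \<omega>)) (bind_pmf M K)) (x, m) =
        ex (bind_pmf M K) (\<lambda>\<omega>. of_bool (\<omega> \<in> {\<omega>. X \<omega> = x \<and> L \<omega> = m}))"
      using fin by (subst ex_of_bool) (auto simp: pmf_map vimage_def)
    also have "\<dots> = ex M (\<lambda>m'. ex (K m') (\<lambda>\<omega>. of_bool (\<omega> \<in> {\<omega>. X \<omega> = x \<and> L \<omega> = m})))"
      using fin by (rule ex_bind)
    also have "\<dots> = ex M (\<lambda>m'. if m' = m then pmf (map_pmf X (K m)) x else 0)"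
    proof (rule ex_cong)
      fix m' assume m': "m' \<in> set_pmf M"
      have "ex (K m') (\<lambda>\<omega>. of_bool (\<omega> \<in> {\<omega>. X \<omega> = x \<and> L \<omega> = m})) =
          measure_pmf.prob (K m') {\<omega>. X \<omega> = x \<and> L \<omega> = m}"
        using fin m' by (simp only: ex_of_bool)
      also have "\<dots> = measure_pmf.prob (K m') {\<omega>. X \<omega> = x \<and> m' = m}"
        using L[OF m'] by (intro prob_cong_set) auto
      finally show "ex (K m') (\<lambda>\<omega>. of_bool (\<omega> \<in> {\<omega>. X \<omega> = x \<and> L \<omega> = m})) =
          (if m' = m then pmf (map_pmf X (K m)) x else 0)"
        by (auto simp: pmf_map vimage_def)
    qed
    also have "\<dots> = pmf M m * pmf (map_pmf X (K m)) x"
      unfolding ex_def using m fin by (simp add: if_distrib[of "\<lambda>u. _ * u"] sum.delta cong: if_cong)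
    finally show ?thesis .
  qed
  have "ent (bind_pmf M K) (\<lambda>\<omega>. (X \<omega>, L \<omega>)) =
      ex M (\<lambda>m. ex (K m) (\<lambda>\<omega>. - log 2 (pmf (map_pmf (\<lambda>\<omega>. (X \<omega>, L \<omega>)) (bind_pmf M K)) (X \<omega>, L \<omega>))))"
    unfolding ent_def using fin by (rule ex_bind)
  also have "\<dots> = ex M (\<lambda>m. ex (K m) (\<lambda>\<omega>. - log 2 (pmf M m) + - log 2 (pmf (map_pmf X (K m)) (X
    \<omega>))))"
  proof (intro ex_cong)
    fix m \<omega> assume m: "m \<in> set_pmf M" and w: "\<omega> \<in> set_pmf (K m)"
    show "- log 2 (pmf (map_pmf (\<lambda>\<omega>. (X \<omega>, L \<omega>)) (bind_pmf M K)) (X \<omega>, L \<omega>)) =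
      - log 2 (pmf M m) + - log 2 (pmf (map_pmf X (K m)) (X \<omega>))"
      using pmf_map_pos[OF w, where X = X] pmf_positive[OF m] L[OF m w] pr[OF m]
      by (simp add: log_mult)
  qed
  also have "\<dots> = ex M (\<lambda>m. - log 2 (pmf M m) + ent (K m) X)"
    using fin by (intro ex_cong) (simp only: ex_add ex_const ent_def)
  also have "\<dots> = ent M (\<lambda>m. m) + ex M (\<lambda>m. ent (K m) X)"
    by (simp only: ex_add ent_def map_pmf_ident)
  finally show ?thesis .
qed

lemma ent_label:
  assumes fin: "finite (set_pmf M)" "\<And>m. m \<in> set_pmf M \<Longrightarrow> finite (set_pmf (K m))"
    and L: "\<And>m \<omega>. m \<in> set_pmf M \<Longrightarrow> \<omega> \<in> set_pmf (K m) \<Longrightarrow> L \<omega> = m"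
  shows "ent (bind_pmf M K) L = ent M (\<lambda>m. m)"
proof -
  have "ent (bind_pmf M K) L = ent (bind_pmf M K) (\<lambda>\<omega>. ((), L \<omega>))"
    by (rule ent_cong) auto
  also have "\<dots> = ent M (\<lambda>m. m)"
    using ent_mixture[OF fin L, where X = "\<lambda>_. ()"] fin by (simp add: ent_unit cong: ex_cong)
  finally show ?thesis .
qed

lemma cent_mixture:
  assumes fin: "finite (set_pmf M)" "\<And>m. m \<in> set_pmf M \<Longrightarrow> finite (set_pmf (K m))"
    and L: "\<And>m \<omega>. m \<in> set_pmf M \<Longrightarrow> \<omega> \<in> set_pmf (K m) \<Longrightarrow> L \<omega> = m"
  shows "cent (bind_pmf M K) X (\<lambda>\<omega>. (Z \<omega>, L \<omega>)) = ex M (\<lambda>m. cent (K m) X Z)"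
    and "cent (bind_pmf M K) X L = ex M (\<lambda>m. ent (K m) X)"
proof -
  have "ent (bind_pmf M K) (\<lambda>\<omega>. (X \<omega>, Z \<omega>, L \<omega>)) = ent (bind_pmf M K) (\<lambda>\<omega>. ((X \<omega>, Z \<omega>), L \<omega>))"
    by (rule ent_cong) auto
  then show "cent (bind_pmf M K) X (\<lambda>\<omega>. (Z \<omega>, L \<omega>)) = ex M (\<lambda>m. cent (K m) X Z)"
    by (simp add: cent_def ent_mixture[OF fin L] ex_diff)
  show "cent (bind_pmf M K) X L = ex M (\<lambda>m. ent (K m) X)"
    by (simp add: cent_def ent_mixture[OF fin L] ent_label[OF fin L])
qed

section \<open>A one-shot coding theorem\<close>

lemma ex_swap: "ex P (\<lambda>x. ex Q (\<lambda>y. f x y)) = ex Q (\<lambda>y. ex P (\<lambda>x. f x y))"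
  unfolding ex_def sum_distrib_left by (subst sum.swap) (simp add: algebra_simps)

lemma ex_pair:
  assumes "finite (set_pmf P)" "finite (set_pmf Q)"
  shows "ex (pair_pmf P Q) f = ex P (\<lambda>x. ex Q (\<lambda>y. f (x, y)))"
  unfolding pair_pmf_def using assms by (simp add: ex_bind)

lemma ex_le_exists:
  assumes "finite (set_pmf P)"
  shows "\<exists>x\<in>set_pmf P. f x \<le> ex P f"
proof (rule ccontr)
  assume "\<not> ?thesis"
  then have less: "\<And>x. x \<in> set_pmf P \<Longrightarrow> ex P f < f x" by auto
  have "(\<Sum>x\<in>set_pmf P. pmf P x * ex P f) < (\<Sum>x\<in>set_pmf P. pmf P x * f x)"
    using assms less by (intro sum_strict_mono) (auto simp: set_pmf_not_empty pmf_positive)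
  also have "(\<Sum>x\<in>set_pmf P. pmf P x * ex P f) = ex P f"
    using ex_const[OF assms, of "ex P f"] by (simp add: ex_def)
  finally show False by (simp add: ex_def)
qed

lemma finite_set_Pi_pmf:
  assumes "finite A" "\<And>x. x \<in> A \<Longrightarrow> finite (set_pmf (p x))"
  shows "finite (set_pmf (Pi_pmf A d p))"
  using assms by (subst set_Pi_pmf) (auto intro!: finite_PiE_dflt)

lemma ex_Pi_pmf1:
  assumes "finite A" "x \<in> A" "\<And>x. x \<in> A \<Longrightarrow> finite (set_pmf (p x))"
  shows "ex (Pi_pmf A d p) (\<lambda>f. g (f x)) = ex (p x) g"
proof -
  have "ex (Pi_pmf A d p) (\<lambda>f. g (f x)) = ex (map_pmf (\<lambda>f. f x) (Pi_pmf A d p)) g"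
    using assms by (simp add: ex_map finite_set_Pi_pmf)
  then show ?thesis using assms by (simp add: Pi_pmf_component)
qed

text \<open>Within each of the random functions drawn below, only the pairwise independence of two
  values is used.\<close>

lemma ex_Pi_pmf2:
  assumes A: "finite A" "x \<in> A" "y \<in> A" "x \<noteq> y" "\<And>x. x \<in> A \<Longrightarrow> finite (set_pmf (p x))"
  shows "ex (Pi_pmf A d p) (\<lambda>f. g (f x) (f y)) = ex (p x) (\<lambda>a. ex (p y) (\<lambda>b. g a b))"
proof -
  define A' where "A' = A - {x}"
  have A': "A = insert x A'" "finite A'" "x \<notin> A'" "y \<in> A'"
    using A by (auto simp: A'_def)
  have fin: "finite (set_pmf (Pi_pmf A' d p))"
    using A A' by (intro finite_set_Pi_pmf) auto
  have "ex (Pi_pmf A d p) (\<lambda>f. g (f x) (f y)) =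
      ex (p x) (\<lambda>a. ex (Pi_pmf A' d p) (\<lambda>f. g a (f y)))"
    unfolding A'(1) using A' A fin by (subst Pi_pmf_insert') (auto simp: ex_bind intro!: ex_cong)
  also have "\<dots> = ex (p x) (\<lambda>a. ex (p y) (\<lambda>b. g a b))"
    using A A' by (intro ex_cong ex_Pi_pmf1[where g = "g _"]) auto
  finally show ?thesis .
qed

definition unif :: "nat \<Rightarrow> nat pmf" where
  "unif k = pmf_of_set {1..k}"

lemma set_unif: "0 < k \<Longrightarrow> set_pmf (unif k) = {1..k}"
  by (simp add: unif_def)

lemma ex_unif: "0 < k \<Longrightarrow> ex (unif k) f = (\<Sum>i\<in>{1..k}. f i) / k"
  by (simp add: ex_def unif_def sum_divide_distrib)

lemma fin_unif [simp]: "0 < k \<Longrightarrow> finite (set_pmf (unif k))"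
  by (simp add: set_unif)

lemma ex_unif_eq: "i \<in> {1..k} \<Longrightarrow> ex (unif k) (\<lambda>j. of_bool (j = i)) = 1 / k"
  by (subst ex_unif) (auto simp: of_bool_def)

lemma ex_unif_le: "j \<le> k \<Longrightarrow> 0 < k \<Longrightarrow> ex (unif k) (\<lambda>i. of_bool (i \<le> j)) = j / k"
proof -
  assume j: "j \<le> k" "0 < k"
  have "(\<Sum>i\<in>{1..k}. of_bool (i \<le> j) :: real) = (\<Sum>i\<in>{1..j}. 1)"
    using j by (intro sum.mono_neutral_cong_right) auto
  then show ?thesis using j by (subst ex_unif) auto
qed

text \<open>
  The one-shot channel: the state law is \<open>S\<close>, the pair of interference \<open>tt u\<close> and output \<open>yy u\<close> seen
  by receiver 1 is coded into \<open>u\<close>, whose law given the state is \<open>W s\<close>; \<open>V\<close> is the law of the second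
  input and \<open>f x t\<close> the output at receiver 2.  The interference sequences are hashed into
  \<open>K\<close> values, of which only the first \<open>L21\<close> are used as messages.
\<close>
locale one_shot =
  fixes S :: "'s pmf" and W :: "'s \<Rightarrow> 'u pmf" and V :: "'x pmf"
    and tt :: "'u \<Rightarrow> 't" and yy :: "'u \<Rightarrow> 'y" and f :: "'x \<Rightarrow> 't \<Rightarrow> 'z"
    and K L1 L21 L2 :: nat and e :: real
  assumes finS: "finite (set_pmf S)" and finW: "\<And>s. s \<in> set_pmf S \<Longrightarrow> finite (set_pmf (W s))"
    and finV: "finite (set_pmf V)"
    and inj_u: "\<And>u u'. tt u = tt u' \<Longrightarrow> yy u = yy u' \<Longrightarrow> u = u'"
    and inj_f: "\<And>x. x \<in> set_pmf V \<Longrightarrow> inj_on (f x) (\<Union>s\<in>set_pmf S. tt ` set_pmf (W s))"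
    and L1: "1 \<le> L1" and L21: "1 \<le> L21" "L21 \<le> K" and L2: "1 \<le> L2" and e: "0 < e"
begin

definition TT :: "'t set" where "TT = (\<Union>s\<in>set_pmf S. tt ` set_pmf (W s))"
definition YY :: "'y set" where "YY = (\<Union>s\<in>set_pmf S. yy ` set_pmf (W s))"

definition pT :: "'t pmf" where "pT = map_pmf tt (bind_pmf S W)"
definition pZt :: "'t \<Rightarrow> 'z pmf" where "pZt t = map_pmf (\<lambda>x. f x t) V"
definition pZ :: "'z pmf" where "pZ = bind_pmf pT pZt"

text \<open>
  The factors are \<open>K L1 - 1\<close>, \<open>K - 1\<close> and \<open>L1 - 1\<close> so that the conditions become void for a
  single message: a rate may be 0 because the matching entropy is 0, and then no sequence has small probability.
\<close>
definition good :: "'s \<Rightarrow> 'u set" where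
  "good s = {u \<in> set_pmf (W s). (real K * L1 - 1) * pmf (W s) u \<le> e \<and>
     (real K - 1) * pmf (map_pmf tt (W s)) (tt u) \<le> e \<and>
     (real L1 - 1) * pmf (map_pmf yy (W s)) (yy u) \<le> e}"

text \<open>The clauses control the expected number of false codewords, first those with the true
  interference, then those with another one. In the second, \<open>L21 / K\<close> is the chance
  that another sequence hashes to a possible message, and the comparison of \<open>pmf pZ z\<close>
  with \<open>pmf pT t\<close> makes the sum over all such sequences at most
  \<open>e\<close>.\<close>

definition test :: "'t \<Rightarrow> 'z \<Rightarrow> bool" where
  "test t z \<longleftrightarrow> (real L2 - 1) * pmf (pZt t) z \<le> e \<and>
     (real L2 - 1) * real L21 / real K * pmf pZ z \<le> e * pmf pT t"

definition joint :: "('s \<times> 'u \<times> 'x) pmf" where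
  "joint = bind_pmf S (\<lambda>s. bind_pmf (W s) (\<lambda>u. map_pmf (\<lambda>x. (s, u, x)) V))"

definition bad :: "('s \<times> 'u \<times> 'x) set" where
  "bad = {(s, u, x). u \<notin> good s \<or> \<not> test (tt u) (f x (tt u))}"

section \<open>Random hash functions and codebook\<close>

definition hashT :: "('t \<Rightarrow> nat) pmf" where "hashT = Pi_pmf TT 1 (\<lambda>_. unif K)"
definition hashY :: "('y \<Rightarrow> nat) pmf" where "hashY = Pi_pmf YY 1 (\<lambda>_. unif L1)"
definition book :: "(nat \<Rightarrow> 'x) pmf" where
  "book = Pi_pmf {1..L2} (SOME x. x \<in> set_pmf V) (\<lambda>_. V)"
definition codes :: "(('t \<Rightarrow> nat) \<times> ('y \<Rightarrow> nat) \<times> (nat \<Rightarrow> 'x)) pmf" where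
  "codes = pair_pmf hashT (pair_pmf hashY book)"

lemma finTT: "finite TT" and finYY: "finite YY"
  using finS finW by (auto simp: TT_def YY_def)

lemma Kpos: "0 < K" using L21 by simp

lemma fin_codes: "finite (set_pmf hashT)" "finite (set_pmf hashY)" "finite (set_pmf book)"
    "finite (set_pmf codes)"
proof -
  show h: "finite (set_pmf hashT)" "finite (set_pmf hashY)" "finite (set_pmf book)"
    unfolding hashT_def hashY_def book_def using finTT finYY finV Kpos L1
    by (intro finite_set_Pi_pmf; simp)+
  then show "finite (set_pmf codes)"
    by (simp add: codes_def)
qed

lemma tt_TT: "s \<in> set_pmf S \<Longrightarrow> u \<in> set_pmf (W s) \<Longrightarrow> tt u \<in> TT"
  and yy_YY: "s \<in> set_pmf S \<Longrightarrow> u \<in> set_pmf (W s) \<Longrightarrow> yy u \<in> YY"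
  by (auto simp: TT_def YY_def)

lemma good_W: "u \<in> good s \<Longrightarrow> u \<in> set_pmf (W s)"
  by (simp add: good_def)

lemma fin_good: "s \<in> set_pmf S \<Longrightarrow> finite (good s)"
  using finW by (auto simp: good_def)

lemma ex_codes: "ex codes (\<lambda>(h, h1, c). a h * b h1 * d c) = ex hashT a * ex hashY b * ex book d"
  unfolding codes_def using fin_codes
  by (simp add: ex_pair ex_cmult ex_cmult_right mult.assoc)

lemma ex_hashT1: "t \<in> TT \<Longrightarrow> m \<in> {1..K} \<Longrightarrow> ex hashT (\<lambda>h. of_bool (h t = m)) = 1 / K"
  unfolding hashT_def using finTT Kpos
  by (subst ex_Pi_pmf1[where g = "\<lambda>i. of_bool (i = m)"]) (auto simp: ex_unif_eq)

lemma ex_hashY1: "y \<in> YY \<Longrightarrow> m \<in> {1..L1} \<Longrightarrow> ex hashY (\<lambda>h. of_bool (h y = m)) = 1 / L1"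
  unfolding hashY_def using finYY L1
  by (subst ex_Pi_pmf1[where g = "\<lambda>i. of_bool (i = m)"]) (auto simp: ex_unif_eq)

lemma ex_hashT2:
  assumes "t \<in> TT" "t' \<in> TT" "m \<in> {1..K}"
  shows "ex hashT (\<lambda>h. of_bool (h t = m) * of_bool (h t' = m)) =
    (if t = t' then real K else 1) / (real K)\<^sup>2"
proof (cases "t = t'")
  case True
  then show ?thesis
    using ex_hashT1[OF assms(1,3)] Kpos by (simp add: power2_eq_square flip: of_bool_conj)
next
  case False
  then have "ex hashT (\<lambda>h. of_bool (h t = m) * of_bool (h t' = m)) =
      ex (unif K) (\<lambda>a. ex (unif K) (\<lambda>b. of_bool (a = m) * of_bool (b = m)))"
    unfolding hashT_def using assms finTT Kpos
    by (intro ex_Pi_pmf2[where g = "\<lambda>a b. of_bool (a = m) * of_bool (b = m)"]) auto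
  also have "\<dots> = 1 / K * (1 / K)"
    by (simp only: ex_cmult ex_cmult_right ex_unif_eq[OF assms(3)])
  finally show ?thesis
    using False by (simp add: power2_eq_square)
qed

lemma ex_hashY2:
  assumes "y \<in> YY" "y' \<in> YY" "m \<in> {1..L1}"
  shows "ex hashY (\<lambda>h. of_bool (h y = m) * of_bool (h y' = m)) =
    (if y = y' then real L1 else 1) / (real L1)\<^sup>2"
proof (cases "y = y'")
  case True
  then show ?thesis
    using ex_hashY1[OF assms(1,3)] L1 by (simp add: power2_eq_square flip: of_bool_conj)
next
  case False
  then have "ex hashY (\<lambda>h. of_bool (h y = m) * of_bool (h y' = m)) =
      ex (unif L1) (\<lambda>a. ex (unif L1) (\<lambda>b. of_bool (a = m) * of_bool (b = m)))"
    unfolding hashY_def using assms finYY L1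
    by (intro ex_Pi_pmf2[where g = "\<lambda>a b. of_bool (a = m) * of_bool (b = m)"]) auto
  also have "\<dots> = 1 / L1 * (1 / L1)"
    by (simp only: ex_cmult ex_cmult_right ex_unif_eq[OF assms(3)])
  finally show ?thesis
    using False by (simp add: power2_eq_square)
qed

lemma ex_hashT_le:
  assumes "t \<in> TT" "t' \<in> TT" "t \<noteq> t'" "m \<in> {1..K}"
  shows "ex hashT (\<lambda>h. of_bool (h t = m) * of_bool (h t' \<le> L21)) = 1 / K * (L21 / K)"
proof -
  have "ex hashT (\<lambda>h. of_bool (h t = m) * of_bool (h t' \<le> L21)) =
      ex (unif K) (\<lambda>a. ex (unif K) (\<lambda>b. of_bool (a = m) * of_bool (b \<le> L21)))"
    unfolding hashT_def using assms finTT Kpos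
    by (intro ex_Pi_pmf2[where g = "\<lambda>a b. of_bool (a = m) * of_bool (b \<le> L21)"]) auto
  also have "\<dots> = 1 / K * (L21 / K)"
    by (simp only: ex_cmult ex_cmult_right ex_unif_eq[OF assms(4)] ex_unif_le[OF L21(2) Kpos])
  finally show ?thesis .
qed

section \<open>Second moment of the matching probability\<close>

fun match :: "('t \<Rightarrow> nat) \<times> ('y \<Rightarrow> nat) \<times> (nat \<Rightarrow> 'x) \<Rightarrow> nat \<Rightarrow> nat \<Rightarrow> 'u \<Rightarrow> real" where
  "match (h, h1, c) m1 m21 u = of_bool (h (tt u) = m21) * of_bool (h1 (yy u) = m1)"

definition wgood :: "'s \<Rightarrow> real" where "wgood s = (\<Sum>u\<in>good s. pmf (W s) u)"

definition mass where "mass g m1 m21 s = (\<Sum>u\<in>good s. pmf (W s) u * match g m1 m21 u)"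

text \<open>The expectation of \<open>mass\<close> over the random code, for admissible
  messages.\<close>

definition mean :: "'s \<Rightarrow> real" where "mean s = wgood s / (real K * real L1)"

lemma ex_match:
  assumes "s \<in> set_pmf S" "u \<in> good s" "m1 \<in> {1..L1}" "m21 \<in> {1..L21}"
  shows "ex codes (\<lambda>g. match g m1 m21 u) = 1 / (real K * real L1)"
proof -
  have "ex codes (\<lambda>g. match g m1 m21 u) =
    ex codes (\<lambda>(h, h1, c). of_bool (h (tt u) = m21) * of_bool (h1 (yy u) = m1) * 1)"
    by (rule ex_cong) auto
  then show ?thesis
    using assms L21 tt_TT yy_YY good_W fin_codes
    by (simp only: ex_codes) (simp add: ex_hashT1 ex_hashY1 ex_const)
qed

lemma ex_match2:
  assumes "s \<in> set_pmf S" "u \<in> good s" "u' \<in> good s" "m1 \<in> {1..L1}" "m21 \<in> {1..L21}"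
  shows "ex codes (\<lambda>g. match g m1 m21 u * match g m1 m21 u') =
    (if tt u = tt u' then real K else 1) * (if yy u = yy u' then real L1 else 1) /
    (real K * real L1)\<^sup>2"
proof -
  have "ex codes (\<lambda>g. match g m1 m21 u * match g m1 m21 u') =
    ex codes (\<lambda>(h, h1, c). (of_bool (h (tt u) = m21) * of_bool (h (tt u') = m21)) *
      (of_bool (h1 (yy u) = m1) * of_bool (h1 (yy u') = m1)) * 1)"
    by (rule ex_cong) (auto simp: algebra_simps)
  also have "\<dots> = (if tt u = tt u' then real K else 1) / (real K)\<^sup>2 *
      ((if yy u = yy u' then real L1 else 1) / (real L1)\<^sup>2) * 1"
  proof -
    have "tt u \<in> TT" "tt u' \<in> TT" "yy u \<in> YY" "yy u' \<in> YY" "m21 \<in> {1..K}"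
      using assms L21 tt_TT yy_YY good_W by auto
    then show ?thesis
      using assms(4) fin_codes by (simp only: ex_codes ex_hashT2 ex_hashY2 ex_const)
  qed
  finally show ?thesis by (simp add: power_mult_distrib)
qed

lemma pmf_fiber:
  assumes "s \<in> set_pmf S" "u \<in> good s"
  shows "(\<Sum>u'\<in>good s. of_bool (r u = r u') * pmf (W s) u') \<le> pmf (map_pmf r (W s)) (r u)"
proof -
  have "(\<Sum>u'\<in>good s. of_bool (r u = r u') * pmf (W s) u') = (\<Sum>u'\<in>{u'\<in>good s. r u = r u'}. pmf (W s)
    u')"
    using fin_good[OF assms(1)] by (intro sum.mono_neutral_cong_right) auto
  also have "\<dots> = measure_pmf.prob (W s) {u'\<in>good s. r u = r u'}"
    using fin_good[OF assms(1)] by (simp add: measure_measure_pmf_finite)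
  also have "\<dots> \<le> pmf (map_pmf r (W s)) (r u)"
    unfolding pmf_map by (intro measure_pmf.finite_measure_mono) auto
  finally show ?thesis .
qed

text \<open>Two sequences that share neither interference nor output match independently, so their
  covariance is 0. The three kinds of collision that remain are paid for by the three clauses of
  \<open>good\<close>, each contributing one \<open>e\<close>.\<close>

lemma variance_le:
  assumes s: "s \<in> set_pmf S" and m: "m1 \<in> {1..L1}" "m21 \<in> {1..L21}"
  shows "ex codes (\<lambda>g. (mass g m1 m21 s - mean s)\<^sup>2) \<le> 3 * e * wgood s / (real K * real L1)\<^sup>2"
proof -
  define C where "C = (real K * real L1)\<^sup>2"
  have Cpos: "0 < C" using Kpos L1 by (simp add: C_def)
  have KL: "1 \<le> real K" "1 \<le> real L1" using Kpos L1 by auto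
  then have KL1: "1 \<le> real K * real L1" using mult_mono[of 1 "real K" 1 "real L1"] by simp
  let ?w = "pmf (W s)"
  define d where "d g u = match g m1 m21 u - 1 / (real K * real L1)" for g u
  have sq: "(mass g m1 m21 s - mean s)\<^sup>2 = (\<Sum>u\<in>good s. \<Sum>u'\<in>good s. ?w u * ?w u' * (d g u * d g u'))"
    for g
  proof -
    have "mass g m1 m21 s - mean s = (\<Sum>u\<in>good s. ?w u * d g u)"
      by (simp add: mass_def mean_def wgood_def d_def algebra_simps sum_subtractf
        sum_divide_distrib)
    then show ?thesis
      by (simp add: power2_eq_square sum_product algebra_simps)
  qed
  have cov: "ex codes (\<lambda>g. d g u * d g u') \<le>
      (of_bool (u = u') * (real K * L1 - 1) + of_bool (tt u = tt u') * (real K - 1) +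
       of_bool (yy u = yy u') * (real L1 - 1)) / C" if u: "u \<in> good s" "u' \<in> good s" for u u'
  proof -
    define k l where "k = (if tt u = tt u' then real K else 1)"
      and "l = (if yy u = yy u' then real L1 else 1)"
    have "ex codes (\<lambda>g. d g u * d g u') =
        ex codes (\<lambda>g. match g m1 m21 u * match g m1 m21 u' - 1 / (real K * real L1) * match g m1 m21
          u
          - 1 / (real K * real L1) * match g m1 m21 u' + (1 / (real K * real L1))\<^sup>2)"
      by (intro ex_cong) (simp add: d_def algebra_simps power2_eq_square)
    also have "\<dots> = k * l / C - 1 / C"
      using ex_match2[OF s u m] ex_match[OF s u(1) m] ex_match[OF s u(2) m] fin_codes
      by (simp only: ex_add ex_diff ex_cmult ex_const)
        (simp add: k_def l_def C_def power2_eq_square)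
    also have "\<dots> = (k * l - 1) / C"
      by (simp add: diff_divide_distrib)
    \<comment> \<open>Sharing both components forces \<open>u = u'\<close> by \<open>inj_u\<close>;
      sharing exactly one gives \<open>K - 1\<close> or \<open>L1 - 1\<close>, and sharing none
      gives 0.\<close>
    also have "k * l - 1 \<le> of_bool (u = u') * (real K * L1 - 1) + of_bool (tt u = tt u') * (real K -
      1) +
       of_bool (yy u = yy u') * (real L1 - 1)"
    proof (cases "tt u = tt u' \<and> yy u = yy u'")
      case True
      then have "u = u'" using inj_u by blast
      then show ?thesis using KL by (simp add: k_def l_def)
    next
      case False
      then show ?thesis using KL KL1 by (auto simp: k_def l_def)
    qed
    finally show ?thesis using Cpos by (simp add: divide_right_mono)
  qed
  have "ex codes (\<lambda>g. (mass g m1 m21 s - mean s)\<^sup>2) =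
      (\<Sum>u\<in>good s. \<Sum>u'\<in>good s. ?w u * ?w u' * ex codes (\<lambda>g. d g u * d g u'))"
    by (simp only: sq ex_sum ex_cmult)
  also have "\<dots> \<le> (\<Sum>u\<in>good s. \<Sum>u'\<in>good s. ?w u * ?w u' *
      ((of_bool (u = u') * (real K * L1 - 1) + of_bool (tt u = tt u') * (real K - 1) +
       of_bool (yy u = yy u') * (real L1 - 1)) / C))"
    by (intro sum_mono mult_left_mono cov) auto
  also have "\<dots> = (\<Sum>u\<in>good s. ?w u * ((real K * L1 - 1) * (\<Sum>u'\<in>good s. of_bool (u = u') * ?w u') +
      (real K - 1) * (\<Sum>u'\<in>good s. of_bool (tt u = tt u') * ?w u') +
      (real L1 - 1) * (\<Sum>u'\<in>good s. of_bool (yy u = yy u') * ?w u'))) / C"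
    unfolding sum_divide_distrib sum_distrib_left sum.distrib[symmetric]
    by (intro sum.cong) (simp_all add: field_simps)
  also have "\<dots> \<le> (\<Sum>u\<in>good s. ?w u * (e + e + e)) / C"
  proof (intro divide_right_mono sum_mono mult_left_mono add_mono)
    fix u assume u: "u \<in> good s"
    show "(real K * L1 - 1) * (\<Sum>u'\<in>good s. of_bool (u = u') * ?w u') \<le> e"
      using mult_left_mono[OF pmf_fiber[OF s u, of "\<lambda>u. u"], of "real K * L1 - 1"] u KL1
      by (simp add: good_def)
    show "(real K - 1) * (\<Sum>u'\<in>good s. of_bool (tt u = tt u') * ?w u') \<le> e"
      using mult_left_mono[OF pmf_fiber[OF s u, of tt], of "real K - 1"] u KL
      by (simp add: good_def)
    show "(real L1 - 1) * (\<Sum>u'\<in>good s. of_bool (yy u = yy u') * ?w u') \<le> e"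
      using mult_left_mono[OF pmf_fiber[OF s u, of yy], of "real L1 - 1"] u KL
      by (simp add: good_def)
  qed (use Cpos in auto)
  also have "\<dots> = 3 * e * wgood s / C"
    by (simp add: wgood_def flip: sum_distrib_right)
  finally show ?thesis by (simp add: C_def)
qed


section \<open>Confusion at receiver 2\<close>

fun accept :: "('t \<Rightarrow> nat) \<times> ('y \<Rightarrow> nat) \<times> (nat \<Rightarrow> 'x) \<Rightarrow> 'z \<Rightarrow> 't \<Rightarrow> nat \<Rightarrow> bool" where
  "accept (h, h1, c) z t m2 \<longleftrightarrow> t \<in> TT \<and> h t \<le> L21 \<and> m2 \<in> {1..L2} \<and> f (c m2) t = z \<and> test t z"

text \<open>A competitor with the same \<open>m2\<close> is not listed: by \<open>inj_f\<close> it
  has the true interference and hence the true hash value.\<close>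

fun confused :: "('t \<Rightarrow> nat) \<times> ('y \<Rightarrow> nat) \<times> (nat \<Rightarrow> 'x) \<Rightarrow> nat \<Rightarrow> 'u \<Rightarrow> bool" where
  "confused (h, h1, c) m2 u \<longleftrightarrow> \<not> test (tt u) (f (c m2) (tt u)) \<or>
     (\<exists>m2' t'. m2' \<noteq> m2 \<and> accept (h, h1, c) (f (c m2) (tt u)) t' m2')"

lemma ex_book1: "m2 \<in> {1..L2} \<Longrightarrow> ex book (\<lambda>c. g (c m2)) = ex V g"
  unfolding book_def using finV by (intro ex_Pi_pmf1) auto

lemma ex_book2:
  "m2 \<in> {1..L2} \<Longrightarrow> m2' \<in> {1..L2} \<Longrightarrow> m2 \<noteq> m2' \<Longrightarrow>
    ex book (\<lambda>c. g (c m2) (c m2')) = ex V (\<lambda>x. ex V (\<lambda>x'. g x x'))"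
  unfolding book_def using finV by (intro ex_Pi_pmf2) auto

lemma pmf_pZt: "ex V (\<lambda>x. of_bool (f x t = z)) = pmf (pZt t) z"
  using ex_of_bool[OF finV, of "{x. f x t = z}"] by (simp add: pZt_def pmf_map vimage_def)

lemma set_pT: "set_pmf pT = TT"
  by (auto simp: pT_def TT_def)

lemma pmf_pZ: "pmf pZ z = (\<Sum>t\<in>TT. pmf pT t * pmf (pZt t) z)"
proof -
  have "pmf pZ z = measure_pmf.expectation pT (\<lambda>t. pmf (pZt t) z)"
    by (simp add: pZ_def pmf_bind)
  also have "\<dots> = ex pT (\<lambda>t. pmf (pZt t) z)"
    using finTT by (intro ex_expectation[symmetric]) (simp add: set_pT)
  finally show ?thesis by (simp add: ex_def set_pT)
qed

lemma same_interference:
  assumes "t \<in> TT"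
  shows "(real L2 - 1) * (of_bool (test t z) * pmf (pZt t) z) \<le> e"
  using e by (auto simp: test_def)

text \<open>If \<open>t'\<close> passes the test, its second clause bounds the weight by
  \<open>e / pmf pZ z * pmf pT t'\<close>, and summing over \<open>t'\<close> rebuilds
  \<open>pmf pZ z\<close>. The division is legitimate because \<open>z\<close> is a possible
  output.\<close>

lemma other_interference:
  assumes t: "t \<in> TT" and x: "x \<in> set_pmf V"
  defines "z \<equiv> f x t"
  shows "(real L2 - 1) * (\<Sum>t'\<in>TT - {t}. L21 / K * (of_bool (test t' z) * pmf (pZt t') z)) \<le> e"
proof -
  have "z \<in> set_pmf (pZt t)"
    using x by (auto simp: z_def pZt_def)
  then have "z \<in> set_pmf pZ"
    using t by (auto simp: pZ_def set_pT)
  then have pos: "0 < pmf pZ z" by (rule pmf_positive)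
  have L2': "0 \<le> real L2 - 1" using L2 by simp
  have "(real L2 - 1) * (\<Sum>t'\<in>TT - {t}. L21 / K * (of_bool (test t' z) * pmf (pZt t') z)) \<le>
      (real L2 - 1) * (\<Sum>t'\<in>TT. L21 / K * (of_bool (test t' z) * pmf (pZt t') z))"
    using finTT L2' by (intro mult_left_mono sum_mono2) auto
  also have "\<dots> = (\<Sum>t'\<in>TT. (real L2 - 1) * L21 / K * (of_bool (test t' z) * pmf (pZt t') z))"
    by (simp add: sum_distrib_left mult.assoc)
  also have "\<dots> \<le> (\<Sum>t'\<in>TT. e / pmf pZ z * (pmf pT t' * pmf (pZt t') z))"
  proof (rule sum_mono)
    fix t' assume "t' \<in> TT"
    show "(real L2 - 1) * L21 / K * (of_bool (test t' z) * pmf (pZt t') z) \<le>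
        e / pmf pZ z * (pmf pT t' * pmf (pZt t') z)"
    proof (cases "test t' z")
      case True
      then have "(real L2 - 1) * L21 / K \<le> e / pmf pZ z * pmf pT t'"
        using pos by (simp add: test_def field_simps)
      then have "(real L2 - 1) * L21 / K * pmf (pZt t') z \<le> e / pmf pZ z * pmf pT t' * pmf (pZt t')
        z"
        by (rule mult_right_mono) simp
      then show ?thesis using True by (simp add: mult.assoc)
    qed (use e in simp)
  qed
  also have "\<dots> = e / pmf pZ z * pmf pZ z"
    by (simp add: pmf_pZ sum_distrib_left)
  also have "\<dots> = e" using pos by simp
  finally show ?thesis .
qed

definition missed :: "'t \<Rightarrow> real" where
  "missed t = ex V (\<lambda>x. of_bool (\<not> test t (f x t)))"

text \<open>The factor \<open>match\<close> stays inside the expectation because the choice of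
  \<open>u\<close> depends on the same hashes. A union bound over the true pair failing the test, a
  competitor with the true \<open>t\<close> and one with another \<open>t'\<close> leaves terms that
  factor: for \<open>t' \<noteq> t\<close> the event \<open>h t' \<le> L21\<close> is independent of
  \<open>h t = m21\<close>.\<close>

lemma ex_match_confused:
  assumes s: "s \<in> set_pmf S" and u: "u \<in> good s"
    and m: "m1 \<in> {1..L1}" "m21 \<in> {1..L21}" "m2 \<in> {1..L2}"
  shows "ex codes (\<lambda>g. match g m1 m21 u * of_bool (confused g m2 u)) \<le>
    (missed (tt u) + 2 * e) / (real K * real L1)"
proof -
  define t where "t = tt u"
  have t: "t \<in> TT" "yy u \<in> YY" "m21 \<in> {1..K}"
    using tt_TT[OF s] yy_YY[OF s] good_W[OF u] m L21 by (auto simp: t_def)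
  define M where "M = {1..L2} - {m2}"
  have cM: "real (card M) = real L2 - 1" using m by (simp add: M_def)
  define A where "A = (\<lambda>h::'t \<Rightarrow> nat. of_bool (h t = m21) :: real)"
  define B where "B = (\<lambda>h::'y \<Rightarrow> nat. of_bool (h (yy u) = m1) :: real)"
  define D where "D = (\<lambda>t' (h::'t \<Rightarrow> nat). of_bool (h t = m21) * of_bool (h t' \<le> L21) :: real)"
  define E where "E = (\<lambda>t' x x'. of_bool (test t' (f x t)) * of_bool (f x' t' = f x t) :: real)"
  have pointwise: "match g m1 m21 u * of_bool (confused g m2 u) \<le>
      (\<lambda>(h, h1, c). A h * B h1 * of_bool (\<not> test t (f (c m2) t))) g +
      (\<Sum>m2'\<in>M. (\<lambda>(h, h1, c). A h * B h1 * E t (c m2) (c m2')) g) +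
      (\<Sum>m2'\<in>M. \<Sum>t'\<in>TT - {t}. (\<lambda>(h, h1, c). D t' h * B h1 * E t' (c m2) (c m2')) g)" (is "_ \<le> ?R g")
        for g
  proof (cases g)
    case (fields h h1 c)
    have nn: "0 \<le> (\<Sum>m2'\<in>M. (\<lambda>(h, h1, c). A h * B h1 * E t (c m2) (c m2')) g)"
      "0 \<le> (\<Sum>m2'\<in>M. \<Sum>t'\<in>TT - {t}. (\<lambda>(h, h1, c). D t' h * B h1 * E t' (c m2) (c m2')) g)"
      "0 \<le> (\<lambda>(h, h1, c). A h * B h1 * of_bool (\<not> test t (f (c m2) t))) g"
      by (auto simp: fields A_def B_def D_def E_def intro!: sum_nonneg)
    show ?thesis
    proof (cases "h t = m21 \<and> h1 (yy u) = m1 \<and> confused g m2 u")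
      case False
      then show ?thesis using nn by (auto simp: fields t_def)
    next
      case True
      then have h: "h t = m21" "h1 (yy u) = m1" and conf: "confused g m2 u" by auto
      have "1 \<le> ?R g"
      proof (cases "test t (f (c m2) t)")
        case False
        then show ?thesis using nn h by (simp add: fields A_def B_def)
      next
        case True
        then obtain m2' t' where a: "m2' \<noteq> m2" "accept g (f (c m2) t) t' m2'"
          using conf by (auto simp: fields t_def)
        then have mM: "m2' \<in> M" and t': "t' \<in> TT" by (auto simp: fields M_def)
        have finM: "finite M" by (simp add: M_def)
        show ?thesis
        proof (cases "t' = t")
          case True
          have "1 \<le> (\<Sum>m2'\<in>M. (\<lambda>(h, h1, c). A h * B h1 * E t (c m2) (c m2')) g)"
            using a h True
            by (intro order_trans[OF _ member_le_sum[OF mM _ finM]])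
              (auto simp: fields A_def B_def E_def)
          then show ?thesis using nn by linarith
        next
          case False
          have "1 \<le> (\<Sum>t'\<in>TT - {t}. (\<lambda>(h, h1, c). D t' h * B h1 * E t' (c m2) (c m2')) g)"
            using a h False t' finTT
            by (intro order_trans[OF _ member_le_sum[of t']])
              (auto simp: fields D_def B_def E_def)
          also have "\<dots> \<le> (\<Sum>m2'\<in>M. \<Sum>t'\<in>TT - {t}. (\<lambda>(h, h1, c). D t' h * B h1 * E t' (c m2) (c m2'))
            g)"
            by (rule member_le_sum[OF mM _ finM])
              (auto simp: fields D_def B_def E_def intro!: sum_nonneg)
          finally show ?thesis using nn by linarith
        qed
      qed
      then show ?thesis using True by (simp add: fields t_def)
    qed
  qed
  have EA: "ex hashT A = 1 / K" and EB: "ex hashY B = 1 / L1"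
    using t m ex_hashT1 ex_hashY1 by (simp_all add: A_def B_def)
  have ED: "ex hashT (D t') = 1 / K * (L21 / K)" if "t' \<in> TT - {t}" for t'
    unfolding D_def using t that by (intro ex_hashT_le) auto
  have EE: "ex book (\<lambda>c. E t' (c m2) (c m2')) = ex V (\<lambda>x. of_bool (test t' (f x t)) * pmf (pZt t')
    (f x t))"
    if "m2' \<in> M" for m2' t'
  proof -
    have "ex book (\<lambda>c. E t' (c m2) (c m2')) = ex V (\<lambda>x. ex V (\<lambda>x'. E t' x x'))"
      using that m by (intro ex_book2) (auto simp: M_def)
    then show ?thesis by (simp only: E_def ex_cmult pmf_pZt)
  qed
  have "ex codes (\<lambda>g. match g m1 m21 u * of_bool (confused g m2 u)) \<le> ex codes ?R"
    by (intro ex_mono pointwise)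
  also have "\<dots> = 1 / K * (1 / L1) * missed t +
      (\<Sum>m2'\<in>M. 1 / K * (1 / L1) * ex V (\<lambda>x. of_bool (test t (f x t)) * pmf (pZt t) (f x t))) +
      (\<Sum>m2'\<in>M. \<Sum>t'\<in>TT - {t}. 1 / K * (L21 / K) * (1 / L1) *
        ex V (\<lambda>x. of_bool (test t' (f x t)) * pmf (pZt t') (f x t)))"
    using m(3) by (simp only: ex_add ex_sum ex_codes EA EB)
      (simp add: ED EE missed_def ex_book1[where g = "\<lambda>x. of_bool (\<not> test t (f x t))"])
  also have "\<dots> = 1 / K * (1 / L1) * (missed t +
      ex V (\<lambda>x. (real L2 - 1) * (of_bool (test t (f x t)) * pmf (pZt t) (f x t))) +
      ex V (\<lambda>x. (real L2 - 1) * (\<Sum>t'\<in>TT - {t}. L21 / K * (of_bool (test t' (f x t)) * pmf (pZt t')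
        (f x t)))))"
    by (simp only: ex_cmult ex_sum sum_constant cM sum_distrib_left[symmetric])
      (use Kpos L1 in \<open>simp add: field_simps\<close>)
  also have "\<dots> \<le> 1 / K * (1 / L1) * (missed t + ex V (\<lambda>_. e) + ex V (\<lambda>_. e))"
    by (intro mult_left_mono add_mono ex_mono same_interference other_interference t) auto
  also have "\<dots> = (missed t + 2 * e) / (real K * real L1)"
    by (simp add: ex_const finV)
  finally show ?thesis by (simp add: t_def)
qed


section \<open>The likelihood encoder and its loss\<close>

text \<open>Encoder 1 does not know \<open>m2\<close>, hence the average over it.\<close>

definition cost where "cost g u = ex (unif L2) (\<lambda>m2. of_bool (confused g m2 u))"

definition fails where
  "fails g m1 m21 s \<longleftrightarrow> wgood s < 1 / 2 \<or> mass g m1 m21 s < mean s / 2"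

text \<open>Under the likelihood encoder the expected cost has the random denominator
  \<open>mass\<close>. Replacing it by its lower bound \<open>mean s / 2\<close> leaves a sum whose
  expectation over the codes is given by \<open>ex_match_confused\<close>.\<close>

definition excess where
  "excess g m1 m21 s = 2 / mean s * (\<Sum>u\<in>good s. pmf (W s) u * (match g m1 m21 u * cost g u))"

definition loss where
  "loss g m1 m21 s = of_bool (fails g m1 m21 s) + of_bool (1 / 2 \<le> wgood s) * excess g m1 m21 s"

lemma match_nonneg: "0 \<le> match g m1 m21 u"
  by (cases g) auto

lemma cost_nonneg: "0 \<le> cost g u"
  by (auto simp: cost_def intro!: ex_nonneg)

lemma excess_nonneg: "0 \<le> excess g m1 m21 s"
  unfolding excess_def mean_def wgood_def
  by (intro mult_nonneg_nonneg divide_nonneg_nonneg sum_nonneg match_nonneg cost_nonneg) auto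

text \<open>
  The likelihood encoder picks a matching \<open>u\<close> with probability proportional to its weight; a
  codeword of least cost does at least as well.
\<close>
lemma choose_codeword:
  assumes s: "s \<in> set_pmf S" and nf: "\<not> fails g m1 m21 s"
  shows "\<exists>u\<in>good s. match g m1 m21 u = 1 \<and> cost g u \<le> excess g m1 m21 s"
proof -
  let ?X = "{u \<in> good s. match g m1 m21 u = 1}"
  have w: "wgood s \<ge> 1 / 2" "mass g m1 m21 s \<ge> mean s / 2"
    using nf by (auto simp: fails_def)
  have mpos: "0 < mean s"
    using w Kpos L1 by (simp add: mean_def)
  have m01: "match g m1 m21 u = 0 \<or> match g m1 m21 u = 1" for u
    by (cases g) auto
  have fin: "finite ?X" using fin_good[OF s] by simp
  have "?X \<noteq> {}"
  proof
    assume "?X = {}"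
    then have "mass g m1 m21 s = 0"
      unfolding mass_def using m01 by (intro sum.neutral) fastforce
    then show False using w mpos by simp
  qed
  then obtain u where u: "u \<in> ?X" and least: "\<And>u'. u' \<in> ?X \<Longrightarrow> cost g u \<le> cost g u'"
    using arg_min_if_finite[OF fin, of "cost g"] by (meson linorder_not_le)
  have "cost g u * (mean s / 2) \<le> cost g u * mass g m1 m21 s"
    using w cost_nonneg by (intro mult_left_mono) auto
  also have "\<dots> = (\<Sum>u'\<in>good s. pmf (W s) u' * (match g m1 m21 u' * cost g u))"
    by (simp add: mass_def sum_distrib_left algebra_simps)
  also have "\<dots> \<le> (\<Sum>u'\<in>good s. pmf (W s) u' * (match g m1 m21 u' * cost g u'))"
  proof (rule sum_mono)
    fix u' assume "u' \<in> good s"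
    then have "match g m1 m21 u' * cost g u \<le> match g m1 m21 u' * cost g u'"
      using m01[of u'] least[of u'] by auto
    then show "pmf (W s) u' * (match g m1 m21 u' * cost g u) \<le>
        pmf (W s) u' * (match g m1 m21 u' * cost g u')"
      by (rule mult_left_mono) simp
  qed
  finally have "cost g u \<le> excess g m1 m21 s"
    using mpos by (simp add: excess_def field_simps)
  then show ?thesis using u by auto
qed

text \<open>If \<open>wgood s < 1 / 2\<close>, the first term alone exceeds 1. Otherwise Chebyshev's
  inequality with \<open>variance_le\<close> gives at most \<open>24 * e\<close> for failure, and
  the excess is at most 4 times the missed tests plus \<open>8 * e\<close>, where 4 bounds
  \<open>2 / wgood s\<close>.\<close>

lemma ex_loss:
  assumes s: "s \<in> set_pmf S" and m: "m1 \<in> {1..L1}" "m21 \<in> {1..L21}"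
  shows "ex codes (\<lambda>g. loss g m1 m21 s) \<le>
    2 * ex (W s) (\<lambda>u. of_bool (u \<notin> good s)) + 4 * ex (W s) (\<lambda>u. missed (tt u)) + 32 * e"
proof -
  have wg: "wgood s = ex (W s) (\<lambda>u. of_bool (u \<in> good s))"
    unfolding wgood_def ex_def using finW[OF s]
    by (intro sum.mono_neutral_cong_left) (auto simp: good_def)
  have nb: "ex (W s) (\<lambda>u. of_bool (u \<notin> good s)) = 1 - wgood s"
  proof -
    have "ex (W s) (\<lambda>u. of_bool (u \<notin> good s)) = ex (W s) (\<lambda>u. 1 - of_bool (u \<in> good s))"
      by (rule ex_cong) auto
    then show ?thesis by (simp add: ex_diff wg ex_const finW s)
  qed
  have missed0: "0 \<le> missed t" for t
    by (auto simp: missed_def intro!: ex_nonneg)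
  have exm0: "0 \<le> ex (W s) (\<lambda>u. missed (tt u))"
    by (intro ex_nonneg missed0)
  show ?thesis
  proof (cases "wgood s < 1 / 2")
    case True
    then have "ex codes (\<lambda>g. loss g m1 m21 s) = 1"
      using fin_codes by (simp add: loss_def fails_def ex_const)
    also have "\<dots> \<le> 2 * ex (W s) (\<lambda>u. of_bool (u \<notin> good s)) + 4 * ex (W s) (\<lambda>u. missed (tt u)) + 32 *
      e"
      using True e exm0 by (simp add: nb)
    finally show ?thesis .
  next
    case False
    define N where "N = real K * real L1"
    have N: "0 < N" using Kpos L1 by (simp add: N_def)
    have mean: "mean s = wgood s / N" by (simp add: mean_def N_def)
    have mpos: "0 < mean s" using False N by (simp add: mean)
    have cheb: "of_bool (mass g m1 m21 s < mean s / 2) \<le> 4 / (mean s)\<^sup>2 * (mass g m1 m21 s - mean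
      s)\<^sup>2" for g
    proof (cases "mass g m1 m21 s < mean s / 2")
      case True
      then have "mean s / 2 \<le> \<bar>mass g m1 m21 s - mean s\<bar>" using mpos by (auto simp: abs_if)
      then have "(mean s / 2)\<^sup>2 \<le> (mass g m1 m21 s - mean s)\<^sup>2"
        using mpos by (metis abs_le_square_iff abs_of_pos half_gt_zero_iff)
      then show ?thesis using True mpos by (simp add: field_simps power2_eq_square)
    qed auto
    have "ex codes (\<lambda>g. of_bool (fails g m1 m21 s)) \<le>
        ex codes (\<lambda>g. 4 / (mean s)\<^sup>2 * (mass g m1 m21 s - mean s)\<^sup>2)"
      using False cheb by (intro ex_mono) (simp add: fails_def)
    also have "\<dots> \<le> 4 / (mean s)\<^sup>2 * (3 * e * wgood s / N\<^sup>2)"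
      unfolding ex_cmult N_def by (intro mult_left_mono variance_le s m) auto
    also have "\<dots> = 12 * e / wgood s"
      using False N by (simp add: mean power2_eq_square field_simps)
    also have "\<dots> \<le> 12 * e / (1 / 2)"
      using False e by (intro divide_left_mono) auto
    finally have fl: "ex codes (\<lambda>g. of_bool (fails g m1 m21 s)) \<le> 24 * e" by simp
    have "ex codes (\<lambda>g. excess g m1 m21 s) = 2 / mean s *
        (\<Sum>u\<in>good s. pmf (W s) u * ex (unif L2) (\<lambda>m2. ex codes (\<lambda>g. match g m1 m21 u * of_bool
          (confused g m2 u))))"
      unfolding excess_def ex_cmult ex_sum cost_def
      by (subst ex_swap) (simp only: ex_cmult)
    also have "\<dots> \<le> 2 / mean s *
        (\<Sum>u\<in>good s. pmf (W s) u * ex (unif L2) (\<lambda>m2. (missed (tt u) + 2 * e) / N))"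
      unfolding N_def using L2 mpos
      by (intro mult_left_mono sum_mono ex_mono ex_match_confused[OF s] m) (auto simp: set_unif)
    also have "\<dots> = 2 / wgood s * (\<Sum>u\<in>good s. pmf (W s) u * (missed (tt u) + 2 * e))"
      using L2 N by (simp add: ex_const mean flip: sum_divide_distrib)
    also have "\<dots> \<le> 2 / (1 / 2) * (\<Sum>u\<in>set_pmf (W s). pmf (W s) u * (missed (tt u) + 2 * e))"
      using False finW[OF s] e missed0
      by (intro mult_mono sum_mono2 divide_left_mono sum_nonneg)
        (auto simp: good_def intro!: mult_nonneg_nonneg add_nonneg_nonneg)
    also have "\<dots> = 4 * (ex (W s) (\<lambda>u. missed (tt u)) + 2 * e)"
      using finW[OF s] by (simp add: ex_add ex_const flip: ex_def)
    finally have "ex codes (\<lambda>g. excess g m1 m21 s) \<le> 4 * ex (W s) (\<lambda>u. missed (tt u)) + 8 * e" by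
      simp
    moreover have "0 \<le> ex (W s) (\<lambda>u. of_bool (u \<notin> good s))"
      by (intro ex_nonneg) auto
    ultimately show ?thesis
      using fl False by (simp add: loss_def ex_add)
  qed
qed

definition total_loss where
  "total_loss g = ex (unif L1) (\<lambda>m1. ex (unif L21) (\<lambda>m21. ex S (\<lambda>s. loss g m1 m21 s)))"

lemma prob_joint:
  "measure_pmf.prob joint A = ex S (\<lambda>s. ex (W s) (\<lambda>u. ex V (\<lambda>x. of_bool ((s, u, x) \<in> A))))"
proof -
  have finWV: "finite (set_pmf (bind_pmf (W s) (\<lambda>u. map_pmf (\<lambda>x. (s, u, x)) V)))"
    if "s \<in> set_pmf S" for s
    using finW[OF that] finV by auto
  have "measure_pmf.prob joint A = ex joint (\<lambda>x. of_bool (x \<in> A))"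
    using finS finW finV by (intro ex_of_bool[symmetric]) (auto simp: joint_def)
  also have "\<dots> = ex S (\<lambda>s. ex (W s) (\<lambda>u. ex V (\<lambda>x. of_bool ((s, u, x) \<in> A))))"
    unfolding joint_def using finS finW finV
    by (simp add: ex_bind finWV ex_map cong: ex_cong)
  finally show ?thesis .
qed

text \<open>A sequence that is not good and a missed test both lie in \<open>bad\<close>, hence
  \<open>6 = 2 + 4\<close>.\<close>

lemma ex_total_loss: "ex codes total_loss \<le> 6 * measure_pmf.prob joint bad + 32 * e"
proof -
  note pb = prob_joint[of bad]
  have b1: "ex S (\<lambda>s. ex (W s) (\<lambda>u. of_bool (u \<notin> good s))) \<le> measure_pmf.prob joint bad"
  proof -
    have "ex S (\<lambda>s. ex (W s) (\<lambda>u. of_bool (u \<notin> good s))) =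
        ex S (\<lambda>s. ex (W s) (\<lambda>u. ex V (\<lambda>x. of_bool (u \<notin> good s))))"
      by (simp add: ex_const finV)
    also have "\<dots> \<le> measure_pmf.prob joint bad"
      unfolding pb by (intro ex_mono) (auto simp: bad_def)
    finally show ?thesis .
  qed
  have b2: "ex S (\<lambda>s. ex (W s) (\<lambda>u. missed (tt u))) \<le> measure_pmf.prob joint bad"
    unfolding pb missed_def by (intro ex_mono) (auto simp: bad_def)
  have "ex codes total_loss =
      ex (unif L1) (\<lambda>m1. ex (unif L21) (\<lambda>m21. ex S (\<lambda>s. ex codes (\<lambda>g. loss g m1 m21 s))))"
    unfolding total_loss_def
    by (subst ex_swap, intro ex_cong, subst ex_swap, intro ex_cong, subst ex_swap, rule refl)
  also have "\<dots> \<le> ex (unif L1) (\<lambda>m1. ex (unif L21) (\<lambda>m21. ex S (\<lambda>s.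
      2 * ex (W s) (\<lambda>u. of_bool (u \<notin> good s)) + 4 * ex (W s) (\<lambda>u. missed (tt u)) + 32 * e)))"
    using L1 L21 by (intro ex_mono ex_loss) (auto simp: set_unif)
  also have "\<dots> = 2 * ex S (\<lambda>s. ex (W s) (\<lambda>u. of_bool (u \<notin> good s))) +
      4 * ex S (\<lambda>s. ex (W s) (\<lambda>u. missed (tt u))) + 32 * e"
    using L1 L21 finS by (simp only: ex_add ex_cmult ex_const) (simp add: ex_const)
  also have "\<dots> \<le> 6 * measure_pmf.prob joint bad + 32 * e"
    using b1 b2 by simp
  finally show ?thesis .
qed

section \<open>A deterministic code from the random one\<close>

definition source :: "(nat \<times> nat \<times> nat \<times> 's) pmf" where
  "source = pair_pmf (unif L1) (pair_pmf (unif L21) (pair_pmf (unif L2) S))"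

lemma prob_source:
  "measure_pmf.prob source {(m1, m21, m2, s). R m1 m21 m2 s} =
    ex (unif L1) (\<lambda>m1. ex (unif L21) (\<lambda>m21. ex S (\<lambda>s. ex (unif L2) (\<lambda>m2. of_bool (R m1 m21 m2
      s)))))"
proof -
  have fin: "finite (set_pmf (unif L1))" "finite (set_pmf (unif L21))" "finite (set_pmf (unif L2))"
    using L1 L21 L2 by auto
  have "measure_pmf.prob source {(m1, m21, m2, s). R m1 m21 m2 s} =
      ex source (\<lambda>x. of_bool (x \<in> {(m1, m21, m2, s). R m1 m21 m2 s}))"
    using fin finS by (intro ex_of_bool[symmetric]) (simp add: source_def)
  also have "\<dots> = ex (unif L1) (\<lambda>m1. ex (unif L21) (\<lambda>m21. ex (unif L2) (\<lambda>m2. ex S (\<lambda>s. of_bool (R m1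
    m21 m2 s)))))"
    unfolding source_def using fin finS by (simp add: ex_pair)
  finally show ?thesis by (subst (asm) ex_swap[where P = "unif L2"])
qed

text \<open>Both error probabilities are bounded by the same \<open>total_loss g\<close>, so a
  single \<open>g\<close> at or below the average serves both receivers. The support conditions on
  \<open>enc\<close> and \<open>c\<close> are what later turns sequences into channel
  letters.\<close>

theorem one_shot_code:
  "\<exists>enc c dec1 dec2.
    (\<forall>m1 m21. \<forall>s\<in>set_pmf S. enc m1 m21 s \<in> set_pmf (W s)) \<and> (\<forall>m\<in>{1..L2}. c m \<in> set_pmf V) \<and>
    measure_pmf.prob source {(m1, m21, m2, s). dec1 (yy (enc m1 m21 s)) \<noteq> m1}
      \<le> 6 * measure_pmf.prob joint bad + 32 * e \<and>
    measure_pmf.prob source {(m1, m21, m2, s). dec2 (f (c m2) (tt (enc m1 m21 s))) \<noteq> (m21, m2)}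
      \<le> 6 * measure_pmf.prob joint bad + 32 * e"
proof -
  obtain g where g: "g \<in> set_pmf codes" and gl: "total_loss g \<le> 6 * measure_pmf.prob joint bad + 32
    * e"
    using ex_le_exists[OF fin_codes(4), of total_loss] ex_total_loss by force
  obtain h h1 c where gg: "g = (h, h1, c)" by (cases g)
  have c: "c m \<in> set_pmf V" if "m \<in> {1..L2}" for m
    using g that finV by (auto simp: gg codes_def book_def set_Pi_pmf PiE_dflt_def)
  \<comment> \<open>After a failure something must still be sent; any sequence in the support of
    \<open>W s\<close> is realizable.\<close>
  define enc where "enc m1 m21 s = (if fails g m1 m21 s then SOME u. u \<in> set_pmf (W s)
    else SOME u. u \<in> good s \<and> match g m1 m21 u = 1 \<and> cost g u \<le> excess g m1 m21 s)" for m1 m21 s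
  have enc: "enc m1 m21 s \<in> good s \<and> match g m1 m21 (enc m1 m21 s) = 1 \<and>
      cost g (enc m1 m21 s) \<le> excess g m1 m21 s"
    if "s \<in> set_pmf S" "\<not> fails g m1 m21 s" for m1 m21 s
  proof -
    have "\<exists>u. u \<in> good s \<and> match g m1 m21 u = 1 \<and> cost g u \<le> excess g m1 m21 s"
      using choose_codeword[OF that] by blast
    from someI_ex[OF this] show ?thesis using that(2) by (simp add: enc_def)
  qed
  have encW: "enc m1 m21 s \<in> set_pmf (W s)" if "s \<in> set_pmf S" for m1 m21 s
  proof (cases "fails g m1 m21 s")
    case True
    then show ?thesis by (simp add: enc_def some_in_eq set_pmf_not_empty)
  next
    case False
    then show ?thesis using enc[OF that False] good_W by blast
  qed
  \<comment> \<open>The hash value of the interference that is found serves as the estimate of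
    \<open>m21\<close>.\<close>
  define dec2 where "dec2 z = (SOME p. \<exists>t m2. accept g z t m2 \<and> p = (h t, m2))" for z
  have dec2: "dec2 (f (c m2) (tt (enc m1 m21 s))) = (m21, m2)"
    if s: "s \<in> set_pmf S" and nf: "\<not> fails g m1 m21 s" and m: "m21 \<in> {1..L21}" "m2 \<in> {1..L2}"
      and nc: "\<not> confused g m2 (enc m1 m21 s)" for m1 m21 m2 s
  proof -
    define t where "t = tt (enc m1 m21 s)"
    have t: "t \<in> TT" using tt_TT[OF s encW[OF s]] by (simp add: t_def)
    have ht: "h t = m21" using enc[OF s nf] by (auto simp: gg t_def of_bool_def split: if_splits)
    have acc: "accept g (f (c m2) t) t m2"
      using nc m t ht by (auto simp: gg t_def)
    have uniq: "m2' = m2 \<and> t' = t" if a: "accept g (f (c m2) t) t' m2'" for t' m2'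
    proof
      show eq: "m2' = m2" using nc a by (auto simp: gg t_def)
      then have "f (c m2) t' = f (c m2) t" "t' \<in> TT" using a by (auto simp: gg)
      then show "t' = t"
        using inj_f[OF c[OF m(2)]] t by (auto simp: inj_on_def TT_def)
    qed
    have "dec2 (f (c m2) t) = (h t, m2)"
      unfolding dec2_def by (rule some_equality) (use acc uniq in auto)
    then show ?thesis by (simp only: ht flip: t_def)
  qed
  have nonfail1: "h1 (yy (enc m1 m21 s)) = m1" if "s \<in> set_pmf S" "\<not> fails g m1 m21 s" for m1 m21 s
    using enc[OF that] by (auto simp: gg of_bool_def split: if_splits)
  have loss1: "1 \<le> loss g m1 m21 s" if "fails g m1 m21 s" for m1 m21 s
    using that excess_nonneg by (auto simp: loss_def)
  have loss0: "0 \<le> loss g m1 m21 s" for m1 m21 s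
    using excess_nonneg by (auto simp: loss_def)
  have finU2: "finite (set_pmf (unif L2))" using L2 by auto
  have e1: "ex (unif L2) (\<lambda>m2. of_bool (h1 (yy (enc m1 m21 s)) \<noteq> m1)) \<le> loss g m1 m21 s"
    if "s \<in> set_pmf S" for m1 m21 s
    using nonfail1[OF that] loss1[of m1 m21 s] loss0[of m1 m21 s] finU2 by (auto simp: ex_const)
  have e2: "ex (unif L2) (\<lambda>m2. of_bool (dec2 (f (c m2) (tt (enc m1 m21 s))) \<noteq> (m21, m2))) \<le> loss g
    m1 m21 s"
    if s: "s \<in> set_pmf S" and m21: "m21 \<in> {1..L21}" for m1 m21 s
  proof (cases "fails g m1 m21 s")
    case True
    have "ex (unif L2) (\<lambda>m2. of_bool (dec2 (f (c m2) (tt (enc m1 m21 s))) \<noteq> (m21, m2))) \<le>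
        ex (unif L2) (\<lambda>m2. 1)"
      by (intro ex_mono) auto
    then show ?thesis using loss1[OF True] finU2 by (simp add: ex_const)
  next
    case False
    have "ex (unif L2) (\<lambda>m2. of_bool (dec2 (f (c m2) (tt (enc m1 m21 s))) \<noteq> (m21, m2))) \<le>
        cost g (enc m1 m21 s)"
      unfolding cost_def using dec2[OF s False m21] L2
      by (intro ex_mono) (auto simp: set_unif)
    also have "\<dots> \<le> excess g m1 m21 s" using enc[OF s False] by simp
    also have "\<dots> \<le> loss g m1 m21 s" using False by (simp add: loss_def fails_def)
    finally show ?thesis .
  qed
  have "measure_pmf.prob source {(m1, m21, m2, s). h1 (yy (enc m1 m21 s)) \<noteq> m1} \<le> total_loss g"
    unfolding prob_source total_loss_def by (intro ex_mono e1)
  moreover have "measure_pmf.prob source {(m1, m21, m2, s). dec2 (f (c m2) (tt (enc m1 m21 s))) \<noteq>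
    (m21, m2)}
      \<le> total_loss g"
    unfolding prob_source total_loss_def using L21 by (intro ex_mono e2) (auto simp: set_unif)
  ultimately show ?thesis
    using gl encW c by (intro exI[of _ enc] exI[of _ c] exI[of _ h1] exI[of _ dec2]) auto
qed

end

section \<open>Memoryless kernels on lists\<close>

primrec kern :: "('a \<Rightarrow> 'b pmf) \<Rightarrow> 'a list \<Rightarrow> 'b list pmf" where
  "kern K [] = return_pmf []"
| "kern K (a # as) = bind_pmf (K a) (\<lambda>x. map_pmf ((#) x) (kern K as))"

lemma set_kern: "set_pmf (kern K as) = {xs. list_all2 (\<lambda>a x. x \<in> set_pmf (K a)) as xs}"
proof (induction as)
  case (Cons a as)
  then show ?case by (auto simp: list_all2_Cons1)
qed simp

lemma length_kern: "xs \<in> set_pmf (kern K as) \<Longrightarrow> length xs = length as"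
  by (auto simp: set_kern dest: list_all2_lengthD)

lemma finite_kern: "(\<And>a. finite (set_pmf (K a))) \<Longrightarrow> finite (set_pmf (kern K as))"
  by (induction as) auto

lemma pmf_kern:
  "length as = length xs \<Longrightarrow> pmf (kern K as) xs = prod_list (map (\<lambda>(a, x). pmf (K a) x) (zip as xs))"
proof (induction as xs rule: list_induct2)
  case (Cons a as x xs)
  have "kern K (a # as) = map_pmf (\<lambda>(x, xs). x # xs) (pair_pmf (K a) (kern K as))"
    by (simp add: pair_pmf_def map_bind_pmf map_pmf_def bind_assoc_pmf bind_return_pmf)
  moreover have "pmf (map_pmf (\<lambda>(x, xs). x # xs) (pair_pmf (K a) (kern K as))) ((\<lambda>(x, xs). x # xs)
    (x, xs)) =
      pmf (pair_pmf (K a) (kern K as)) (x, xs)"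
    by (rule pmf_map_inj') (auto simp: inj_def)
  ultimately show ?case using Cons by (simp add: pmf_pair)
qed simp

lemma map_kern: "map_pmf (map g) (kern K as) = kern (\<lambda>a. map_pmf g (K a)) as"
proof (induction as)
  case (Cons a as)
  then show ?case by (simp add: map_bind_pmf bind_map_pmf map_pmf_comp flip: Cons.IH)
qed simp

lemma map2_kern: "length as = length bs \<Longrightarrow>
    map_pmf (\<lambda>xs. map2 g xs bs) (kern K as) = kern (\<lambda>(a, b). map_pmf (\<lambda>x. g x b) (K a)) (zip as bs)"
proof (induction as bs rule: list_induct2)
  case (Cons a as b bs)
  then show ?case
    by (simp add: map_bind_pmf bind_map_pmf map_pmf_comp flip: Cons.IH)
qed simp

text \<open>An intermediate memoryless sequence is averaged out letter by letter; this identifies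
  the block laws of interference and output in \<open>block_laws\<close>.\<close>

lemma bind_kern: "bind_pmf (kern A qs) (\<lambda>as. kern K (zip qs as)) = kern (\<lambda>q. bind_pmf (A q) (\<lambda>a. K
  (q, a))) qs"
proof (induction qs)
  case (Cons q qs)
  have "bind_pmf (kern A (q # qs)) (\<lambda>as. kern K (zip (q # qs) as)) =
      bind_pmf (A q) (\<lambda>a. bind_pmf (kern A qs) (\<lambda>as. bind_pmf (K (q, a)) (\<lambda>x. map_pmf ((#) x) (kern
        K (zip qs as)))))"
    by (simp add: bind_assoc_pmf bind_map_pmf)
  also have "\<dots> = bind_pmf (A q) (\<lambda>a. bind_pmf (K (q, a)) (\<lambda>x. map_pmf ((#) x) (bind_pmf (kern A qs)
    (\<lambda>as. kern K (zip qs as)))))"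
    by (subst bind_commute_pmf) (simp add: map_bind_pmf)
  finally show ?case by (simp add: Cons bind_assoc_pmf)
qed (simp add: bind_return_pmf)

lemma lk_const: "length as = n \<Longrightarrow> kern (\<lambda>_. p) as = replicate_pmf n p"
proof (induction as arbitrary: n)
  case (Cons a as)
  then show ?case by (cases n) (auto simp: map_pmf_def)
qed simp

lemma ex_kern_Cons:
  assumes "\<And>a. finite (set_pmf (K a))"
  shows "ex (kern K (a # as)) g = ex (K a) (\<lambda>x. ex (kern K as) (\<lambda>xs. g (x # xs)))"
  using assms by (simp add: ex_bind ex_map finite_kern)

lemma finite_replicate_pmf: "finite (set_pmf p) \<Longrightarrow> finite (set_pmf (replicate_pmf n p))"
  by (induction n) auto

lemma ex_replicate_Suc:
  assumes "finite (set_pmf p)"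
  shows "ex (replicate_pmf (Suc n) p) g = ex p (\<lambda>x. ex (replicate_pmf n p) (\<lambda>xs. g (x # xs)))"
  using assms by (simp add: ex_bind finite_replicate_pmf)

section \<open>Typical sequences\<close>

text \<open>The cross term of the square carries the first moment of the tail, so both claims go
  through one induction.\<close>

lemma ex_sum_square:
  assumes fin: "finite (set_pmf P)" and mean: "ex P g = 0"
  shows "ex (replicate_pmf n P) (\<lambda>xs. sum_list (map g xs)) = 0"
    and "ex (replicate_pmf n P) (\<lambda>xs. (sum_list (map g xs))\<^sup>2) = n * ex P (\<lambda>x. (g x)\<^sup>2)"
proof (induction n)
  case (Suc n)
  {
    case 1
    show ?case
      using Suc fin by (simp only: ex_replicate_Suc[OF fin] list.map sum_list.Cons ex_add)
        (simp add: ex_const finite_replicate_pmf mean)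
  next
    case 2
    have "ex (replicate_pmf (Suc n) P) (\<lambda>xs. (sum_list (map g xs))\<^sup>2) =
        ex P (\<lambda>x. ex (replicate_pmf n P) (\<lambda>xs. (g x)\<^sup>2 + (2 * g x * sum_list (map g xs) + (sum_list
          (map g xs))\<^sup>2)))"
      unfolding ex_replicate_Suc[OF fin] by (simp add: power2_sum algebra_simps)
    also have "\<dots> = ex P (\<lambda>x. (g x)\<^sup>2 + n * ex P (\<lambda>x. (g x)\<^sup>2))"
      by (simp only: ex_add ex_cmult Suc) (simp add: ex_const finite_replicate_pmf fin)
    also have "\<dots> = Suc n * ex P (\<lambda>x. (g x)\<^sup>2)"
      by (simp add: ex_add ex_const fin algebra_simps)
    finally show ?case .
  }
qed simp_all

text \<open>Weak typicality with respect to an arbitrary letter statistic; it is used with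
  self-informations, one for each entropy involved.\<close>

definition typical :: "'a pmf \<Rightarrow> ('a \<Rightarrow> real) \<Rightarrow> real \<Rightarrow> 'a list \<Rightarrow> bool" where
  "typical P g d xs \<longleftrightarrow> \<bar>sum_list (map g xs) - real (length xs) * ex P g\<bar> \<le> real (length xs) * d"

lemma sum_list_diff_const: "sum_list (map (\<lambda>x. g x - c) xs) = sum_list (map g xs) - real (length xs)
  * (c::real)"
  by (induction xs) (auto simp: algebra_simps)

text \<open>Chebyshev's inequality. Decay like \<open>1 / n\<close> is enough, as achievability asks
  for no rate of convergence.\<close>

lemma atypical_le:
  assumes fin: "finite (set_pmf P)" and d: "0 < d" and n: "0 < n"
  shows "measure_pmf.prob (replicate_pmf n P) {xs. \<not> typical P g d xs}
    \<le> ex P (\<lambda>x. (g x - ex P g)\<^sup>2) / d\<^sup>2 / n"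
proof -
  let ?g = "\<lambda>x. g x - ex P g"
  have mean: "ex P ?g = 0" by (simp add: ex_diff ex_const fin)
  have "measure_pmf.prob (replicate_pmf n P) {xs. \<not> typical P g d xs} =
      ex (replicate_pmf n P) (\<lambda>xs. of_bool (xs \<in> {xs. \<not> typical P g d xs}))"
    by (intro ex_of_bool[symmetric] finite_replicate_pmf fin)
  also have "\<dots> \<le> ex (replicate_pmf n P) (\<lambda>xs. 1 / (n * d)\<^sup>2 * (sum_list (map ?g xs))\<^sup>2)"
  proof (rule ex_mono)
    fix xs assume "xs \<in> set_pmf (replicate_pmf n P)"
    then have len: "length xs = n" by (simp add: set_replicate_pmf)
    show "of_bool (xs \<in> {xs. \<not> typical P g d xs}) \<le> 1 / (n * d)\<^sup>2 * (sum_list (map ?g xs))\<^sup>2"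
    proof (cases "typical P g d xs")
      case False
      then have "n * d \<le> \<bar>sum_list (map ?g xs)\<bar>"
        by (simp add: typical_def sum_list_diff_const len)
      then have "(n * d)\<^sup>2 \<le> (sum_list (map ?g xs))\<^sup>2"
        using d by (metis abs_le_square_iff abs_of_nonneg mult_nonneg_nonneg of_nat_0_le_iff
          order_less_imp_le)
      then show ?thesis using False d n by (simp add: field_simps)
    qed auto
  qed
  also have "\<dots> = 1 / (n * d)\<^sup>2 * (n * ex P (\<lambda>x. (?g x)\<^sup>2))"
    by (simp only: ex_cmult ex_sum_square[OF fin mean])
  also have "\<dots> = ex P (\<lambda>x. (?g x)\<^sup>2) / d\<^sup>2 / n"
    using n d by (simp add: power2_eq_square field_simps)
  finally show ?thesis .
qed

lemma prod_list_powr: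
  assumes "\<And>x. x \<in> set xs \<Longrightarrow> 0 < D x"
  shows "prod_list (map D xs) = 2 powr (- sum_list (map (\<lambda>x. - log 2 (D x)) xs))"
  using assms
proof (induction xs)
  case (Cons a xs)
  then show ?case by (simp add: powr_diff powr_minus divide_inverse)
qed simp

text \<open>The asymptotic equipartition property: a product of probabilities is 2 to the power of
  minus the sum of self-informations.\<close>

lemma typical_prod_list:
  assumes "\<And>x. x \<in> set xs \<Longrightarrow> 0 < D x" "typical P (\<lambda>x. - log 2 (D x)) d xs"
  shows "prod_list (map D xs) \<le> 2 powr (- real (length xs) * (ex P (\<lambda>x. - log 2 (D x)) - d))"
    and "2 powr (- real (length xs) * (ex P (\<lambda>x. - log 2 (D x)) + d)) \<le> prod_list (map D xs)"
proof -
  have h: "\<bar>sum_list (map (\<lambda>x. - log 2 (D x)) xs) - real (length xs) * ex P (\<lambda>x. - log 2 (D x))\<bar> \<le>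
    real (length xs) * d"
    using assms(2) by (simp add: typical_def)
  have eq: "prod_list (map D xs) = 2 powr (- sum_list (map (\<lambda>x. - log 2 (D x)) xs))"
    by (rule prod_list_powr[OF assms(1)])
  show "prod_list (map D xs) \<le> 2 powr (- real (length xs) * (ex P (\<lambda>x. - log 2 (D x)) - d))"
    and "2 powr (- real (length xs) * (ex P (\<lambda>x. - log 2 (D x)) + d)) \<le> prod_list (map D xs)"
    unfolding eq using h by (intro powr_mono; auto simp: algebra_simps abs_le_iff)+
qed

section \<open>Achievability\<close>

definition nmsg :: "nat \<Rightarrow> real \<Rightarrow> nat" where
  "nmsg n R = nat \<lceil>2 powr (real n * R)\<rceil>"

lemma nmsg_zero [simp]: "nmsg n 0 = 1"
  by (simp add: nmsg_def)

lemma nmsg_bounds: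
  assumes "0 \<le> R"
  shows "1 \<le> nmsg n R" "2 powr (n * R) \<le> nmsg n R" "real (nmsg n R) - 1 \<le> 2 powr (n * R)"
    "real (nmsg n R) \<le> 2 * 2 powr (n * R)"
proof -
  have 1: "1 \<le> 2 powr (real n * R)" using assms by (simp add: ge_one_powr_ge_zero)
  have r: "real (nmsg n R) = of_int \<lceil>2 powr (real n * R)\<rceil>"
    using 1 by (simp add: nmsg_def)
  show "2 powr (n * R) \<le> nmsg n R" "real (nmsg n R) - 1 \<le> 2 powr (n * R)"
    unfolding r by linarith+
  then show "real (nmsg n R) \<le> 2 * 2 powr (n * R)" "1 \<le> nmsg n R" using 1 by linarith+
qed

lemma nmsg_mono: "R \<le> R' \<Longrightarrow> nmsg n R \<le> nmsg n R'"
  unfolding nmsg_def by (intro nat_mono ceiling_mono) (simp add: mult_left_mono)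

lemma source_pmf_unif:
  "source_pmf ps n R1 R21 R2 = pair_pmf (unif (nmsg n R1)) (pair_pmf (unif (nmsg n R21))
    (pair_pmf (unif (nmsg n R2)) (replicate_pmf n ps)))"
  by (simp add: source_pmf_def message_set_def unif_def nmsg_def)

lemma zip_maps: "zip (map f xs) (map g xs) = map (\<lambda>x. (f x, g x)) xs"
  by (induction xs) auto

lemma finite_set_pmf_finite [simp]: "finite (set_pmf (p :: 'a::finite pmf))"
  by simp

text \<open>A positive rate stays \<open>d\<close> below the entropy and typicality costs
  \<open>d / 4\<close>, so the exponent falls by \<open>3 / 4 * d\<close> per letter. Only
  \<open>d / 4\<close> is claimed, which leaves room for rounding in the two variants that follow.
  At rate 0 there is one message and the left side is 0, whatever \<open>H\<close> is.\<close>

lemma nmsg_mult_le: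
  assumes R: "0 \<le> R" "R = 0 \<or> R \<le> H - d" and d: "0 < d"
    and p: "0 \<le> p" "p \<le> 2 powr (- real n * (H - d / 4))"
  shows "(real (nmsg n R) - 1) * p \<le> 2 powr (- (real n * d / 4))"
proof (cases "R = 0")
  case False
  have "(real (nmsg n R) - 1) * p \<le> 2 powr (n * R) * 2 powr (- real n * (H - d / 4))"
    using nmsg_bounds[OF R(1), of n] p by (intro mult_mono) auto
  also have "\<dots> = 2 powr (n * (R - H + d / 4))"
    by (simp add: algebra_simps flip: powr_add)
  also have "\<dots> \<le> 2 powr (n * (- (d / 4)))"
    using False R d by (intro powr_mono mult_left_mono) auto
  finally show ?thesis by simp
qed simp

lemma nmsg_mult_le2:
  assumes R: "0 \<le> R" "0 \<le> k" "k = 0 \<and> R = 0 \<or> k + R \<le> H - d" and d: "0 < d" and n: "8 \<le> real n * d"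
    and p: "0 \<le> p" "p \<le> 2 powr (- real n * (H - d / 4))"
  shows "(real (nmsg n k) * real (nmsg n R) - 1) * p \<le> 2 powr (- (real n * d / 4))"
proof (cases "k = 0 \<and> R = 0")
  case False
  have "real (nmsg n k) * real (nmsg n R) \<le> (2 * 2 powr (n * k)) * (2 * 2 powr (n * R))"
    using nmsg_bounds[OF R(1), of n] nmsg_bounds[OF R(2), of n] by (intro mult_mono) auto
  then have "(real (nmsg n k) * real (nmsg n R) - 1) * p \<le>
      ((2 * 2 powr (n * k)) * (2 * 2 powr (n * R))) * 2 powr (- real n * (H - d / 4))"
    using p by (intro mult_mono) auto
  \<comment> \<open>Rounding two message counts up costs a factor 4, that is 2 in the exponent,
    which \<open>8 \<le> n * d\<close> absorbs.\<close>
  also have "\<dots> = 2 powr (2 + n * (k + R - H + d / 4))"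
    by (simp add: algebra_simps powr_add powr_diff powr_minus)
  also have "\<dots> \<le> 2 powr (2 + n * (- (d * 3 / 4)))"
    using False R d by (intro powr_mono add_left_mono mult_left_mono) auto
  also have "\<dots> \<le> 2 powr (- (real n * d / 4))"
    using n by (intro powr_mono) (auto simp: algebra_simps)
  finally show ?thesis .
qed simp

text \<open>This serves the second clause of \<open>one_shot.test\<close>, with \<open>p\<close> the
  output probability and \<open>r\<close> the probability of the interference. As \<open>r\<close>
  stands on the larger side, the lower typicality bound is needed for it.\<close>

lemma nmsg_mult_le3:
  assumes R: "0 \<le> R2" "0 \<le> R21" "0 \<le> k" "R2 = 0 \<or> R2 + R21 - k \<le> H5 - H6 - d" and d: "0 < d" and n:
    "8 \<le> real n * d"
    and p: "0 \<le> p" "p \<le> 2 powr (- real n * (H5 - d / 4))" and r: "2 powr (- real n * (H6 + d / 4)) \<le>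
      r"
  shows "(real (nmsg n R2) - 1) * real (nmsg n R21) / real (nmsg n k) * p \<le> 2 powr (- (real n * d /
    4)) * r"
proof (cases "R2 = 0")
  case True
  have "0 \<le> r" using r powr_ge_zero[of 2] order_trans by blast
  then show ?thesis using True by simp
next
  case False
  have kp: "0 < 2 powr (n * k)" by simp
  have "(real (nmsg n R2) - 1) * real (nmsg n R21) / real (nmsg n k) * p \<le>
      2 powr (n * R2) * (2 * 2 powr (n * R21)) / 2 powr (n * k) * 2 powr (- real n * (H5 - d / 4))"
    using nmsg_bounds[OF R(1), of n] nmsg_bounds[OF R(2), of n] nmsg_bounds[OF R(3), of n] p kp
    by (intro mult_mono frac_le) auto
  also have "\<dots> = 2 powr (1 + n * (R2 + R21 - k - H5 + d / 4))"
    by (simp add: algebra_simps powr_add powr_diff powr_minus)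
  also have "\<dots> \<le> 2 powr (1 + n * (- H6 - d * 3 / 4))"
    using False R d by (intro powr_mono add_left_mono mult_left_mono) auto
  also have "\<dots> \<le> 2 powr (- (real n * d / 4) + - real n * (H6 + d / 4))"
    using n by (intro powr_mono) (auto simp: algebra_simps)
  also have "\<dots> \<le> 2 powr (- (real n * d / 4)) * r"
    unfolding powr_add by (intro mult_left_mono r) auto
  finally show ?thesis .
qed

section \<open>Product codes with a fixed time-sharing sequence\<close>

locale coding =
  fixes ps :: "'s::finite pmf"
    and y1 :: "'x1::finite \<Rightarrow> 's \<Rightarrow> 'y1::finite"
    and t1 :: "'x1 \<Rightarrow> 's \<Rightarrow> 't::finite"
    and y2 :: "'x2::finite \<Rightarrow> 't \<Rightarrow> 'y2::finite"
    and pq :: "'q::finite pmf" and px1 :: "'s \<Rightarrow> 'q \<Rightarrow> 'x1 pmf" and px2 :: "'q \<Rightarrow> 'x2 pmf"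
  assumes inj_y2: "\<And>x2. inj (y2 x2)"
begin

text \<open>Coding takes place on pairs of interference and output instead of \<open>x1\<close>,
  since both receivers see \<open>x1\<close> only through them. A letter that realizes the chosen
  pair is picked in \<open>block_code\<close>.\<close>

definition w :: "'q \<times> 's \<Rightarrow> ('t \<times> 'y1) pmf" where
  "w = (\<lambda>(q, s). map_pmf (\<lambda>x. (t1 x s, y1 x s)) (px1 s q))"

definition wT :: "'q \<Rightarrow> 't pmf" where "wT q = bind_pmf ps (\<lambda>s. map_pmf fst (w (q, s)))"

definition wZ :: "'q \<times> 't \<Rightarrow> 'y2 pmf" where "wZ = (\<lambda>(q, t). map_pmf (\<lambda>x. y2 x t) (px2 q))"

definition wY2 :: "'q \<Rightarrow> 'y2 pmf" where "wY2 q = bind_pmf (wT q) (\<lambda>t. wZ (q, t))"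

definition letter :: "('q \<times> 's \<times> ('t \<times> 'y1) \<times> 'x2) pmf" where
  "letter = bind_pmf pq (\<lambda>q. bind_pmf ps (\<lambda>s. bind_pmf (w (q, s)) (\<lambda>u. map_pmf (\<lambda>x. (q, s, u, x))
    (px2 q))))"

text \<open>The probabilities whose expected self-informations are the six quantities of
  \<open>entropies\<close>, in the same order and averaged over \<open>q\<close>. One indexed family
  lets the six typicality conditions be treated in a single sum.\<close>

definition dens :: "nat \<Rightarrow> 'q \<times> 's \<times> ('t \<times> 'y1) \<times> 'x2 \<Rightarrow> real" where
  "dens j = (\<lambda>(q, s, (t, y), x).
     if j = 1 then pmf (map_pmf snd (w (q, s))) y
     else if j = 2 then pmf (map_pmf fst (w (q, s))) t
     else if j = 3 then pmf (w (q, s)) (t, y)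
     else if j = 4 then pmf (wZ (q, t)) (y2 x t)
     else if j = 5 then pmf (wY2 q) (y2 x t)
     else pmf (wT q) t)"

definition Hl :: "nat \<Rightarrow> real" where "Hl j = ex letter (\<lambda>\<omega>. - log 2 (dens j \<omega>))"

definition Wn :: "'q list \<Rightarrow> 's list \<Rightarrow> ('t \<times> 'y1) list pmf" where "Wn qs ss = kern w (zip qs ss)"

abbreviation ss_of :: "('q \<times> 's \<times> ('t \<times> 'y1) \<times> 'x2) list \<Rightarrow> 's list" where
  "ss_of \<equiv> map (fst \<circ> snd)"
abbreviation us_of :: "('q \<times> 's \<times> ('t \<times> 'y1) \<times> 'x2) list \<Rightarrow> ('t \<times> 'y1) list" where
  "us_of \<equiv> map (fst \<circ> snd \<circ> snd)"
abbreviation xs_of :: "('q \<times> 's \<times> ('t \<times> 'y1) \<times> 'x2) list \<Rightarrow> 'x2 list" where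
  "xs_of \<equiv> map (snd \<circ> snd \<circ> snd)"

lemma set_letter:
  "(q, s, (t, y), x) \<in> set_pmf letter \<longleftrightarrow>
    q \<in> set_pmf pq \<and> s \<in> set_pmf ps \<and> (t, y) \<in> set_pmf (w (q, s)) \<and> x \<in> set_pmf (px2 q)"
  by (auto simp: letter_def)

lemma dens_pos: "\<omega> \<in> set_pmf letter \<Longrightarrow> 0 < dens j \<omega>"
proof -
  assume a: "\<omega> \<in> set_pmf letter"
  obtain q s t y x where w: "\<omega> = (q, s, (t, y), x)" by (metis prod.exhaust)
  have m: "s \<in> set_pmf ps" "(t, y) \<in> set_pmf (w (q, s))" "x \<in> set_pmf (px2 q)"
    using a by (auto simp: w set_letter)
  have T: "t \<in> set_pmf (wT q)" using m by (force simp: wT_def)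
  have Z: "y2 x t \<in> set_pmf (wZ (q, t))" using m by (auto simp: wZ_def)
  have "y2 x t \<in> set_pmf (wY2 q)" using T Z by (auto simp: wY2_def)
  then show ?thesis
    using pmf_map_pos[OF m(2), where X = fst] pmf_map_pos[OF m(2), where X = snd] m T Z
    unfolding w dens_def by (auto intro!: pmf_positive simp del: set_map_pmf)
qed

lemma ex_letter:
  "ex letter g = ex pq (\<lambda>q. ex ps (\<lambda>s. ex (w (q, s)) (\<lambda>u. ex (px2 q) (\<lambda>x. g (q, s, u, x)))))"
  unfolding letter_def by (simp add: ex_bind ex_map)

text \<open>Drawing whole sequences one component after another and drawing letter by letter give
  the same law. The swaps in the induction step bring all first letters in front of the remaining
  blocks.\<close>

lemma ex_blocks:
  "ex (replicate_pmf n pq) (\<lambda>qs. ex (replicate_pmf n ps) (\<lambda>ss. ex (Wn qs ss) (\<lambda>us. ex (kern px2 qs)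
    (\<lambda>xs. g qs ss us xs)))) =
   ex (replicate_pmf n letter) (\<lambda>ws. g (map fst ws) (ss_of ws) (us_of ws) (xs_of ws))"
proof (induction n arbitrary: g)
  case 0
  then show ?case by (simp add: Wn_def)
next
  case (Suc n)
  define G where "G q s u x qs ss us = ex (kern px2 qs) (\<lambda>xs. g (q # qs) (s # ss) (u # us) (x #
    xs))" for q s u x qs ss us
  have "ex (replicate_pmf (Suc n) pq) (\<lambda>qs. ex (replicate_pmf (Suc n) ps) (\<lambda>ss. ex (Wn qs ss) (\<lambda>us.
    ex (kern px2 qs) (\<lambda>xs. g qs ss us xs)))) =
    ex pq (\<lambda>q. ex (replicate_pmf n pq) (\<lambda>qs. ex ps (\<lambda>s. ex (replicate_pmf n ps) (\<lambda>ss.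
      ex (w (q, s)) (\<lambda>u. ex (Wn qs ss) (\<lambda>us. ex (px2 q) (\<lambda>x. G q s u x qs ss us)))))))"
    unfolding ex_replicate_Suc[OF finite_set_pmf_finite] by (simp add: G_def Wn_def ex_kern_Cons
      del: kern.simps)
  also have "\<dots> = ex pq (\<lambda>q. ex (replicate_pmf n pq) (\<lambda>qs. ex ps (\<lambda>s. ex (replicate_pmf n ps) (\<lambda>ss.
      ex (w (q, s)) (\<lambda>u. ex (px2 q) (\<lambda>x. ex (Wn qs ss) (\<lambda>us. G q s u x qs ss us)))))))"
    by (intro ex_cong, rule ex_swap)
  also have "\<dots> = ex pq (\<lambda>q. ex (replicate_pmf n pq) (\<lambda>qs. ex ps (\<lambda>s. ex (w (q, s)) (\<lambda>u. ex
    (replicate_pmf n ps) (\<lambda>ss.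
      ex (px2 q) (\<lambda>x. ex (Wn qs ss) (\<lambda>us. G q s u x qs ss us)))))))"
    by (intro ex_cong, rule ex_swap)
  also have "\<dots> = ex pq (\<lambda>q. ex (replicate_pmf n pq) (\<lambda>qs. ex ps (\<lambda>s. ex (w (q, s)) (\<lambda>u. ex (px2 q)
    (\<lambda>x. ex (replicate_pmf n ps) (\<lambda>ss.
      ex (Wn qs ss) (\<lambda>us. G q s u x qs ss us)))))))"
    by (intro ex_cong, rule ex_swap)
  also have "\<dots> = ex pq (\<lambda>q. ex ps (\<lambda>s. ex (replicate_pmf n pq) (\<lambda>qs. ex (w (q, s)) (\<lambda>u. ex (px2 q)
    (\<lambda>x. ex (replicate_pmf n ps) (\<lambda>ss.
      ex (Wn qs ss) (\<lambda>us. G q s u x qs ss us)))))))"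
    by (intro ex_cong, rule ex_swap)
  also have "\<dots> = ex pq (\<lambda>q. ex ps (\<lambda>s. ex (w (q, s)) (\<lambda>u. ex (replicate_pmf n pq) (\<lambda>qs. ex (px2 q)
    (\<lambda>x. ex (replicate_pmf n ps) (\<lambda>ss.
      ex (Wn qs ss) (\<lambda>us. G q s u x qs ss us)))))))"
    by (intro ex_cong, rule ex_swap)
  also have "\<dots> = ex pq (\<lambda>q. ex ps (\<lambda>s. ex (w (q, s)) (\<lambda>u. ex (px2 q) (\<lambda>x. ex (replicate_pmf n pq)
    (\<lambda>qs. ex (replicate_pmf n ps) (\<lambda>ss.
      ex (Wn qs ss) (\<lambda>us. G q s u x qs ss us)))))))"
    by (intro ex_cong, rule ex_swap)
  also have "\<dots> = ex letter (\<lambda>\<omega>. ex (replicate_pmf n letter) (\<lambda>ws.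
      g (fst \<omega> # map fst ws) (fst (snd \<omega>) # ss_of ws)
        (fst (snd (snd \<omega>)) # us_of ws) (snd (snd (snd \<omega>)) # xs_of ws)))"
    by (simp add: G_def ex_letter Suc comp_def)
  also have "\<dots> = ex (replicate_pmf (Suc n) letter) (\<lambda>ws. g (map fst ws) (ss_of ws)
      (us_of ws) (xs_of ws))"
    by (subst ex_replicate_Suc) (simp_all add: comp_def)
  finally show ?case .
qed

lemma one_shot_block:
  assumes len: "length qs = n" and "1 \<le> L1" "1 \<le> L21" "L21 \<le> K" "1 \<le> L2" "0 < e"
  shows "one_shot (replicate_pmf n ps) (Wn qs) (kern px2 qs) (map fst) (map snd) (map2 y2) K L1 L21
    L2 e"
proof
  show "finite (set_pmf (replicate_pmf n ps))" by (simp add: finite_replicate_pmf)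
  show "finite (set_pmf (Wn qs s))" for s by (simp add: Wn_def finite_kern)
  show "finite (set_pmf (kern px2 qs))" by (simp add: finite_kern)
  show "u = u'" if "map fst u = map fst u'" "map snd u = map snd u'" for u u' :: "('t \<times> 'y1) list"
    using that by (metis zip_map_fst_snd)
  show "inj_on (map2 y2 x) (\<Union>s\<in>set_pmf (replicate_pmf n ps). map fst ` set_pmf (Wn qs s))"
    if x: "x \<in> set_pmf (kern px2 qs)" for x
  proof (rule inj_onI)
    have len_t: "length t = n" if "t \<in> (\<Union>s\<in>set_pmf (replicate_pmf n ps). map fst ` set_pmf (Wn qs
      s))" for t
      using that len by (auto simp: Wn_def set_replicate_pmf dest: length_kern)
    have lx: "length x = n" using length_kern[OF x] len by simp
    fix t t' assume t: "t \<in> (\<Union>s\<in>set_pmf (replicate_pmf n ps). map fst ` set_pmf (Wn qs s))"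
      "t' \<in> (\<Union>s\<in>set_pmf (replicate_pmf n ps). map fst ` set_pmf (Wn qs s))"
      and eq: "map2 y2 x t = map2 y2 x t'"
    show "t = t'"
    proof (rule nth_equalityI)
      show "length t = length t'" using t len_t by auto
      fix i assume "i < length t"
      then have i: "i < n" "length t = n" "length t' = n" using t len_t by auto
      then have "map2 y2 x t ! i = map2 y2 x t' ! i" by (simp add: eq)
      then have "y2 (x ! i) (t ! i) = y2 (x ! i) (t' ! i)" using i lx by simp
      then show "t ! i = t' ! i" using inj_y2[of "x ! i"] by (simp add: inj_def)
    qed
  qed
qed (use assms in auto)

lemma pmf_Wn:
  "pmf (Wn (map fst ws) (ss_of ws)) (us_of ws) = prod_list (map (dens 3) ws)"
  "pmf (map_pmf (map fst) (Wn (map fst ws) (ss_of ws))) (map fst (us_of ws)) =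
    prod_list (map (dens 2) ws)"
  "pmf (map_pmf (map snd) (Wn (map fst ws) (ss_of ws))) (map snd (us_of ws)) =
    prod_list (map (dens 1) ws)"
proof -
  show "pmf (Wn (map fst ws) (ss_of ws)) (us_of ws) = prod_list (map (dens 3) ws)"
    unfolding Wn_def
    by (subst pmf_kern) (auto simp: zip_maps comp_def dens_def intro!: arg_cong[where f =
      prod_list])
  show "pmf (map_pmf (map fst) (Wn (map fst ws) (ss_of ws))) (map fst (us_of ws)) =
    prod_list (map (dens 2) ws)"
    unfolding Wn_def map_kern
    by (subst pmf_kern) (auto simp: zip_maps comp_def dens_def intro!: arg_cong[where f =
      prod_list])
  show "pmf (map_pmf (map snd) (Wn (map fst ws) (ss_of ws))) (map snd (us_of ws)) =
    prod_list (map (dens 1) ws)"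
    unfolding Wn_def map_kern
    by (subst pmf_kern) (auto simp: zip_maps comp_def dens_def intro!: arg_cong[where f =
      prod_list])
qed

text \<open>These identify \<open>one_shot.pT\<close>, \<open>one_shot.pZt\<close> and
  \<open>one_shot.pZ\<close> as memoryless, so that their values become products of
  \<open>dens 6\<close>, \<open>dens 4\<close> and \<open>dens 5\<close>.\<close>

lemma block_laws:
  assumes len: "length qs = n"
  shows "map_pmf (map fst) (bind_pmf (replicate_pmf n ps) (Wn qs)) = kern wT qs"
    and "length ts = n \<Longrightarrow> map_pmf (\<lambda>x. map2 y2 x ts) (kern px2 qs) = kern wZ (zip qs ts)"
    and "bind_pmf (kern wT qs) (\<lambda>ts. map_pmf (\<lambda>x. map2 y2 x ts) (kern px2 qs)) = kern wY2 qs"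
proof -
  show "map_pmf (map fst) (bind_pmf (replicate_pmf n ps) (Wn qs)) = kern wT qs"
    by (simp add: map_bind_pmf Wn_def map_kern wT_def[abs_def] bind_kern flip: lk_const[OF len])
  show *: "map_pmf (\<lambda>x. map2 y2 x ts) (kern px2 qs) = kern wZ (zip qs ts)" if "length ts = n" for ts
    using that len by (simp add: map2_kern wZ_def)
  have "bind_pmf (kern wT qs) (\<lambda>ts. map_pmf (\<lambda>x. map2 y2 x ts) (kern px2 qs)) =
      bind_pmf (kern wT qs) (\<lambda>ts. kern wZ (zip qs ts))"
    using len by (intro bind_pmf_cong *) (auto dest: length_kern)
  then show "bind_pmf (kern wT qs) (\<lambda>ts. map_pmf (\<lambda>x. map2 y2 x ts) (kern px2 qs)) = kern wY2 qs"
    by (simp add: bind_kern wY2_def[abs_def])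
qed

text \<open>Each clause of \<open>good\<close> and \<open>test\<close> weighs message counts against
  block probabilities, which are products of \<open>dens j\<close>. Typicality controls the
  products, and the rate margin \<open>d\<close> does the rest.\<close>

lemma typical_not_bad:
  assumes ws: "ws \<in> set_pmf (replicate_pmf n letter)"
    and tp: "\<And>j. j \<in> {1..6} \<Longrightarrow> typical letter (\<lambda>\<omega>. - log 2 (dens j \<omega>)) (d / 4) ws"
    and d: "0 < d" and n: "8 \<le> real n * d"
    and R: "0 \<le> R1" "0 \<le> R21" "0 \<le> R2" "0 \<le> k" "R21 \<le> k"
    and c1: "R1 = 0 \<or> R1 \<le> Hl 1 - d" and c2: "k = 0 \<or> k \<le> Hl 2 - d"
    and c3: "k = 0 \<and> R1 = 0 \<or> k + R1 \<le> Hl 3 - d" and c4: "R2 = 0 \<or> R2 \<le> Hl 4 - d"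
    and c5: "R2 = 0 \<or> R2 + R21 - k \<le> Hl 5 - Hl 6 - d"
  shows "(ss_of ws, us_of ws, xs_of ws) \<notin>
    one_shot.bad (replicate_pmf n ps) (Wn (map fst ws)) (kern px2 (map fst ws)) (map fst) (map snd)
      (map2 y2)
      (nmsg n k) (nmsg n R1) (nmsg n R21) (nmsg n R2) (2 powr (- (real n * d / 4)))"
proof -
  define qs ss us xs where "qs = map fst ws" and "ss = ss_of ws"
    and "us = us_of ws" and "xs = xs_of ws"
  define e where "e = 2 powr (- (real n * d / 4))"
  have len: "length ws = n" and set_ws: "set ws \<subseteq> set_pmf letter"
    using ws by (auto simp: set_replicate_pmf)
  have lens: "length qs = n" "length ss = n" "length us = n" "length xs = n"
    by (simp_all add: qs_def ss_def us_def xs_def len)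
  interpret O: one_shot "replicate_pmf n ps" "Wn qs" "kern px2 qs" "map fst" "map snd" "map2 y2"
    "nmsg n k" "nmsg n R1" "nmsg n R21" "nmsg n R2" e
    by (rule one_shot_block[OF lens(1)])
      (use nmsg_bounds(1)[OF R(1)] nmsg_bounds(1)[OF R(2)] nmsg_bounds(1)[OF R(3)] nmsg_mono[OF
        R(5)]
        in \<open>auto simp: e_def\<close>)
  have dpos: "0 < dens j \<omega>" if "\<omega> \<in> set ws" for j \<omega>
    using set_ws that dens_pos by blast
  have up: "prod_list (map (dens j) ws) \<le> 2 powr (- real n * (Hl j - d / 4))" if "j \<in> {1..6}" for j
    using typical_prod_list(1)[OF dpos tp[OF that]] by (simp add: Hl_def len)
  have low: "2 powr (- real n * (Hl j + d / 4)) \<le> prod_list (map (dens j) ws)" if "j \<in> {1..6}" for j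
    using typical_prod_list(2)[OF dpos tp[OF that]] by (simp add: Hl_def len)
  have pos: "0 \<le> prod_list (map (dens j) ws)" for j
    using dpos by (intro prod_list_nonneg) (auto intro: less_imp_le)
  have W3: "pmf (Wn qs ss) us = prod_list (map (dens 3) ws)"
    and W2: "pmf (map_pmf (map fst) (Wn qs ss)) (map fst us) = prod_list (map (dens 2) ws)"
    and W1: "pmf (map_pmf (map snd) (Wn qs ss)) (map snd us) = prod_list (map (dens 1) ws)"
    using pmf_Wn[of ws] by (simp_all add: qs_def ss_def us_def)
  have us: "us \<in> set_pmf (Wn qs ss)"
  proof -
    have "(fst \<circ> snd \<circ> snd) \<omega> \<in> set_pmf (w (fst \<omega>, (fst \<circ> snd) \<omega>))" if "\<omega> \<in> set ws" for \<omega>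
    proof -
      obtain q s t y x where "\<omega> = (q, s, (t, y), x)" by (metis prod.exhaust)
      then show ?thesis using that set_ws by (auto simp: set_letter)
    qed
    then show ?thesis
      by (auto simp: Wn_def set_kern qs_def ss_def us_def zip_maps list.rel_map intro!:
        list.rel_refl_strong)
  qed
  have "us \<in> O.good ss"
    unfolding O.good_def using us
    by (simp only: e_def W1 W2 W3 mem_Collect_eq)
      (intro conjI nmsg_mult_le2[OF R(1,4) c3 d n pos up] nmsg_mult_le[OF R(4) c2 d pos up]
        nmsg_mult_le[OF R(1) c1 d pos up]; simp)
  moreover have "O.test (map fst us) (map2 y2 xs (map fst us))"
  proof -
    have lt: "length (map fst us) = n" using lens by simp
    have z: "map2 y2 xs (map fst us) = map (\<lambda>(q, s, (t, y), x). y2 x t) ws"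
      by (auto simp: xs_def us_def zip_maps comp_def)
    have 4: "pmf (O.pZt (map fst us)) (map2 y2 xs (map fst us)) = prod_list (map (dens 4) ws)"
      unfolding O.pZt_def block_laws(2)[OF lens(1) lt] z
      by (subst pmf_kern) (auto simp: zip_maps comp_def dens_def qs_def us_def intro!:
        arg_cong[where f = prod_list])
    have pT: "O.pT = kern wT qs"
      unfolding O.pT_def by (rule block_laws[OF lens(1)])
    have 5: "pmf O.pZ (map2 y2 xs (map fst us)) = prod_list (map (dens 5) ws)"
      unfolding O.pZ_def pT O.pZt_def[abs_def] block_laws(3)[OF lens(1)] z
      by (subst pmf_kern) (auto simp: zip_maps comp_def dens_def qs_def us_def intro!:
        arg_cong[where f = prod_list])
    have 6: "pmf O.pT (map fst us) = prod_list (map (dens 6) ws)"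
      unfolding pT
      by (subst pmf_kern) (auto simp: zip_maps comp_def dens_def qs_def us_def intro!:
        arg_cong[where f = prod_list])
    show ?thesis
      unfolding O.test_def 4 5 6 unfolding e_def
      by (intro conjI nmsg_mult_le[OF R(3) c4 d pos up] nmsg_mult_le3[OF R(3,2,4) c5 d n pos up
        low]; simp)
  qed
  ultimately have "(ss, us, xs) \<notin> O.bad"
    by (simp add: O.bad_def)
  then show ?thesis unfolding e_def qs_def ss_def us_def xs_def .
qed

text \<open>The time-sharing sequence has to be common to all terminals, so it is fixed before
  coding. On average over \<open>qs\<close> the bad event is at most as likely as an atypical block
  of letters, hence some \<open>qs\<close> is no worse.\<close>

lemma block_code:
  assumes d: "0 < d" and n: "8 \<le> real n * d"
    and R: "0 \<le> R1" "0 \<le> R21" "0 \<le> R2" "0 \<le> k" "R21 \<le> k"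
    and c: "R1 = 0 \<or> R1 \<le> Hl 1 - d" "k = 0 \<or> k \<le> Hl 2 - d"
      "k = 0 \<and> R1 = 0 \<or> k + R1 \<le> Hl 3 - d" "R2 = 0 \<or> R2 \<le> Hl 4 - d"
      "R2 = 0 \<or> R2 + R21 - k \<le> Hl 5 - Hl 6 - d"
  defines "B \<equiv> 6 * (\<Sum>j\<in>{1..6}. measure_pmf.prob (replicate_pmf n letter)
      {ws. \<not> typical letter (\<lambda>\<omega>. - log 2 (dens j \<omega>)) (d / 4) ws}) + 32 * 2 powr (- (real n * d /
        4))"
  shows "\<exists>enc1 enc2 dec1 dec2.
        error_prob1 ps y1 n R1 R21 R2 enc1 dec1 \<le> B \<and>
        error_prob2 ps t1 y2 n R1 R21 R2 enc1 enc2 dec2 \<le> B"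
proof -
  define e where "e = 2 powr (- (real n * d / 4))"
  define atyp where "atyp j = {ws. \<not> typical letter (\<lambda>\<omega>. - log 2 (dens j \<omega>)) (d / 4) ws}" for j
  define \<eta> where "\<eta> = (\<Sum>j\<in>{1..6}. measure_pmf.prob (replicate_pmf n letter) (atyp j))"
  define bd where "bd qs = one_shot.bad (replicate_pmf n ps) (Wn qs) (kern px2 qs) (map fst) (map
    snd) (map2 y2)
      (nmsg n k) (nmsg n R1) (nmsg n R21) (nmsg n R2) e" for qs
  define \<phi> where "\<phi> qs = ex (replicate_pmf n ps) (\<lambda>ss. ex (Wn qs ss) (\<lambda>us. ex (kern px2 qs) (\<lambda>xs.
    of_bool ((ss, us, xs) \<in> bd qs))))" for qs
  have "ex (replicate_pmf n pq) \<phi> = ex (replicate_pmf n letter) (\<lambda>ws. of_bool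
      ((ss_of ws, us_of ws, xs_of ws) \<in> bd (map fst ws)))"
    unfolding \<phi>_def by (rule ex_blocks)
  also have "\<dots> \<le> ex (replicate_pmf n letter) (\<lambda>ws. \<Sum>j\<in>{1..6}. of_bool (ws \<in> atyp j))"
  proof (rule ex_mono)
    fix ws assume ws: "ws \<in> set_pmf (replicate_pmf n letter)"
    show "of_bool ((ss_of ws, us_of ws, xs_of ws) \<in> bd (map fst ws))
      \<le> (\<Sum>j\<in>{1..6::nat}. of_bool (ws \<in> atyp j) :: real)"
    proof (cases "\<exists>j\<in>{1..6}. ws \<in> atyp j")
      case True
      then obtain j where j: "j \<in> {1..6}" "ws \<in> atyp j" by auto
      then have "1 \<le> (\<Sum>j\<in>{1..6::nat}. of_bool (ws \<in> atyp j) :: real)"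
        by (intro order_trans[OF _ member_le_sum[OF j(1)]]) auto
      then show ?thesis by (auto simp: of_bool_def)
    next
      case False
      then have "(ss_of ws, us_of ws, xs_of ws) \<notin> bd (map fst ws)"
        unfolding bd_def e_def by (intro typical_not_bad[OF ws _ d n R c]) (auto simp: atyp_def)
      then show ?thesis by (auto intro: sum_nonneg)
    qed
  qed
  also have "\<dots> = \<eta>"
    unfolding ex_sum \<eta>_def by (intro sum.cong refl ex_of_bool finite_replicate_pmf
      finite_set_pmf_finite)
  finally have "ex (replicate_pmf n pq) \<phi> \<le> \<eta>" .
  then obtain qs where qs: "qs \<in> set_pmf (replicate_pmf n pq)" and le: "\<phi> qs \<le> \<eta>"
    using ex_le_exists[OF finite_replicate_pmf[OF finite_set_pmf_finite], of n pq \<phi>] by force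
  have len: "length qs = n" using qs by (simp add: set_replicate_pmf)
  interpret O: one_shot "replicate_pmf n ps" "Wn qs" "kern px2 qs" "map fst" "map snd" "map2 y2"
    "nmsg n k" "nmsg n R1" "nmsg n R21" "nmsg n R2" e
    by (rule one_shot_block[OF len])
      (use nmsg_bounds(1)[OF R(1)] nmsg_bounds(1)[OF R(2)] nmsg_bounds(1)[OF R(3)] nmsg_mono[OF
        R(5)]
        in \<open>auto simp: e_def\<close>)
  have B: "6 * measure_pmf.prob O.joint O.bad + 32 * e \<le> B"
    using le by (simp add: O.prob_joint B_def e_def \<phi>_def bd_def \<eta>_def atyp_def)
  obtain enc c dec1 dec2 where code:
    "(\<forall>m1 m21. \<forall>s\<in>set_pmf (replicate_pmf n ps). enc m1 m21 s \<in> set_pmf (Wn qs s)) \<and>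
    (\<forall>m\<in>{1..nmsg n R2}. c m \<in> set_pmf (kern px2 qs)) \<and>
    measure_pmf.prob O.source {(m1, m21, m2, s). dec1 (map snd (enc m1 m21 s)) \<noteq> m1}
      \<le> 6 * measure_pmf.prob O.joint O.bad + 32 * e \<and>
    measure_pmf.prob O.source {(m1, m21, m2, s). dec2 (map2 y2 (c m2) (map fst (enc m1 m21 s))) \<noteq>
      (m21, m2)}
      \<le> 6 * measure_pmf.prob O.joint O.bad + 32 * e"
    using O.one_shot_code by (elim exE)
  have enc: "enc m1 m21 s \<in> set_pmf (Wn qs s)" if "s \<in> set_pmf (replicate_pmf n ps)" for m1 m21 s
    using code that by simp
  have cV: "c m \<in> set_pmf (kern px2 qs)" if "m \<in> {1..nmsg n R2}" for m
    using code that by blast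
  have e1: "measure_pmf.prob O.source {(m1, m21, m2, s). dec1 (map snd (enc m1 m21 s)) \<noteq> m1} \<le> B"
    and e2: "measure_pmf.prob O.source {(m1, m21, m2, s). dec2 (map2 y2 (c m2) (map fst (enc m1 m21
      s))) \<noteq> (m21, m2)} \<le> B"
    using code B by linarith+
  \<comment> \<open>The chosen pair lies in the support of \<open>w\<close>, so it is the image of
    an input letter, and any such letter will do.\<close>
  define enc1 where "enc1 m1 m21 s i = (SOME x. (t1 x (s ! i), y1 x (s ! i)) = enc m1 m21 s ! i)"
    for m1 m21 s i
  have enc1: "(t1 (enc1 m1 m21 s i) (s ! i), y1 (enc1 m1 m21 s i) (s ! i)) = enc m1 m21 s ! i"
    if s: "s \<in> set_pmf (replicate_pmf n ps)" and i: "i < n" for m1 m21 s i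
  proof -
    have ls: "length s = n" using s by (simp add: set_replicate_pmf)
    have la: "list_all2 (\<lambda>a x. x \<in> set_pmf (w a)) (zip qs s) (enc m1 m21 s)"
      using enc[OF s] by (auto simp: Wn_def set_kern)
    have "enc m1 m21 s ! i \<in> set_pmf (w (qs ! i, s ! i))"
      using list_all2_nthD[OF la, of i] i ls len by simp
    then have "\<exists>x. (t1 x (s ! i), y1 x (s ! i)) = enc m1 m21 s ! i"
      by (auto simp: w_def)
    then show "(t1 (enc1 m1 m21 s i) (s ! i), y1 (enc1 m1 m21 s i) (s ! i)) = enc m1 m21 s ! i"
      unfolding enc1_def by (rule someI_ex)
  qed
  have lenc: "length (enc m1 m21 s) = n" if s: "s \<in> set_pmf (replicate_pmf n ps)" for m1 m21 s
    using length_kern[OF enc[OF s, unfolded Wn_def]] s len by (simp add: set_replicate_pmf)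
  have r1: "received1 y1 n enc1 m1 m21 s = map snd (enc m1 m21 s)"
    if s: "s \<in> set_pmf (replicate_pmf n ps)" for m1 m21 s
  proof -
    have "y1 (enc1 m1 m21 s i) (s ! i) = snd (enc m1 m21 s ! i)" if "i < n" for i
      using enc1[OF s that, of m1 m21] by (metis snd_conv)
    then show ?thesis
      using lenc[OF s] by (intro nth_equalityI) (auto simp: received1_def)
  qed
  have r2: "received2 t1 y2 n enc1 (\<lambda>m2 i. c m2 ! i) m1 m21 m2 s = map2 y2 (c m2) (map fst (enc m1
    m21 s))"
    if s: "s \<in> set_pmf (replicate_pmf n ps)" and m2: "m2 \<in> {1..nmsg n R2}" for m1 m21 m2 s
  proof -
    have "length (c m2) = n" using cV[OF m2] len by (auto dest: length_kern)
    moreover have "t1 (enc1 m1 m21 s i) (s ! i) = fst (enc m1 m21 s ! i)" if "i < n" for i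
      using enc1[OF s that, of m1 m21] by (metis fst_conv)
    ultimately show ?thesis
      using lenc[OF s] by (intro nth_equalityI) (auto simp: received2_def)
  qed
  have src: "source_pmf ps n R1 R21 R2 = O.source"
    by (simp add: source_pmf_unif O.source_def)
  have set_src: "s \<in> set_pmf (replicate_pmf n ps) \<and> m2 \<in> {1..nmsg n R2}" if "(m1, m21, m2, s) \<in>
    set_pmf O.source" for m1 m21 m2 s
    using that O.L2 set_unif[of "nmsg n R2"] by (simp add: O.source_def)
  have "error_prob1 ps y1 n R1 R21 R2 enc1 dec1 \<le> B"
    unfolding error_prob1_def src
    by (rule order_trans[OF prob_mono_set e1]) (use set_src r1 in fastforce)
  moreover have "error_prob2 ps t1 y2 n R1 R21 R2 enc1 (\<lambda>m2 i. c m2 ! i) dec2 \<le> B"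
    unfolding error_prob2_def src
    by (rule order_trans[OF prob_mono_set e2]) (use set_src r2 in fastforce)
  ultimately show ?thesis by blast
qed

lemma achievable_margin:
  assumes d: "0 < d" and R: "0 \<le> R1" "0 \<le> R21" "0 \<le> R2" "0 \<le> k" "R21 \<le> k"
    and c: "R1 = 0 \<or> R1 \<le> Hl 1 - d" "k = 0 \<or> k \<le> Hl 2 - d"
      "k = 0 \<and> R1 = 0 \<or> k + R1 \<le> Hl 3 - d" "R2 = 0 \<or> R2 \<le> Hl 4 - d"
      "R2 = 0 \<or> R2 + R21 - k \<le> Hl 5 - Hl 6 - d"
  shows "achievable ps y1 t1 y2 R1 R21 R2"
  unfolding achievable_def
proof (intro conjI R allI impI)
  fix \<epsilon> :: real assume eps: "0 < \<epsilon>"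
  define B where "B n = 6 * (\<Sum>j\<in>{1..6}. measure_pmf.prob (replicate_pmf n letter)
      {ws. \<not> typical letter (\<lambda>\<omega>. - log 2 (dens j \<omega>)) (d / 4) ws}) + 32 * 2 powr (- (real n * d /
        4))" for n
  define C where "C = (\<Sum>j\<in>{1..6}. ex letter (\<lambda>x. (- log 2 (dens j x) - ex letter (\<lambda>\<omega>. - log 2 (dens
    j \<omega>)))\<^sup>2) / (d / 4)\<^sup>2)"
  have le: "B n \<le> 6 * (C / n) + 32 * 2 powr (- (real n * d / 4))" if "0 < n" for n
    unfolding B_def C_def sum_divide_distrib using d that
    by (intro add_right_mono mult_left_mono sum_mono atypical_le finite_set_pmf_finite) auto
  have lim: "(\<lambda>n. 6 * (C / real n) + 32 * 2 powr (- (real n * d / 4))) \<longlonglongrightarrow> 6 * 0 + 32 * 0"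
  proof (intro tendsto_add tendsto_mult tendsto_const)
    show "(\<lambda>n. C / real n) \<longlonglongrightarrow> 0" by (rule lim_const_over_n)
    have "(\<lambda>n. (2 powr (- (d / 4))) ^ n) \<longlonglongrightarrow> 0"
      using d by (intro LIMSEQ_power_zero) (simp add: powr_less_one)
    then show "(\<lambda>n. 2 powr (- (real n * d / 4))) \<longlonglongrightarrow> 0"
      by (simp add: powr_realpow[symmetric] powr_powr mult.commute)
  qed
  then have "\<forall>\<^sub>F n in sequentially. 6 * (C / real n) + 32 * 2 powr (- (real n * d / 4)) < \<epsilon>"
    using eps by (intro order_tendstoD(2)) auto
  moreover have "\<forall>\<^sub>F n in sequentially. 8 / d \<le> real n"
    using filterlim_real_sequentially unfolding filterlim_at_top by blast
  moreover have "\<forall>\<^sub>F n in sequentially. 0 < (n::nat)"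
    by (rule eventually_gt_at_top)
  ultimately show "\<forall>\<^sub>F n in sequentially. \<exists>enc1 enc2 dec1 dec2.
        error_prob1 ps y1 n R1 R21 R2 enc1 dec1 \<le> \<epsilon> \<and>
        error_prob2 ps t1 y2 n R1 R21 R2 enc1 enc2 dec2 \<le> \<epsilon>"
  proof eventually_elim
    case (elim n)
    have n: "8 \<le> real n * d" using elim(2) d by (simp add: field_simps)
    have Be: "B n \<le> \<epsilon>" using le[OF elim(3)] elim(1) by simp
    show ?case
      using block_code[OF d n R c] Be unfolding B_def by (meson order_trans)
  qed
qed

end

section \<open>The single-letter constraints\<close>

lemma information_space_pmf: "information_space (measure_pmf P) 2"
  by (simp add: information_space_def information_space_axioms_def measure_pmf.prob_space_axioms)

lemma simple_distributed_pmf: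
  "simple_distributed (measure_pmf (P :: 'a::finite pmf)) X (pmf (map_pmf X P))"
  using prob_space.simple_distributedI[OF measure_pmf.prob_space_axioms[of P], of X "pmf (map_pmf X
    P)"]
  by (simp add: pmf_map simple_function_def)

lemma ex_range:
  fixes P :: "'a::finite pmf"
  shows "ex P (\<lambda>\<omega>. g (X \<omega>)) = (\<Sum>x\<in>range X. pmf (map_pmf X P) x * g x)"
proof -
  have "ex P (\<lambda>\<omega>. g (X \<omega>)) = ex (map_pmf X P) g"
    by (simp add: ex_map)
  also have "\<dots> = (\<Sum>x\<in>range X. pmf (map_pmf X P) x * g x)"
    by (intro ex_superset) auto
  finally show ?thesis .
qed

text \<open>The library's sum runs over the whole range; by \<open>ex_range\<close> it is an
  expectation, and on the support the logarithm of the quotient splits.\<close>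

lemma cond_entropy_cent:
  fixes P :: "'a::finite pmf"
  shows "cond_entropy P X Y = cent P X Y"
proof -
  have "cond_entropy P X Y = - (\<Sum>(x, y)\<in>range (\<lambda>\<omega>. (X \<omega>, Y \<omega>)). pmf (map_pmf (\<lambda>\<omega>. (X \<omega>, Y \<omega>)) P) (x,
    y) *
      log 2 (pmf (map_pmf (\<lambda>\<omega>. (X \<omega>, Y \<omega>)) P) (x, y) / pmf (map_pmf Y P) y))"
    using information_space.conditional_entropy_eq[OF information_space_pmf simple_distributed_pmf
      simple_distributed_pmf, of P X Y]
    by simp
  also have "\<dots> = - ex P (\<lambda>\<omega>. (\<lambda>(x, y). log 2 (pmf (map_pmf (\<lambda>\<omega>. (X \<omega>, Y \<omega>)) P) (x, y) / pmf (map_pmf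
    Y P) y)) (X \<omega>, Y \<omega>))"
    by (subst ex_range) (simp add: case_prod_unfold)
  also have "\<dots> = - ex P (\<lambda>\<omega>. - log 2 (pmf (map_pmf Y P) (Y \<omega>)) - - log 2 (pmf (map_pmf (\<lambda>\<omega>. (X \<omega>, Y
    \<omega>)) P) (X \<omega>, Y \<omega>)))"
  proof (intro arg_cong[where f = uminus] ex_cong)
    fix \<omega> assume w: "\<omega> \<in> set_pmf P"
    show "(\<lambda>(x, y). log 2 (pmf (map_pmf (\<lambda>\<omega>. (X \<omega>, Y \<omega>)) P) (x, y) / pmf (map_pmf Y P) y)) (X \<omega>, Y
      \<omega>) =
      - log 2 (pmf (map_pmf Y P) (Y \<omega>)) - - log 2 (pmf (map_pmf (\<lambda>\<omega>. (X \<omega>, Y \<omega>)) P) (X \<omega>, Y \<omega>))"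
      using pmf_map_pos[OF w, where X = Y] pmf_map_pos[OF w, where X = "\<lambda>\<omega>. (X \<omega>, Y \<omega>)"]
      by (simp add: log_divide_pos)
  qed
  also have "\<dots> = cent P X Y"
    by (simp only: ex_diff cent_def ent_def minus_diff_eq)
  finally show ?thesis .
qed

lemma cond_mutual_info_ent:
  fixes P :: "'a::finite pmf"
  shows "cond_mutual_info P X Y Z = cent P X Z - cent P X (\<lambda>\<omega>. (Y \<omega>, Z \<omega>))"
proof -
  define p where "p = pmf (map_pmf (\<lambda>\<omega>. (X \<omega>, Y \<omega>, Z \<omega>)) P)"
  define pxz where "pxz = pmf (map_pmf (\<lambda>\<omega>. (X \<omega>, Z \<omega>)) P)"
  define pyz where "pyz = pmf (map_pmf (\<lambda>\<omega>. (Y \<omega>, Z \<omega>)) P)"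
  define pz where "pz = pmf (map_pmf Z P)"
  define r where "r = (\<lambda>(x, y, z). log 2 (p (x, y, z) / (pxz (x, z) * (pyz (y, z) / pz z))))"
  have "cond_mutual_info P X Y Z = (\<Sum>(x, y, z)\<in>range (\<lambda>\<omega>. (X \<omega>, Y \<omega>, Z \<omega>)).
      p (x, y, z) * log 2 (p (x, y, z) / (pxz (x, z) * (pyz (y, z) / pz z))))"
    using information_space.conditional_mutual_information_eq[OF information_space_pmf
      simple_distributed_pmf
      simple_distributed_pmf simple_distributed_pmf simple_distributed_pmf, of P X Y Z]
    by (simp add: p_def pxz_def pyz_def pz_def)
  also have "\<dots> = ex P (\<lambda>\<omega>. r (X \<omega>, Y \<omega>, Z \<omega>))"
    by (subst ex_range) (simp add: case_prod_unfold r_def p_def)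
  also have "\<dots> = ex P (\<lambda>\<omega>. (- log 2 (pxz (X \<omega>, Z \<omega>)) - - log 2 (pz (Z \<omega>))) -
      (- log 2 (p (X \<omega>, Y \<omega>, Z \<omega>)) - - log 2 (pyz (Y \<omega>, Z \<omega>))))"
  proof (rule ex_cong)
    fix \<omega> assume w: "\<omega> \<in> set_pmf P"
    show "r (X \<omega>, Y \<omega>, Z \<omega>) = (- log 2 (pxz (X \<omega>, Z \<omega>)) - - log 2 (pz (Z \<omega>))) -
      (- log 2 (p (X \<omega>, Y \<omega>, Z \<omega>)) - - log 2 (pyz (Y \<omega>, Z \<omega>)))"
      using pmf_map_pos[OF w, where X = Z] pmf_map_pos[OF w, where X = "\<lambda>\<omega>. (X \<omega>, Z \<omega>)"]
        pmf_map_pos[OF w, where X = "\<lambda>\<omega>. (Y \<omega>, Z \<omega>)"] pmf_map_pos[OF w, where X = "\<lambda>\<omega>. (X \<omega>, Y \<omega>, Z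
          \<omega>)"]
      by (simp add: r_def p_def pxz_def pyz_def pz_def log_divide_pos log_mult_pos)
  qed
  also have "\<dots> = cent P X Z - cent P X (\<lambda>\<omega>. (Y \<omega>, Z \<omega>))"
    by (simp only: ex_diff cent_def ent_def p_def pxz_def pyz_def pz_def)
  finally show ?thesis .
qed

section \<open>Constraints as averages over the time-sharing variable\<close>

text \<open>The law of one channel use once the value of the time-sharing variable is fixed.\<close>

definition single :: "'s pmf \<Rightarrow> ('s \<Rightarrow> 'x1 pmf) \<Rightarrow> 'x2 pmf \<Rightarrow> ('s \<times> 'x1 \<times> 'x2) pmf" where
  "single ps a b = bind_pmf ps (\<lambda>s. bind_pmf (a s) (\<lambda>x1. map_pmf (\<lambda>x2. (s, x1, x2)) b))"

text \<open>
  The entropies \<open>H(Y\<^sub>1|S)\<close>, \<open>H(T\<^sub>1|S)\<close>, \<open>H(T\<^sub>1,Y\<^sub>1|S)\<close>, \<open>H(Y\<^sub>2|T\<^sub>1)\<close>, \<open>H(Y\<^sub>2)\<close>, \<open>H(T\<^sub>1)\<close>,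
  in this order.
\<close>
definition entropies :: "('x1 \<Rightarrow> 's \<Rightarrow> 'y1) \<Rightarrow> ('x1 \<Rightarrow> 's \<Rightarrow> 't) \<Rightarrow> ('x2 \<Rightarrow> 't \<Rightarrow> 'y2) \<Rightarrow>
    ('s \<times> 'x1 \<times> 'x2) pmf \<Rightarrow> nat \<Rightarrow> real" where
  "entropies y1 t1 y2 J j =
    (let S = (\<lambda>(s, x1, x2). s); T = (\<lambda>(s, x1, x2). t1 x1 s); Y1 = (\<lambda>(s, x1, x2). y1 x1 s);
         Y2 = (\<lambda>(s, x1, x2). y2 x2 (t1 x1 s))
     in if j = 1 then cent J Y1 S
        else if j = 2 then cent J T S
        else if j = 3 then cent J (\<lambda>\<omega>. (T \<omega>, Y1 \<omega>)) S
        else if j = 4 then cent J Y2 T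
        else if j = 5 then ent J Y2
        else ent J T)"

text \<open>\<open>H(Y1|T1,S)\<close> is \<open>g 3 - g 2\<close> and \<open>I(T1;S)\<close> is
  \<open>g 6 - g 2\<close>, so six entropies suffice and every constraint is linear in them; in the
  last one \<open>g 2\<close> cancels.\<close>

definition bounds :: "(nat \<Rightarrow> real) \<Rightarrow> real \<Rightarrow> real \<Rightarrow> real \<Rightarrow> bool" where
  "bounds g R1 R21 R2 \<longleftrightarrow> R1 \<le> g 1 \<and> R2 \<le> g 4 \<and> R21 \<le> g 2 \<and> R1 + R21 \<le> g 3 \<and>
    R2 + R21 \<le> g 5 - g 6 + g 2 \<and> R1 + R2 + R21 \<le> g 3 + g 5 - g 6"

text \<open>Conditioning on \<open>Q\<close> becomes an average over \<open>q\<close>. The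
  right-hand sides are thereby linear in the law of \<open>Q\<close>, on which both the use of the
  time index and the reduction to six values rest.\<close>

lemma rate_constraints_iff:
  fixes ps :: "'s::finite pmf" and y1 :: "'x1::finite \<Rightarrow> 's \<Rightarrow> 'y1" and t1 :: "'x1 \<Rightarrow> 's \<Rightarrow> 't"
    and y2 :: "'x2::finite \<Rightarrow> 't \<Rightarrow> 'y2" and pq :: "'q::finite pmf"
  shows "rate_constraints ps y1 t1 y2 pq px1 px2 R1 R21 R2 \<longleftrightarrow>
    bounds (\<lambda>j. ex pq (\<lambda>q. entropies y1 t1 y2 (single ps (\<lambda>s. px1 s q) (px2 q)) j)) R1 R21 R2"
proof -
  define Q :: "'q \<times> 's \<times> 'x1 \<times> 'x2 \<Rightarrow> 'q" where "Q = (\<lambda>(q, s, x1, x2). q)"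
  define S :: "'q \<times> 's \<times> 'x1 \<times> 'x2 \<Rightarrow> 's" where "S = (\<lambda>(q, s, x1, x2). s)"
  define T :: "'q \<times> 's \<times> 'x1 \<times> 'x2 \<Rightarrow> 't" where "T = (\<lambda>(q, s, x1, x2). t1 x1 s)"
  define Y1 :: "'q \<times> 's \<times> 'x1 \<times> 'x2 \<Rightarrow> 'y1" where "Y1 = (\<lambda>(q, s, x1, x2). y1 x1 s)"
  define Y2 :: "'q \<times> 's \<times> 'x1 \<times> 'x2 \<Rightarrow> 'y2" where "Y2 = (\<lambda>(q, s, x1, x2). y2 x2 (t1 x1 s))"
  define P where "P = joint_pmf pq ps px1 px2"
  define J where "J q = single ps (\<lambda>s. px1 s q) (px2 q)" for q
  define g where "g j = ex pq (\<lambda>q. entropies y1 t1 y2 (J q) j)" for j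
  have P: "P = bind_pmf pq (\<lambda>q. map_pmf (Pair q) (J q))"
    by (simp add: P_def joint_pmf_def J_def single_def map_bind_pmf map_pmf_comp)
      (simp add: map_pmf_def)
  have mix: "cent P X (\<lambda>\<omega>. (Z \<omega>, Q \<omega>)) = ex pq (\<lambda>q. cent (J q) (\<lambda>\<omega>. X (q, \<omega>)) (\<lambda>\<omega>. Z (q, \<omega>)))"
    "cent P X Q = ex pq (\<lambda>q. ent (J q) (\<lambda>\<omega>. X (q, \<omega>)))" for X :: "_ \<Rightarrow> 'u" and Z :: "_ \<Rightarrow> 'v"
    unfolding P by (subst cent_mixture; auto simp: cent_def ent_map Q_def)+
  have 1: "cent P Y1 (\<lambda>\<omega>. (S \<omega>, Q \<omega>)) = g 1"
    and 2: "cent P T (\<lambda>\<omega>. (S \<omega>, Q \<omega>)) = g 2"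
    and 3: "cent P (\<lambda>\<omega>. (T \<omega>, Y1 \<omega>)) (\<lambda>\<omega>. (S \<omega>, Q \<omega>)) = g 3"
    and 4: "cent P Y2 (\<lambda>\<omega>. (T \<omega>, Q \<omega>)) = g 4"
    and 5: "cent P Y2 Q = g 5" and 6: "cent P T Q = g 6"
    by (simp_all add: mix g_def entropies_def S_def T_def Y1_def Y2_def)
  have 7: "cent P Y1 (\<lambda>\<omega>. (T \<omega>, S \<omega>, Q \<omega>)) = g 3 - g 2"
  proof -
    have "cent P (\<lambda>\<omega>. (T \<omega>, Y1 \<omega>)) (\<lambda>\<omega>. (S \<omega>, Q \<omega>)) = cent P (\<lambda>\<omega>. (Y1 \<omega>, T \<omega>)) (\<lambda>\<omega>. (S \<omega>, Q \<omega>))"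
      unfolding cent_def by (intro arg_cong2[where f = minus] ent_cong) auto
    then show ?thesis using 2 3 cent_chain[of P Y1 T "\<lambda>\<omega>. (S \<omega>, Q \<omega>)"] by simp
  qed
  have "rate_constraints ps y1 t1 y2 pq px1 px2 R1 R21 R2 \<longleftrightarrow>
      R1 \<le> g 1 \<and> R2 \<le> g 4 \<and> R21 \<le> g 2 \<and> R1 + R21 \<le> g 3 \<and>
      R2 + R21 \<le> g 5 - (g 6 - g 2) \<and> R1 + R2 + R21 \<le> g 3 - g 2 + g 5 - (g 6 - g 2)"
    unfolding rate_constraints_def Let_def cond_entropy_cent cond_mutual_info_ent
    unfolding P_def[symmetric] Q_def[symmetric] S_def[symmetric] T_def[symmetric] Y1_def[symmetric]
      Y2_def[symmetric]
    unfolding 1 2 3 4 5 6 7 by (rule refl)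
  then show ?thesis
    unfolding bounds_def g_def J_def by (auto simp: algebra_simps)
qed

section \<open>From the constraints to the capacity region\<close>

context coding
begin

lemma entropies_cond:
  "entropies y1 t1 y2 (single ps a b) 1 = ex ps (\<lambda>s. ent (a s) (\<lambda>x. y1 x s))"
  "entropies y1 t1 y2 (single ps a b) 2 = ex ps (\<lambda>s. ent (a s) (\<lambda>x. t1 x s))"
  "entropies y1 t1 y2 (single ps a b) 3 = ex ps (\<lambda>s. ent (a s) (\<lambda>x. (t1 x s, y1 x s)))"
proof -
  have "cent (single ps a b) (\<lambda>(s, x1, x2). F s x1) (\<lambda>(s, x1, x2). s) = ex ps (\<lambda>s. ent (a s) (F s))"
    for F :: "'s \<Rightarrow> 'x1 \<Rightarrow> 'u"
  proof -
    have fm: "map_pmf fst (bind_pmf (a s) (\<lambda>x1. map_pmf (Pair x1) b)) = a s" for s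
      by (simp add: map_bind_pmf map_pmf_comp map_pmf_const bind_return_pmf')
    have "cent (single ps a b) (\<lambda>(s, x1, x2). F s x1) (\<lambda>(s, x1, x2). s) =
        ex ps (\<lambda>s. ent (bind_pmf (a s) (\<lambda>x1. map_pmf (\<lambda>x2. (s, x1, x2)) b)) (\<lambda>(s, x1, x2). F s x1))"
      unfolding single_def by (subst cent_mixture) auto
    also have "\<dots> = ex ps (\<lambda>s. ent (map_pmf (Pair s) (bind_pmf (a s) (\<lambda>x1. map_pmf (Pair x1) b)))
      (\<lambda>(s, x1, x2). F s x1))"
      by (simp add: map_bind_pmf map_pmf_comp)
    also have "\<dots> = ex ps (\<lambda>s. ent (map_pmf fst (bind_pmf (a s) (\<lambda>x1. map_pmf (Pair x1) b))) (F s))"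
      by (simp add: ent_map case_prod_unfold)
    finally show ?thesis by (simp add: fm)
  qed
  note * = this
  show "entropies y1 t1 y2 (single ps a b) 1 = ex ps (\<lambda>s. ent (a s) (\<lambda>x. y1 x s))"
    "entropies y1 t1 y2 (single ps a b) 2 = ex ps (\<lambda>s. ent (a s) (\<lambda>x. t1 x s))"
    using *[of "\<lambda>s x. y1 x s"] *[of "\<lambda>s x. t1 x s"] by (simp_all add: entropies_def)
  show "entropies y1 t1 y2 (single ps a b) 3 = ex ps (\<lambda>s. ent (a s) (\<lambda>x. (t1 x s, y1 x s)))"
    using *[of "\<lambda>s x. (t1 x s, y1 x s)"] by (simp add: entropies_def case_prod_unfold)
qed

lemma ex_wT: "ex (wT q) g = ex ps (\<lambda>s. ex (w (q, s)) (\<lambda>u. g (fst u)))"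
  by (simp add: wT_def ex_bind ex_map)

lemma single_TX:
  "map_pmf (\<lambda>(s, x1, x2). (t1 x1 s, x2)) (single ps (\<lambda>s. px1 s q) (px2 q)) =
    bind_pmf (wT q) (\<lambda>t. map_pmf (Pair t) (px2 q))"
  by (simp add: single_def wT_def w_def map_bind_pmf map_pmf_comp bind_assoc_pmf bind_map_pmf)

lemma entropies_second:
  defines "J q \<equiv> single ps (\<lambda>s. px1 s q) (px2 q)"
  shows "entropies y1 t1 y2 (J q) 4 = ex (wT q) (\<lambda>t. ent (px2 q) (\<lambda>x. y2 x t))"
    and "entropies y1 t1 y2 (J q) 5 = ent (wY2 q) (\<lambda>z. z)"
    and "entropies y1 t1 y2 (J q) 6 = ent (wT q) (\<lambda>z. z)"
proof -
  define TX where "TX = (\<lambda>(s, x1, x2 :: 'x2). (t1 x1 s, x2))"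
  have m: "map_pmf TX (J q) = bind_pmf (wT q) (\<lambda>t. map_pmf (Pair t) (px2 q))"
    unfolding TX_def J_def by (rule single_TX)
  have "cent (J q) (\<lambda>\<omega>. (\<lambda>(t, x). y2 x t) (TX \<omega>)) (\<lambda>\<omega>. fst (TX \<omega>)) =
      cent (map_pmf TX (J q)) (\<lambda>(t, x). y2 x t) fst"
    by (simp add: cent_def ent_map)
  also have "\<dots> = ex (wT q) (\<lambda>t. ent (map_pmf (Pair t) (px2 q)) (\<lambda>(t, x). y2 x t))"
    unfolding m by (subst cent_mixture) auto
  finally show "entropies y1 t1 y2 (J q) 4 = ex (wT q) (\<lambda>t. ent (px2 q) (\<lambda>x. y2 x t))"
    by (simp add: entropies_def TX_def case_prod_unfold ent_map)
  have "ent (J q) (\<lambda>\<omega>. (\<lambda>(t, x). y2 x t) (TX \<omega>)) = ent (map_pmf (\<lambda>(t, x). y2 x t) (map_pmf TX (J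
    q))) (\<lambda>z. z)"
    by (simp add: ent_map)
  also have "map_pmf (\<lambda>(t, x). y2 x t) (map_pmf TX (J q)) = wY2 q"
    unfolding m wY2_def wZ_def by (simp add: map_bind_pmf map_pmf_comp)
  finally show "entropies y1 t1 y2 (J q) 5 = ent (wY2 q) (\<lambda>z. z)"
    by (simp add: entropies_def TX_def case_prod_unfold)
  have "ent (J q) (\<lambda>\<omega>. fst (TX \<omega>)) = ent (map_pmf fst (map_pmf TX (J q))) (\<lambda>z. z)"
    by (simp add: ent_map)
  also have "map_pmf fst (map_pmf TX (J q)) = wT q"
    unfolding m by (simp add: map_bind_pmf map_pmf_comp map_pmf_const bind_return_pmf')
  finally show "entropies y1 t1 y2 (J q) 6 = ent (wT q) (\<lambda>z. z)"
    by (simp add: entropies_def TX_def case_prod_unfold)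
qed

lemma Hl_entropies:
  assumes "j \<in> {1..6}"
  shows "Hl j = ex pq (\<lambda>q. entropies y1 t1 y2 (single ps (\<lambda>s. px1 s q) (px2 q)) j)"
proof -
  have wn: "ent (w (q, s)) r = ent (px1 s q) (\<lambda>x. r (t1 x s, y1 x s))" for q s and r :: "_ \<Rightarrow> 'u"
    by (simp add: w_def ent_map)
  consider "j = 1" | "j = 2" | "j = 3" | "j = 4" | "j = 5" | "j = 6"
    using assms by (auto simp: numeral_eq_Suc le_Suc_eq)
  then show ?thesis
  proof cases
    case 1
    have "Hl j = ex pq (\<lambda>q. ex ps (\<lambda>s. ent (w (q, s)) snd))"
      using 1 by (simp add: Hl_def ex_letter dens_def ent_def case_prod_unfold ex_const)
    then show ?thesis using 1 by (simp only: entropies_cond wn snd_conv)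
  next
    case 2
    have "Hl j = ex pq (\<lambda>q. ex ps (\<lambda>s. ent (w (q, s)) fst))"
      using 2 by (simp add: Hl_def ex_letter dens_def ent_def case_prod_unfold ex_const)
    then show ?thesis using 2 by (simp only: entropies_cond wn fst_conv)
  next
    case 3
    have "Hl j = ex pq (\<lambda>q. ex ps (\<lambda>s. ent (w (q, s)) (\<lambda>u. u)))"
      using 3 by (simp add: Hl_def ex_letter dens_def ent_def case_prod_unfold ex_const)
    then show ?thesis using 3 by (simp only: entropies_cond wn)
  next
    case 4
    then show ?thesis
      by (simp add: Hl_def ex_letter dens_def case_prod_unfold entropies_second ex_wT ent_def
        wZ_def)
  next
    case 5
    have "ent (wY2 q) (\<lambda>z. z) = ex (wT q) (\<lambda>t. ex (px2 q) (\<lambda>x. - log 2 (pmf (wY2 q) (y2 x t))))" for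
      q
      unfolding ent_def by (subst (1) wY2_def) (simp add: ex_bind ex_map wZ_def)
    then show ?thesis using 5
      by (simp add: Hl_def ex_letter dens_def case_prod_unfold entropies_second ex_wT)
  next
    case 6
    then show ?thesis
      by (simp add: Hl_def ex_letter dens_def case_prod_unfold entropies_second ent_def ex_wT
        ex_const)
  qed
qed

text \<open>Fourier-Motzkin elimination of the hash rate: the constraints leave room for an
  admissible \<open>k\<close>. Each rate is lowered by \<open>d\<close>, or to 0;
  \<open>d / 2\<close> is used as the margin in \<open>achievable_margin\<close> and enters the
  choice of \<open>k\<close> as well.\<close>

lemma rate_constraints_capacity:
  assumes rc: "rate_constraints ps y1 t1 y2 pq px1 px2 R1 R21 R2"
    and R: "0 \<le> R1" "0 \<le> R21" "0 \<le> R2"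
  shows "(R1, R21, R2) \<in> capacity_region ps y1 t1 y2"
proof -
  have b: "bounds Hl R1 R21 R2"
    using rc unfolding rate_constraints_iff bounds_def by (simp add: Hl_entropies)
  have pos: "0 \<le> Hl 3 - Hl 2"
  proof -
    have "Hl 2 \<le> Hl 3"
      by (simp add: Hl_entropies entropies_cond) (intro ex_mono ent_mono, auto)
    then show ?thesis by simp
  qed
  have ach: "achievable ps y1 t1 y2 (max 0 (R1 - d)) (max 0 (R21 - d)) (max 0 (R2 - d))" if d: "0 <
    d" for d
  proof -
    define R1' R21' R2' where "R1' = max 0 (R1 - d)" and "R21' = max 0 (R21 - d)" and "R2' = max 0
      (R2 - d)"
    \<comment> \<open>the least hash rate for which receiver 2 can tell the interference sequences apart\<close>
    define k where "k = (if R2' = 0 then R21' else max R21' (R21' + R2' + Hl 6 - Hl 5 + d / 2))"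
    have "achievable ps y1 t1 y2 R1' R21' R2'"
      by (rule achievable_margin[where d = "d / 2" and k = k])
        (use b d pos R in \<open>auto simp: R1'_def R21'_def R2'_def k_def bounds_def max_def split:
          if_splits\<close>)
    then show ?thesis by (simp add: R1'_def R21'_def R2'_def)
  qed
  define x where "x n = (max 0 (R1 - 1 / real (Suc n)), max 0 (R21 - 1 / real (Suc n)), max 0 (R2 -
    1 / real (Suc n)))" for n
  have "x n \<in> {(R1, R21, R2). achievable ps y1 t1 y2 R1 R21 R2}" for n
    using ach[of "1 / real (Suc n)"] by (simp add: x_def)
  moreover have "x \<longlonglongrightarrow> (max 0 (R1 - 0), max 0 (R21 - 0), max 0 (R2 - 0))"
    unfolding x_def by (intro tendsto_Pair tendsto_max tendsto_diff tendsto_const lim_1_over_n[THEN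
      LIMSEQ_Suc])
  ultimately show ?thesis
    unfolding capacity_region_def closure_sequential using R by (auto simp: max_def)
qed

end

section \<open>The converse for one code\<close>

lemma cent_cong:
  assumes "\<And>\<omega> \<omega>'. \<omega> \<in> set_pmf P \<Longrightarrow> \<omega>' \<in> set_pmf P \<Longrightarrow> X \<omega> = X \<omega>' \<and> Z \<omega> = Z \<omega>' \<longleftrightarrow> X' \<omega> = X' \<omega>' \<and> Z' \<omega> =
    Z' \<omega>'"
    and "\<And>\<omega> \<omega>'. \<omega> \<in> set_pmf P \<Longrightarrow> \<omega>' \<in> set_pmf P \<Longrightarrow> Z \<omega> = Z \<omega>' \<longleftrightarrow> Z' \<omega> = Z' \<omega>'"
  shows "cent P X Z = cent P X' Z'"
proof -
  have "ent P (\<lambda>\<omega>. (X \<omega>, Z \<omega>)) = ent P (\<lambda>\<omega>. (X' \<omega>, Z' \<omega>))"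
    by (rule ent_cong) (use assms(1) in blast)
  moreover have "ent P Z = ent P Z'"
    by (rule ent_cong) (use assms(2) in blast)
  ultimately show ?thesis by (simp add: cent_def)
qed

lemma cent_le_ent: "finite (set_pmf P) \<Longrightarrow> cent P X Y \<le> ent P X"
  using cent_antimono[of P Y "\<lambda>_. ()" X] by (simp add: cent_unit)

lemma ent_pair_le: "finite (set_pmf P) \<Longrightarrow> ent P (\<lambda>\<omega>. (X \<omega>, Y \<omega>)) \<le> ent P X + ent P Y"
  using cent_le_ent[of P X Y] by (simp add: cent_def)

text \<open>By the chain rule each letter is conditioned on more than its own \<open>Z i\<close>,
  and dropping the rest can only increase the entropy. Applied to the state given the interference,
  the bound yields mutual information from below.\<close>

lemma cent_list_le:
  assumes fin: "finite (set_pmf P)"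
  shows "cent P (\<lambda>\<omega>. map (\<lambda>i. X i \<omega>) [0..<n]) (\<lambda>\<omega>. map (\<lambda>i. Z i \<omega>) [0..<n]) \<le> (\<Sum>i<n. cent P (X i) (Z
    i))"
proof (induction n)
  case 0
  then show ?case by (simp add: cent_def ent_unit fin)
next
  case (Suc n)
  let ?X = "\<lambda>\<omega>. map (\<lambda>i. X i \<omega>) [0..<n]" and ?Z = "\<lambda>\<omega>. map (\<lambda>i. Z i \<omega>) [0..<n]"
  have "cent P (\<lambda>\<omega>. map (\<lambda>i. X i \<omega>) [0..<Suc n]) (\<lambda>\<omega>. map (\<lambda>i. Z i \<omega>) [0..<Suc n]) =
      cent P (\<lambda>\<omega>. (X n \<omega>, ?X \<omega>)) (\<lambda>\<omega>. (Z n \<omega>, ?Z \<omega>))"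
    by (rule cent_cong) auto
  also have "\<dots> = cent P ?X (\<lambda>\<omega>. (Z n \<omega>, ?Z \<omega>)) + cent P (X n) (\<lambda>\<omega>. (?X \<omega>, Z n \<omega>, ?Z \<omega>))"
    by (rule cent_chain)
  also have "\<dots> \<le> cent P ?X ?Z + cent P (X n) (Z n)"
    by (intro add_mono cent_antimono fin) auto
  finally show ?case using Suc by simp
qed

abbreviation pairing :: "('w \<Rightarrow> 'a) \<Rightarrow> ('w \<Rightarrow> 'b) \<Rightarrow> 'w \<Rightarrow> 'a \<times> 'b" (infixr "\<bowtie>" 60) where
  "X \<bowtie> Y \<equiv> \<lambda>\<omega>. (X \<omega>, Y \<omega>)"

text \<open>Independence of the messages and the state enters only through \<open>tot\<close>
  together with \<open>l\<close>: by subadditivity, parts given the rest keep their full entropy.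
  The encoders, the channel and its injectivity enter as functional dependences.\<close>

lemma converse_entropy:
  fixes P :: "'w pmf" and M1 M21 M2 :: "'w \<Rightarrow> nat"
  assumes fin: "finite (set_pmf P)"
    and T: "\<forall>u\<in>set_pmf P. \<forall>v\<in>set_pmf P. M1 u = M1 v \<and> M21 u = M21 v \<and> S u = S v \<longrightarrow> T u = T v"
    and Y1: "\<forall>u\<in>set_pmf P. \<forall>v\<in>set_pmf P. M1 u = M1 v \<and> M21 u = M21 v \<and> S u = S v \<longrightarrow> Y1 u = Y1 v"
    and Y2: "\<forall>u\<in>set_pmf P. \<forall>v\<in>set_pmf P. M2 u = M2 v \<and> T u = T v \<longrightarrow> Y2 u = Y2 v"
    and inj: "\<forall>u\<in>set_pmf P. \<forall>v\<in>set_pmf P. M2 u = M2 v \<and> Y2 u = Y2 v \<longrightarrow> T u = T v"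
    and tot: "ent P (M1 \<bowtie> M21 \<bowtie> M2 \<bowtie> S) = l1 + l21 + l2 + ent P S"
    and l: "ent P M1 \<le> l1" "ent P M21 \<le> l21" "ent P M2 \<le> l2"
    and f1: "cent P M1 Y1 \<le> f1" and f2: "cent P (M21 \<bowtie> M2) Y2 \<le> f2"
  shows "l1 \<le> cent P Y1 S + f1" "l2 \<le> cent P Y2 T + f2" "l21 \<le> cent P T S + f2"
    "l1 + l21 \<le> cent P (T \<bowtie> Y1) S + f1 + f2"
    "l2 + l21 \<le> ent P Y2 - (ent P S - cent P S T) + f2"
    "l1 + l2 + l21 \<le> cent P Y1 (T \<bowtie> S) + ent P Y2 - (ent P S - cent P S T) + f1 + f2"
proof -
  note anti = cent_antimono[OF fin]
  let ?all = "M1 \<bowtie> M21 \<bowtie> M2 \<bowtie> S"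
  have E1: "ent P ?all = ent P (M1 \<bowtie> M21 \<bowtie> S \<bowtie> M2)"
    by (rule ent_cong) auto
  have E2: "ent P ?all = ent P (\<lambda>\<omega>. ((M1 \<omega>, M21 \<omega>), M2 \<omega>, S \<omega>))"
    by (rule ent_cong) auto
  have E3: "ent P ?all = ent P (M21 \<bowtie> M1 \<bowtie> M2 \<bowtie> S)"
    by (rule ent_cong) auto
  have E4: "ent P ?all = ent P (M2 \<bowtie> M1 \<bowtie> M21 \<bowtie> S)"
    by (rule ent_cong) auto
  have E5: "ent P ?all = ent P (S \<bowtie> M1 \<bowtie> M21 \<bowtie> M2)"
    by (rule ent_cong) auto
  note sub = ent_pair_le[OF fin]
  have i1: "l1 \<le> cent P M1 (M21 \<bowtie> M2 \<bowtie> S)"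
    using tot l sub[of M21 "M2 \<bowtie> S"] sub[of M2 S] by (simp add: cent_def)
  have i2: "l2 \<le> cent P M2 (M1 \<bowtie> M21 \<bowtie> S)"
    using tot l E4 sub[of M1 "M21 \<bowtie> S"] sub[of M21 S] by (simp add: cent_def)
  have i21: "l21 \<le> cent P M21 (M1 \<bowtie> M2 \<bowtie> S)"
    using tot l E3 sub[of M1 "M2 \<bowtie> S"] sub[of M2 S] by (simp add: cent_def)
  have i12: "l1 + l21 \<le> cent P (M1 \<bowtie> M21) (M2 \<bowtie> S)"
    using tot l E2 sub[of M2 S] by (simp add: cent_def)
  have iS: "ent P S \<le> cent P S (M1 \<bowtie> M21 \<bowtie> M2)"
    using tot l E5 sub[of M1 "M21 \<bowtie> M2"] sub[of M21 M2] by (simp add: cent_def)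
  have i22: "l2 + l21 \<le> ent P (M21 \<bowtie> M2)"
  proof -
    have "ent P (M21 \<bowtie> M2 \<bowtie> S) = ent P (\<lambda>\<omega>. ((M21 \<omega>, M2 \<omega>), S \<omega>))"
      by (rule ent_cong) auto
    then show ?thesis
      using tot l sub[of M1 "M21 \<bowtie> M2 \<bowtie> S"] sub[of "M21 \<bowtie> M2" S] by simp
  qed
  note dec = cent_decode[OF fin]
  have c1: "cent P M1 (M21 \<bowtie> M2 \<bowtie> S) \<le> cent P M1 S" by (rule anti) auto
  show "l1 \<le> cent P Y1 S + f1"
    using i1 c1 dec[of M1 S Y1] f1 by linarith
  have m2: "cent P M2 Y2 \<le> cent P (M21 \<bowtie> M2) Y2"
    and m21: "cent P M21 Y2 \<le> cent P (M21 \<bowtie> M2) Y2"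
    by (rule cent_mono, auto)+
  \<comment> \<open>\<open>T\<close> is a function of \<open>M1\<close>, \<open>M21\<close> and
    \<open>S\<close>, so conditioning on it alone leaves \<open>M2\<close> at least as
    uncertain.\<close>
  have c2: "cent P M2 (M1 \<bowtie> M21 \<bowtie> S) \<le> cent P M2 T"
    by (rule anti) (metis T prod.inject)
  show "l2 \<le> cent P Y2 T + f2"
    using i2 c2 dec[of M2 T Y2] m2 f2 by linarith
  have c21: "cent P M21 (M1 \<bowtie> M2 \<bowtie> S) \<le> cent P M21 (M2 \<bowtie> S)"
    by (rule anti) auto
  have d21: "cent P Y2 (M2 \<bowtie> S) \<le> cent P T (M2 \<bowtie> S)"
    by (rule cent_mono) (metis Y2 prod.inject)
  have e21: "cent P T (M2 \<bowtie> S) \<le> cent P T S"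
    by (rule anti) auto
  show "l21 \<le> cent P T S + f2"
    using i21 c21 d21 e21 dec[of M21 "M2 \<bowtie> S" Y2] m21 f2 by linarith
  have "cent P (M1 \<bowtie> M21) (Y1 \<bowtie> Y2) =
      cent P M21 (Y1 \<bowtie> Y2) + cent P M1 (M21 \<bowtie> Y1 \<bowtie> Y2)"
    by (rule cent_chain)
  also have "\<dots> \<le> cent P M21 Y2 + cent P M1 Y1"
    by (intro add_mono anti) auto
  finally have c12: "cent P (M1 \<bowtie> M21) (Y1 \<bowtie> Y2) \<le> f1 + f2"
    using m21 f1 f2 by linarith
  have d12: "cent P (Y1 \<bowtie> Y2) (M2 \<bowtie> S) \<le> cent P (T \<bowtie> Y1) (M2 \<bowtie> S)"
    by (rule cent_mono) (metis Y2 prod.inject)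
  have e12: "cent P (T \<bowtie> Y1) (M2 \<bowtie> S) \<le> cent P (T \<bowtie> Y1) S"
    by (rule anti) auto
  show "l1 + l21 \<le> cent P (T \<bowtie> Y1) S + f1 + f2"
    using i12 c12 d12 e12 dec[of "M1 \<bowtie> M21" "M2 \<bowtie> S" "Y1 \<bowtie> Y2"] by linarith
  \<comment> \<open>\<open>H(Y2,M21,M2)\<close> is expanded in two ways, and
    \<open>H(Y2|M21,M2)\<close> has to be bounded from below. Given \<open>M2\<close>, the output
    determines \<open>T\<close> by injectivity; \<open>M2\<close> is then dropped because it is
    independent of \<open>T\<close> and \<open>M21\<close>; at last the state comes in.\<close>
  have "ent P (M21 \<bowtie> M2) + cent P Y2 (M21 \<bowtie> M2) =
      ent P Y2 + cent P (M21 \<bowtie> M2) Y2"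
  proof -
    have "ent P (Y2 \<bowtie> M21 \<bowtie> M2) = ent P (\<lambda>\<omega>. ((M21 \<omega>, M2 \<omega>), Y2 \<omega>))"
      by (rule ent_cong) auto
    then show ?thesis by (simp add: cent_def)
  qed
  moreover have "cent P T (M21 \<bowtie> M2) \<le> cent P Y2 (M21 \<bowtie> M2)"
    by (rule cent_mono) (metis inj prod.inject)
  moreover have "cent P T M21 \<le> cent P T (M21 \<bowtie> M2)"
  proof -
    have "cent P M2 (M1 \<bowtie> M21 \<bowtie> S) \<le> cent P M2 (T \<bowtie> M21)"
      by (rule anti) (metis T prod.inject)
    moreover have "cent P M2 M21 \<le> l2" using cent_le_ent[OF fin, of M2 M21] l by linarith
    ultimately have le: "cent P M2 M21 \<le> cent P M2 (T \<bowtie> M21)" using i2 by linarith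
    show ?thesis
    proof -
      have "ent P (T \<bowtie> M21 \<bowtie> M2) = ent P (M2 \<bowtie> T \<bowtie> M21)"
        by (rule ent_cong) auto
      moreover have "ent P (M21 \<bowtie> M2) = ent P (M2 \<bowtie> M21)"
        by (rule ent_cong) auto
      ultimately show ?thesis using le by (simp add: cent_def)
    qed
  qed
  moreover have "ent P S - cent P S T + cent P T (S \<bowtie> M21) \<le> cent P T M21"
  proof -
    have "cent P S (M1 \<bowtie> M21 \<bowtie> M2) \<le> cent P S M21" by (rule anti) auto
    moreover have "cent P S (T \<bowtie> M21) \<le> cent P S T" by (rule anti) auto
    moreover have "cent P T M21 + cent P S (T \<bowtie> M21) = cent P S M21 + cent P T (S \<bowtie> M21)"
    proof -
      have "ent P (S \<bowtie> T \<bowtie> M21) = ent P (T \<bowtie> S \<bowtie> M21)"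
        by (rule ent_cong) auto
      then show ?thesis by (simp add: cent_def)
    qed
    ultimately show ?thesis using iS by linarith
  qed
  ultimately have key: "l2 + l21 \<le> ent P Y2 + f2 - (ent P S - cent P S T) - cent P T (S \<bowtie> M21)"
    using i22 f2 by linarith
  then show "l2 + l21 \<le> ent P Y2 - (ent P S - cent P S T) + f2"
    using cent_nonneg[of P T "S \<bowtie> M21"] by linarith
  \<comment> \<open>The term \<open>H(T|S,M21)\<close> saved in \<open>key\<close> pays for the
    interference part of \<open>H(Y1,T|S,M21)\<close>, so that only \<open>H(Y1|T,S)\<close>
    remains.\<close>
  have "cent P M1 (M21 \<bowtie> M2 \<bowtie> S) \<le> cent P M1 (S \<bowtie> M21)"
    by (rule anti) auto
  moreover have "cent P Y1 (S \<bowtie> M21) \<le> cent P (Y1 \<bowtie> T) (S \<bowtie> M21)"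
    by (rule cent_mono) auto
  moreover have "cent P (Y1 \<bowtie> T) (S \<bowtie> M21) =
      cent P T (S \<bowtie> M21) + cent P Y1 (T \<bowtie> S \<bowtie> M21)"
    by (rule cent_chain)
  moreover have "cent P Y1 (T \<bowtie> S \<bowtie> M21) \<le> cent P Y1 (T \<bowtie> S)"
    by (rule anti) auto
  ultimately show "l1 + l2 + l21 \<le> cent P Y1 (T \<bowtie> S) + ent P Y2 - (ent P S - cent P S T) + f1 + f2"
    using key i1 f1 dec[of M1 "S \<bowtie> M21" Y1] by linarith
qed

section \<open>Laws induced by a code\<close>

lemma pmf_unif: "m \<in> {1..k} \<Longrightarrow> pmf (unif k) m = 1 / k"
  by (simp add: unif_def)

lemma ent_unif: "0 < k \<Longrightarrow> ent (unif k) (\<lambda>m. m) = log 2 k"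
proof -
  assume k: "0 < k"
  have "ent (unif k) (\<lambda>m. m) = ex (unif k) (\<lambda>_. - log 2 (1 / k))"
    unfolding ent_def using k by (intro ex_cong) (simp add: set_unif pmf_unif)
  then show ?thesis using k by (simp add: ex_const log_divide)
qed

lemma ent_pair_pmf:
  assumes "finite (set_pmf A)" "finite (set_pmf B)"
  shows "ent (pair_pmf A B) (\<lambda>\<omega>. \<omega>) = ent A (\<lambda>x. x) + ent B (\<lambda>x. x)"
proof -
  have p: "pair_pmf A B = bind_pmf A (\<lambda>a. map_pmf (Pair a) B)"
    by (simp add: pair_pmf_def map_pmf_def)
  have "ent (pair_pmf A B) (\<lambda>\<omega>. \<omega>) = ent (pair_pmf A B) (\<lambda>\<omega>. (snd \<omega>, fst \<omega>))"
    by (rule ent_cong) (auto simp: prod_eq_iff)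
  also have "\<dots> = ent A (\<lambda>m. m) + ex A (\<lambda>m. ent (map_pmf (Pair m) B) snd)"
    unfolding p using assms by (intro ent_mixture) auto
  finally show ?thesis using assms by (simp add: ent_map ex_const)
qed

lemma ent_replicate_pmf:
  assumes "finite (set_pmf p)"
  shows "ent (replicate_pmf n p) (\<lambda>x. x) = n * ent p (\<lambda>x. x)"
proof (induction n)
  case 0
  then show ?case by (simp add: ent_def)
next
  case (Suc n)
  have r: "replicate_pmf (Suc n) p = map_pmf (\<lambda>(x, xs). x # xs) (pair_pmf p (replicate_pmf n p))"
    by (simp add: pair_pmf_def map_bind_pmf)
  have "ent (replicate_pmf (Suc n) p) (\<lambda>x. x) = ent (pair_pmf p (replicate_pmf n p)) (\<lambda>\<omega>. (\<lambda>(x, xs).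
    x # xs) \<omega>)"
    unfolding r using assms by (subst ent_map) (auto simp: finite_replicate_pmf)
  also have "\<dots> = ent (pair_pmf p (replicate_pmf n p)) (\<lambda>\<omega>. \<omega>)"
    by (rule ent_cong) auto
  finally show ?case
    using Suc assms by (simp add: ent_pair_pmf finite_replicate_pmf algebra_simps)
qed

lemma map_nth_replicate_pmf: "i < n \<Longrightarrow> map_pmf (\<lambda>xs. xs ! i) (replicate_pmf n p) = p"
proof (induction n arbitrary: i)
  case (Suc n)
  then show ?case
    by (cases i) (simp_all add: map_bind_pmf map_pmf_comp map_pmf_const bind_return_pmf' flip:
      map_pmf_def)
qed simp

lemma pmf_disintegrate:
  "\<exists>a. G = bind_pmf (map_pmf fst G) (\<lambda>s. map_pmf (Pair s) (a s))"
proof -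
  let ?c = "\<lambda>s. cond_pmf G {w. fst w = s}"
  have ne: "set_pmf G \<inter> {w. fst w = s} \<noteq> {}" if "s \<in> set_pmf (map_pmf fst G)" for s
    using that by auto
  have "bind_pmf (map_pmf fst G) ?c = G"
    by (rule bind_cond_pmf_cancel) (auto simp: vimage_def intro!: arg_cong[where f =
      "measure_pmf.prob G"])
  moreover have "?c s = map_pmf (Pair s) (map_pmf snd (?c s))" if "s \<in> set_pmf (map_pmf fst G)" for
    s
  proof -
    have "map_pmf (Pair s) (map_pmf snd (?c s)) = map_pmf (\<lambda>w. w) (?c s)"
      unfolding map_pmf_comp using ne[OF that] by (intro map_pmf_cong) auto
    then show ?thesis by simp
  qed
  ultimately have "G = bind_pmf (map_pmf fst G) (\<lambda>s. map_pmf (Pair s) (map_pmf snd (?c s)))"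
    by (metis (no_types, lifting) bind_pmf_cong)
  then show ?thesis by (rule exI[where x = "\<lambda>s. map_pmf snd (?c s)"])
qed

lemma bind_pair_commute:
  "map_pmf (\<lambda>(m1, m21, m2, s). (g m1 m21 s, h m2)) (pair_pmf A (pair_pmf B (pair_pmf C D))) =
    bind_pmf (map_pmf (\<lambda>(m1, m21, s). g m1 m21 s) (pair_pmf A (pair_pmf B D))) (\<lambda>u. map_pmf (Pair u)
      (map_pmf h C))"
  unfolding pair_pmf_def
  by (simp add: map_bind_pmf bind_assoc_pmf bind_map_pmf map_pmf_comp bind_return_pmf)
    (subst bind_commute_pmf[of C D], simp add: map_pmf_def bind_assoc_pmf bind_return_pmf)

text \<open>The third component depends on \<open>M2\<close> alone, which is independent of whatever
  determines the other two, and a single state letter has law \<open>ps\<close>. This is why the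
  time index can serve as \<open>Q\<close> with input laws of the required product form.\<close>

lemma letter_law:
  assumes i: "i < n"
  shows "\<exists>a b. map_pmf (\<lambda>(m1, m21, m2, s). (s ! i, F m1 m21 s, H m2)) (source_pmf ps n R1 R21 R2) =
    single ps a b"
proof -
  define A B C where "A = pmf_of_set (message_set n R1)" and "B = pmf_of_set (message_set n R21)"
    and "C = pmf_of_set (message_set n R2)"
  define D where "D = replicate_pmf n ps"
  define G where "G = map_pmf (\<lambda>(m1, m21, s). (s ! i, F m1 m21 s)) (pair_pmf A (pair_pmf B D))"
  have "map_pmf fst G = map_pmf (\<lambda>s. s ! i) (map_pmf snd (map_pmf snd (pair_pmf A (pair_pmf B D))))"
    by (simp add: G_def map_pmf_comp case_prod_unfold)
  also have "\<dots> = ps"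
    by (simp add: map_snd_pair_pmf D_def map_nth_replicate_pmf i)
  finally have fst: "map_pmf fst G = ps" .
  obtain a where a: "G = bind_pmf ps (\<lambda>s. map_pmf (Pair s) (a s))"
    using pmf_disintegrate[of G] fst by auto
  have "map_pmf (\<lambda>(m1, m21, m2, s). (s ! i, F m1 m21 s, H m2)) (source_pmf ps n R1 R21 R2) =
      map_pmf (\<lambda>((s, x1), x2). (s, x1, x2)) (map_pmf (\<lambda>(m1, m21, m2, s). ((s ! i, F m1 m21 s), H
        m2))
        (pair_pmf A (pair_pmf B (pair_pmf C D))))"
    by (simp add: source_pmf_def A_def B_def C_def D_def map_pmf_comp case_prod_unfold)
  also have "\<dots> = map_pmf (\<lambda>((s, x1), x2). (s, x1, x2)) (bind_pmf G (\<lambda>u. map_pmf (Pair u) (map_pmf H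
    C)))"
    unfolding G_def by (subst bind_pair_commute) (rule refl)
  also have "\<dots> = single ps a (map_pmf H C)"
    by (simp add: a single_def map_bind_pmf bind_assoc_pmf bind_map_pmf map_pmf_comp)
  finally show ?thesis by blast
qed

lemma log_nmsg:
  assumes "0 \<le> R"
  shows "n * R \<le> log 2 (nmsg n R)" "log 2 (nmsg n R) \<le> n * R + 1"
proof -
  have pos: "0 < real (nmsg n R)" using nmsg_bounds(1)[OF assms, of n] by simp
  show "n * R \<le> log 2 (nmsg n R)"
    using nmsg_bounds(2)[OF assms, of n] pos by (simp add: le_log_iff)
  have "log 2 (nmsg n R) \<le> log 2 (2 * 2 powr (n * R))"
    using nmsg_bounds(4)[OF assms, of n] pos by simp
  also have "\<dots> = n * R + 1"
    by (simp add: log_mult_pos)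
  finally show "log 2 (nmsg n R) \<le> n * R + 1" .
qed

lemma cent_const: "finite (set_pmf P) \<Longrightarrow> cent P X (\<lambda>_. c) = ent P X"
proof -
  assume fin: "finite (set_pmf P)"
  have "ent P (\<lambda>\<omega>. (X \<omega>, c)) = ent P X" by (rule ent_cong) auto
  then show ?thesis by (simp add: cent_def ent_unit fin)
qed

text \<open>\<open>\<tau>\<close> is the Fano loss per letter: two applications give
  \<open>2 + e * (l1 + l21 + l2)\<close>, and the logarithm of each message count exceeds
  \<open>n * R\<close> by at most one bit, hence the 3. Subtracting \<open>\<tau>\<close> from every
  rate gives the sums at least the same slack.\<close>

lemma code_bounds:
  fixes ps :: "'s::finite pmf"
    and y1 :: "'x1::finite \<Rightarrow> 's \<Rightarrow> 'y1::finite"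
    and t1 :: "'x1 \<Rightarrow> 's \<Rightarrow> 't::finite"
    and y2 :: "'x2::finite \<Rightarrow> 't \<Rightarrow> 'y2::finite"
  assumes inj: "\<And>x2. inj (y2 x2)" and n: "0 < n" and R: "0 \<le> R1" "0 \<le> R21" "0 \<le> R2"
    and e: "0 \<le> e" "error_prob1 ps y1 n R1 R21 R2 enc1 dec1 \<le> e"
      "error_prob2 ps t1 y2 n R1 R21 R2 enc1 enc2 dec2 \<le> e"
  defines "\<tau> \<equiv> (2 + e * (n * (R1 + R21 + R2) + 3)) / n"
  shows "\<exists>a b. bounds (\<lambda>j. (\<Sum>i<n. entropies y1 t1 y2 (single ps (a i) (b i)) j) / n) (R1 - \<tau>) (R21 -
    \<tau>) (R2 - \<tau>)"
proof -
  define P where "P = source_pmf ps n R1 R21 R2"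
  define M1 M21 M2 :: "nat \<times> nat \<times> nat \<times> 's list \<Rightarrow> nat"
    where "M1 = (\<lambda>(m1, m21, m2, s). m1)" and "M21 = (\<lambda>(m1, m21, m2, s). m21)"
      and "M2 = (\<lambda>(m1, m21, m2, s). m2)"
  define St where "St i = (\<lambda>(m1 :: nat, m21 :: nat, m2 :: nat, s :: 's list). s ! i)" for i
  define X1 where "X1 i = (\<lambda>(m1, m21, m2 :: nat, s). enc1 m1 m21 s i)" for i
  define X2 where "X2 i = (\<lambda>(m1 :: nat, m21 :: nat, m2, s :: 's list). enc2 m2 i)" for i
  define T where "T i \<omega> = t1 (X1 i \<omega>) (St i \<omega>)" for i \<omega>
  define Y1 where "Y1 i \<omega> = y1 (X1 i \<omega>) (St i \<omega>)" for i \<omega>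
  define Y2 where "Y2 i \<omega> = y2 (X2 i \<omega>) (T i \<omega>)" for i \<omega>
  define Sn where "Sn \<omega> = map (\<lambda>i. St i \<omega>) [0..<n]" for \<omega>
  define Tn where "Tn \<omega> = map (\<lambda>i. T i \<omega>) [0..<n]" for \<omega>
  define Y1n where "Y1n \<omega> = map (\<lambda>i. Y1 i \<omega>) [0..<n]" for \<omega>
  define Y2n where "Y2n \<omega> = map (\<lambda>i. Y2 i \<omega>) [0..<n]" for \<omega>
  define l1 l21 l2 where "l1 = log 2 (nmsg n R1)" and "l21 = log 2 (nmsg n R21)" and "l2 = log 2
    (nmsg n R2)"
  have pos: "0 < nmsg n R1" "0 < nmsg n R21" "0 < nmsg n R2"
    using nmsg_bounds(1)[OF R(1), of n] nmsg_bounds(1)[OF R(2), of n] nmsg_bounds(1)[OF R(3), of n]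
      by auto
  have P: "P = pair_pmf (unif (nmsg n R1)) (pair_pmf (unif (nmsg n R21)) (pair_pmf (unif (nmsg n
    R2)) (replicate_pmf n ps)))"
    by (simp add: P_def source_pmf_unif)
  have fin: "finite (set_pmf P)"
    using pos by (simp add: P finite_replicate_pmf)
  have supp: "m1 \<in> {1..nmsg n R1}" "m21 \<in> {1..nmsg n R21}" "m2 \<in> {1..nmsg n R2}" "Sn (m1, m21, m2,
    s) = s"
    if "(m1, m21, m2, s) \<in> set_pmf P" for m1 m21 m2 s
  proof -
    have "length s = n" using that by (simp add: P set_replicate_pmf)
    then show "Sn (m1, m21, m2, s) = s" using map_nth[of s] by (simp add: Sn_def St_def)
  qed (use that pos in \<open>simp_all add: P set_unif\<close>)
  have entS: "ent P (St i) = ent ps (\<lambda>s. s)" if "i < n" for i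
  proof -
    have "ent P (St i) = ent (map_pmf (St i) P) (\<lambda>s. s)"
      using fin by (simp add: ent_map)
    also have "map_pmf (St i) P = map_pmf (\<lambda>s. s ! i) (map_pmf snd (map_pmf snd (map_pmf snd P)))"
      by (simp add: St_def map_pmf_comp case_prod_unfold)
    also have "\<dots> = ps"
      unfolding P by (simp only: map_snd_pair_pmf map_nth_replicate_pmf[OF that])
    finally show ?thesis .
  qed
  have entSn: "ent P Sn = n * ent ps (\<lambda>s. s)"
  proof -
    have "ent P Sn = ent P (\<lambda>\<omega>. snd (snd (snd \<omega>)))"
      by (rule ent_cong) (use supp(4) in auto)
    also have "\<dots> = ent (map_pmf snd (map_pmf snd (map_pmf snd P))) (\<lambda>s. s)"
      using fin by (simp add: ent_map)
    finally show ?thesis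
      unfolding P by (simp add: map_snd_pair_pmf ent_replicate_pmf)
  qed
  have tot: "ent P (\<lambda>\<omega>. (M1 \<omega>, M21 \<omega>, M2 \<omega>, Sn \<omega>)) = l1 + l21 + l2 + ent P Sn"
  proof -
    have "ent P (\<lambda>\<omega>. (M1 \<omega>, M21 \<omega>, M2 \<omega>, Sn \<omega>)) = ent P (\<lambda>\<omega>. \<omega>)"
      by (rule ent_cong) (use supp(4) in \<open>auto simp: M1_def M21_def M2_def\<close>)
    also have "\<dots> = l1 + (l21 + (l2 + ent (replicate_pmf n ps) (\<lambda>s. s)))"
      unfolding P using pos by (simp add: ent_pair_pmf finite_replicate_pmf ent_unif l1_def l21_def
        l2_def)
    finally show ?thesis by (simp add: entSn ent_replicate_pmf)
  qed
  have le: "ent P M1 \<le> l1" "ent P M21 \<le> l21" "ent P M2 \<le> l2"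
  proof -
    have "ent P M \<le> log 2 k" if "M ` set_pmf P \<subseteq> {1..k}" for M :: "nat \<times> nat \<times> nat \<times> 's list \<Rightarrow> nat"
      and k
      using cent_le_log_card[OF fin that, of "\<lambda>_. ()"] by (simp add: cent_unit fin)
    moreover have "M1 ` set_pmf P \<subseteq> {1..nmsg n R1}"
      unfolding M1_def using supp(1) by (intro image_subsetI) (simp only: split_paired_all
        prod.case)
    moreover have "M21 ` set_pmf P \<subseteq> {1..nmsg n R21}"
      unfolding M21_def using supp(2) by (intro image_subsetI) (simp only: split_paired_all
        prod.case)
    moreover have "M2 ` set_pmf P \<subseteq> {1..nmsg n R2}"
      unfolding M2_def using supp(3) by (intro image_subsetI) (simp only: split_paired_all
        prod.case)
    ultimately show "ent P M1 \<le> l1" "ent P M21 \<le> l21" "ent P M2 \<le> l2"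
      unfolding l1_def l21_def l2_def by blast+
  qed
  have f1: "cent P M1 Y1n \<le> 1 + e * l1"
  proof -
    have "measure_pmf.prob P {\<omega>. dec1 (Y1n \<omega>) \<noteq> M1 \<omega>} \<le> e"
      using e(2) unfolding error_prob1_def P_def[symmetric]
      by (simp add: received1_def Y1n_def Y1_def X1_def St_def M1_def case_prod_unfold)
    then have "cent P M1 Y1n \<le> 1 + e * log 2 (card {1..nmsg n R1})"
      using supp by (intro cent_fano fin) (auto simp: M1_def)
    then show ?thesis by (simp add: l1_def)
  qed
  have f2: "cent P (\<lambda>\<omega>. (M21 \<omega>, M2 \<omega>)) Y2n \<le> 1 + e * (l21 + l2)"
  proof -
    have "measure_pmf.prob P {\<omega>. dec2 (Y2n \<omega>) \<noteq> (M21 \<omega>, M2 \<omega>)} \<le> e"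
      using e(3) unfolding error_prob2_def P_def[symmetric]
      by (simp add: received2_def Y2n_def Y2_def T_def X1_def X2_def St_def M21_def M2_def
        case_prod_unfold)
    then have "cent P (\<lambda>\<omega>. (M21 \<omega>, M2 \<omega>)) Y2n \<le> 1 + e * log 2 (card ({1..nmsg n R21} \<times> {1..nmsg n
      R2}))"
      using supp by (intro cent_fano fin) (auto simp: M21_def M2_def)
    then show ?thesis using pos by (simp add: l21_def l2_def log_mult_pos card_cartesian_product)
  qed
  have dT: "Tn u = Tn v" and dY: "Y1n u = Y1n v"
    if "u \<in> set_pmf P" "v \<in> set_pmf P" "M1 u = M1 v" "M21 u = M21 v" "Sn u = Sn v" for u v
  proof -
    obtain m1 m21 m2 s where u: "u = (m1, m21, m2, s)" by (cases u)
    obtain m1' m21' m2' s' where v: "v = (m1', m21', m2', s')" by (cases v)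
    have "m1' = m1" "m21' = m21" "s' = s"
      using that supp(4) by (auto simp: u v M1_def M21_def)
    then show "Tn u = Tn v" "Y1n u = Y1n v"
      by (auto simp: u v Tn_def Y1n_def T_def Y1_def X1_def St_def)
  qed
  have X2eq: "X2 i u = X2 i v" if "M2 u = M2 v" for u v i
    using that by (auto simp: X2_def M2_def split: prod.splits)
  have dY2: "Y2n u = Y2n v" if "M2 u = M2 v" "Tn u = Tn v" for u v
    using that X2eq[OF that(1)] by (auto simp: Y2n_def Tn_def Y2_def)
  have dinj: "Tn u = Tn v" if "M2 u = M2 v" "Y2n u = Y2n v" for u v
  proof -
    have "T i u = T i v" if "i < n" for i
    proof -
      have "y2 (X2 i u) (T i u) = y2 (X2 i u) (T i v)"
        using \<open>Y2n u = Y2n v\<close> X2eq[OF \<open>M2 u = M2 v\<close>] that by (auto simp: Y2n_def Y2_def)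
      then show ?thesis using inj[of "X2 i u"] by (simp add: inj_def)
    qed
    then show ?thesis by (simp add: Tn_def)
  qed
  have "\<forall>u\<in>set_pmf P. \<forall>v\<in>set_pmf P. M1 u = M1 v \<and> M21 u = M21 v \<and> Sn u = Sn v \<longrightarrow> Tn u = Tn v"
    "\<forall>u\<in>set_pmf P. \<forall>v\<in>set_pmf P. M1 u = M1 v \<and> M21 u = M21 v \<and> Sn u = Sn v \<longrightarrow> Y1n u = Y1n v"
    "\<forall>u\<in>set_pmf P. \<forall>v\<in>set_pmf P. M2 u = M2 v \<and> Tn u = Tn v \<longrightarrow> Y2n u = Y2n v"
    "\<forall>u\<in>set_pmf P. \<forall>v\<in>set_pmf P. M2 u = M2 v \<and> Y2n u = Y2n v \<longrightarrow> Tn u = Tn v"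
    using dT dY dY2 dinj by blast+
  note conv = converse_entropy[OF fin this tot le f1 f2]
  define V where "V i \<omega> = (St i \<omega>, X1 i \<omega>, X2 i \<omega>)" for i \<omega>
  define g where "g i j = entropies y1 t1 y2 (map_pmf (V i) P) j" for i j
  have g: "g i 1 = cent P (Y1 i) (St i)" "g i 2 = cent P (T i) (St i)"
    "g i 3 = cent P (\<lambda>\<omega>. (T i \<omega>, Y1 i \<omega>)) (St i)" "g i 4 = cent P (Y2 i) (T i)"
    "g i 5 = ent P (Y2 i)" "g i 6 = ent P (T i)" for i
    unfolding g_def entropies_def
    by (simp_all add: cent_def ent_map fin V_def case_prod_unfold T_def[symmetric] Y1_def[symmetric]
      Y2_def[symmetric])
  have s1: "cent P Y1n Sn \<le> (\<Sum>i<n. g i 1)"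
    unfolding g Y1n_def Sn_def by (rule cent_list_le[OF fin])
  have s2: "cent P Tn Sn \<le> (\<Sum>i<n. g i 2)"
    unfolding g Tn_def Sn_def by (rule cent_list_le[OF fin])
  have s3: "cent P (\<lambda>\<omega>. (Tn \<omega>, Y1n \<omega>)) Sn \<le> (\<Sum>i<n. g i 3)"
  proof -
    have "cent P (\<lambda>\<omega>. (Tn \<omega>, Y1n \<omega>)) Sn = cent P (\<lambda>\<omega>. map (\<lambda>i. (T i \<omega>, Y1 i \<omega>)) [0..<n]) Sn"
      by (rule cent_cong) (auto simp: Tn_def Y1n_def)
    also have "\<dots> \<le> (\<Sum>i<n. g i 3)"
      unfolding g Sn_def by (rule cent_list_le[OF fin])
    finally show ?thesis .
  qed
  have s4: "cent P Y2n Tn \<le> (\<Sum>i<n. g i 4)"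
    unfolding g Y2n_def Tn_def by (rule cent_list_le[OF fin])
  have s5: "ent P Y2n \<le> (\<Sum>i<n. g i 5)"
    using cent_list_le[OF fin, of Y2 n "\<lambda>_ _. ()"] by (simp add: cent_const fin g Y2n_def[abs_def])
  \<comment> \<open>\<open>H(Y1|T,S) = H(T,Y1|S) - H(T|S)\<close> keeps the bound within the six
    averaged quantities.\<close>
  have s7: "cent P Y1n (\<lambda>\<omega>. (Tn \<omega>, Sn \<omega>)) \<le> (\<Sum>i<n. g i 3 - g i 2)"
  proof -
    have "cent P Y1n (\<lambda>\<omega>. (Tn \<omega>, Sn \<omega>)) = cent P Y1n (\<lambda>\<omega>. map (\<lambda>i. (T i \<omega>, St i \<omega>)) [0..<n])"
      by (rule cent_cong) (auto simp: Tn_def Sn_def)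
    also have "\<dots> \<le> (\<Sum>i<n. cent P (Y1 i) (\<lambda>\<omega>. (T i \<omega>, St i \<omega>)))"
      unfolding Y1n_def by (rule cent_list_le[OF fin])
    also have "\<dots> = (\<Sum>i<n. g i 3 - g i 2)"
    proof (rule sum.cong)
      fix i
      have "g i 3 = cent P (\<lambda>\<omega>. (Y1 i \<omega>, T i \<omega>)) (St i)"
        unfolding g by (rule cent_cong) auto
      then show "cent P (Y1 i) (\<lambda>\<omega>. (T i \<omega>, St i \<omega>)) = g i 3 - g i 2"
        by (simp add: cent_chain g)
    qed simp
    finally show ?thesis .
  qed
  \<comment> \<open>Superadditivity of the mutual information, from the exact sum in
    \<open>entS\<close> and \<open>entSn\<close> and from \<open>cent_list_le\<close>.\<close>
  have s8: "(\<Sum>i<n. g i 6 - g i 2) \<le> ent P Sn - cent P Sn Tn"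
  proof -
    have "g i 6 - g i 2 = ent P (St i) - cent P (St i) (T i)" for i
    proof -
      have "ent P (\<lambda>\<omega>. (T i \<omega>, St i \<omega>)) = ent P (\<lambda>\<omega>. (St i \<omega>, T i \<omega>))" by (rule ent_cong) auto
      then show ?thesis by (simp add: g cent_def)
    qed
    then have "(\<Sum>i<n. g i 6 - g i 2) = ent P Sn - (\<Sum>i<n. cent P (St i) (T i))"
      by (simp add: sum_subtractf entS entSn)
    also have "\<dots> \<le> ent P Sn - cent P Sn Tn"
      using cent_list_le[OF fin, of St n T] by (simp add: Sn_def[abs_def] Tn_def[abs_def])
    finally show ?thesis .
  qed
  have "\<exists>a b. map_pmf (V i) P = single ps a b" if "i < n" for i
  proof -
    have "V i = (\<lambda>(m1, m21, m2, s). (s ! i, enc1 m1 m21 s i, enc2 m2 i))"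
      by (auto simp: V_def St_def X1_def X2_def)
    then show ?thesis unfolding P_def using letter_law[OF that] by simp
  qed
  then obtain a b where ab: "\<And>i. i < n \<Longrightarrow> map_pmf (V i) P = single ps (a i) (b i)"
    by metis
  define Sg where "Sg j = (\<Sum>i<n. g i j)" for j
  have Sg: "Sg j = (\<Sum>i<n. entropies y1 t1 y2 (single ps (a i) (b i)) j)" for j
    unfolding Sg_def g_def by (intro sum.cong) (auto simp: ab)
  have l: "n * R1 \<le> l1" "n * R21 \<le> l21" "n * R2 \<le> l2"
    "l1 \<le> n * R1 + 1" "l21 \<le> n * R21 + 1" "l2 \<le> n * R2 + 1"
    unfolding l1_def l21_def l2_def by (intro log_nmsg R)+
  have \<tau>: "n * \<tau> = 2 + e * (n * (R1 + R21 + R2) + 3)"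
    using n by (simp add: \<tau>_def)
  have l0: "0 \<le> e * l1" "0 \<le> e * (l21 + l2)"
    using l R e n by (smt (verit) mult_nonneg_nonneg of_nat_0_le_iff)+
  have "e * (l1 + (l21 + l2)) \<le> e * (n * (R1 + R21 + R2) + 3)"
    using e l by (intro mult_left_mono) (auto simp: algebra_simps)
  then have ff: "(1 + e * l1) + (1 + e * (l21 + l2)) \<le> n * \<tau>"
    unfolding \<tau> by (simp add: algebra_simps)
  have "bounds (\<lambda>j. Sg j / n) (R1 - \<tau>) (R21 - \<tau>) (R2 - \<tau>)"
  proof -
    have "(R1 - \<tau>) * n \<le> Sg 1" "(R2 - \<tau>) * n \<le> Sg 4" "(R21 - \<tau>) * n \<le> Sg 2"
      "(R1 - \<tau> + (R21 - \<tau>)) * n \<le> Sg 3" "(R2 - \<tau> + (R21 - \<tau>)) * n \<le> Sg 5 - Sg 6 + Sg 2"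
      "(R1 - \<tau> + (R2 - \<tau>) + (R21 - \<tau>)) * n \<le> Sg 3 + Sg 5 - Sg 6"
    proof -
      have eqs: "(R1 - \<tau>) * n = n * R1 - n * \<tau>" "(R2 - \<tau>) * n = n * R2 - n * \<tau>"
        "(R21 - \<tau>) * n = n * R21 - n * \<tau>"
        "(R1 - \<tau> + (R21 - \<tau>)) * n = n * R1 + n * R21 - 2 * (n * \<tau>)"
        "(R2 - \<tau> + (R21 - \<tau>)) * n = n * R2 + n * R21 - 2 * (n * \<tau>)"
        "(R1 - \<tau> + (R2 - \<tau>) + (R21 - \<tau>)) * n = n * R1 + n * R2 + n * R21 - 3 * (n * \<tau>)"
        by (simp_all add: algebra_simps)
      note s = s1 s2 s3 s4 s5 s7[unfolded sum_subtractf] s8[unfolded sum_subtractf]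
      note s' = s[folded Sg_def]
      show "(R1 - \<tau>) * n \<le> Sg 1" unfolding eqs using conv(1) s' l ff l0 by linarith
      show "(R2 - \<tau>) * n \<le> Sg 4" unfolding eqs using conv(2) s' l ff l0 by linarith
      show "(R21 - \<tau>) * n \<le> Sg 2" unfolding eqs using conv(3) s' l ff l0 by linarith
      show "(R1 - \<tau> + (R21 - \<tau>)) * n \<le> Sg 3" unfolding eqs using conv(4) s' l ff l0 by linarith
      show "(R2 - \<tau> + (R21 - \<tau>)) * n \<le> Sg 5 - Sg 6 + Sg 2" unfolding eqs using conv(5) s' l ff l0 by
        linarith
      show "(R1 - \<tau> + (R2 - \<tau>) + (R21 - \<tau>)) * n \<le> Sg 3 + Sg 5 - Sg 6"
        unfolding eqs using conv(6) s' l ff l0 by linarith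
    qed
    then show ?thesis
      unfolding bounds_def using n
      by (simp add: pos_le_divide_eq flip: diff_divide_distrib add_divide_distrib)
  qed
  then show ?thesis unfolding Sg by blast
qed

section \<open>Reducing the time-sharing alphabet\<close>

type_synonym real7 = "real \<times> real \<times> real \<times> real \<times> real \<times> real \<times> real"

text \<open>
  Seven points of \<open>\<real>\<^sup>6\<close> either satisfy an affine relation or affinely generate the direction
  \<open>(1, \<dots>, 1)\<close>; both give a signed weight of total mass 0 that decreases no coordinate.
\<close>
lemma signed_weight:
  fixes v :: "nat \<Rightarrow> 'i \<Rightarrow> real"
  assumes fin: "finite I" and card: "6 < card I"
  shows "\<exists>c. (\<exists>i\<in>I. c i \<noteq> 0) \<and> (\<Sum>i\<in>I. c i) = 0 \<and> (\<forall>k\<in>{1..6}. 0 \<le> (\<Sum>i\<in>I. c i * v k i))"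
proof -
  \<comment> \<open>The leading 1 records the total mass: a linear relation between these vectors is
    an affine one between the points, and \<open>u\<close> has mass 0.\<close>
  define w :: "'i \<Rightarrow> real7" where "w i = (1, v 1 i, v 2 i, v 3 i, v 4 i, v 5 i, v 6 i)" for i
  define u :: real7 where "u = (0, 1, 1, 1, 1, 1, 1)"
  have comp: "(\<Sum>i\<in>I. c i *\<^sub>R w i) = ((\<Sum>i\<in>I. c i), (\<Sum>i\<in>I. c i * v 1 i), (\<Sum>i\<in>I. c i * v 2 i),
      (\<Sum>i\<in>I. c i * v 3 i), (\<Sum>i\<in>I. c i * v 4 i), (\<Sum>i\<in>I. c i * v 5 i), (\<Sum>i\<in>I. c i * v 6 i))" for c
    by (simp add: w_def prod_eq_iff fst_sum snd_sum)
  have "\<exists>c r. (\<exists>i\<in>I. c i \<noteq> 0) \<and> 0 \<le> r \<and> (\<Sum>i\<in>I. c i *\<^sub>R w i) = r *\<^sub>R u"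
  \<comment> \<open>Linear dependence speaks of sets, so repeated vectors are treated first; they
    give a relation with two opposite weights.\<close>
  proof (cases "inj_on w I")
    case False
    then obtain i j where ij: "i \<in> I" "j \<in> I" "i \<noteq> j" "w i = w j" by (auto simp: inj_on_def)
    define c where "c l = (if l = i then 1 else 0) - (if l = j then 1 else 0 :: real)" for l
    have "(\<Sum>l\<in>I. c l *\<^sub>R w l) = 0"
      using ij fin by (simp add: c_def scaleR_diff_left sum_subtractf if_distrib[of "\<lambda>a. a *\<^sub>R _"]
        cong: if_cong)
    then show ?thesis using ij by (intro exI[of _ c] exI[of _ 0]) (auto simp: c_def)
  next
    case inj: True
    have reindex: "(\<Sum>x\<in>w ` I. f x *\<^sub>R x) = (\<Sum>i\<in>I. f (w i) *\<^sub>R w i)" for f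
      by (simp add: sum.reindex inj)
    show ?thesis
    proof (cases "dependent (w ` I)")
      case True
      then obtain f where f: "\<exists>x\<in>w ` I. f x \<noteq> 0" "(\<Sum>x\<in>w ` I. f x *\<^sub>R x) = 0"
        using fin by (auto simp: dependent_finite)
      then show ?thesis
        unfolding reindex by (intro exI[of _ "\<lambda>i. f (w i)"] exI[of _ 0]) auto
    next
      case False
      \<comment> \<open>Independence forces exactly seven vectors, which then span the space and
        reach \<open>u\<close>.\<close>
      have "card (w ` I) \<le> DIM(real7)"
        using False by (rule independent_card_le)
      then have "card (w ` I) = DIM(real7)"
        using card by (simp add: card_image inj)
      then have "span (w ` I) = UNIV"
        using False fin by (metis card_ge_dim_independent dim_UNIV le_refl subset_UNIV
          top.extremum_uniqueI)
      then have "u \<in> span (w ` I)" by simp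
      then obtain f where "u = (\<Sum>x\<in>w ` I. f x *\<^sub>R x)"
        using fin by (auto simp: span_finite)
      then have f: "(\<Sum>i\<in>I. f (w i) *\<^sub>R w i) = 1 *\<^sub>R u" unfolding reindex by simp
      have "\<exists>i\<in>I. f (w i) \<noteq> 0"
      proof (rule ccontr)
        assume "\<not> ?thesis"
        then have "(\<Sum>i\<in>I. f (w i) *\<^sub>R w i) = 0" by (intro sum.neutral) auto
        then show False using f by (simp add: u_def zero_prod_def)
      qed
      then show ?thesis using f by (intro exI[of _ "\<lambda>i. f (w i)"] exI[of _ 1]) auto
    qed
  qed
  then obtain c r where c: "\<exists>i\<in>I. c i \<noteq> 0" and r: "0 \<le> r" and eq: "(\<Sum>i\<in>I. c i *\<^sub>R w i) = r *\<^sub>R u"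
    by blast
  have "(\<Sum>i\<in>I. c i) = 0"
    using eq unfolding comp u_def by simp
  moreover have "(\<Sum>i\<in>I. c i * v k i) = r" if "k \<in> {1..6}" for k
  proof -
    have "k = 1 \<or> k = 2 \<or> k = 3 \<or> k = 4 \<or> k = 5 \<or> k = 6"
      using that by (auto simp: numeral_eq_Suc le_Suc_eq)
    then show "(\<Sum>i\<in>I. c i * v k i) = r"
      using eq unfolding comp u_def by auto
  qed
  ultimately show ?thesis using c r by (intro exI[of _ c]) auto
qed

lemma embed_finite_pmf:
  assumes "finite I" "\<And>i. i \<in> I \<Longrightarrow> 0 \<le> g i" "(\<Sum>i\<in>I. g i) = 1"
  shows "\<exists>q. \<forall>i. pmf q i = (if i \<in> I then g i else 0)"
proof -
  let ?f = "\<lambda>i. if i \<in> I then g i else 0"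
  have "(\<integral>\<^sup>+ i. ennreal (?f i) \<partial>count_space UNIV) = (\<Sum>i\<in>I. ennreal (?f i))"
    using assms(1) by (intro nn_integral_count_space') auto
  also have "\<dots> = ennreal (\<Sum>i\<in>I. g i)"
    using assms by (subst sum_ennreal[symmetric]) (auto simp: sum_ennreal)
  finally have "(\<integral>\<^sup>+ i. ennreal (?f i) \<partial>count_space UNIV) = 1"
    using assms by simp
  then have "pmf (embed_pmf ?f) i = ?f i" for i
    using assms(2) by (intro pmf_embed_pmf) auto
  then show ?thesis by blast
qed

lemma reduce_step:
  fixes v :: "nat \<Rightarrow> 'i \<Rightarrow> real"
  assumes fin: "finite (set_pmf p)" and card: "6 < card (set_pmf p)"
  shows "\<exists>q. set_pmf q \<subset> set_pmf p \<and> (\<forall>k\<in>{1..6}. ex p (v k) \<le> ex q (v k))"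
proof -
  let ?I = "set_pmf p"
  obtain c where c: "\<exists>i\<in>?I. c i \<noteq> 0" and c0: "(\<Sum>i\<in>?I. c i) = 0"
    and cv: "\<And>k. k \<in> {1..6} \<Longrightarrow> 0 \<le> (\<Sum>i\<in>?I. c i * v k i)"
    using signed_weight[OF fin card, of v] by blast
  let ?N = "{i\<in>?I. c i < 0}"
  have ne: "?N \<noteq> {}"
  proof
    assume "?N = {}"
    then have "\<And>i. i \<in> ?I \<Longrightarrow> 0 \<le> c i" by fastforce
    then have "\<forall>i\<in>?I. c i = 0" using c0 fin by (simp add: sum_nonneg_eq_0_iff)
    then show False using c by auto
  qed
  have finN: "finite ?N" using fin by simp
  \<comment> \<open>The first time at which some weight \<open>pmf p i + t * c i\<close> vanishes;
    only a negative \<open>c i\<close> can make this happen.\<close>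
  define t where "t = Min ((\<lambda>i. pmf p i / - c i) ` ?N)"
  have "t \<in> (\<lambda>i. pmf p i / - c i) ` ?N"
    unfolding t_def using finN ne by (intro Min_in) auto
  then obtain j where j: "j \<in> ?N" "t = pmf p j / - c j"
    by (elim imageE)
  have t0: "0 \<le> t"
    unfolding j(2) using j(1) by (intro divide_nonneg_pos) auto
  have tmin: "t \<le> pmf p i / - c i" if "i \<in> ?N" for i
    unfolding t_def using finN that by (intro Min_le) auto
  define g where "g i = pmf p i + t * c i" for i
  have g0: "0 \<le> g i" if "i \<in> ?I" for i
  proof (cases "c i < 0")
    case True
    have "t * - c i \<le> pmf p i"
      by (rule pos_le_divide_eq[THEN iffD1, OF _ tmin]) (use True that in auto)
    then show ?thesis by (simp add: g_def)
  qed (use t0 in \<open>simp add: g_def\<close>)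
  have gj: "g j = 0" using j by (simp add: g_def field_simps)
  have "(\<Sum>i\<in>?I. g i) = 1"
    using c0 fin by (simp add: g_def sum.distrib sum_pmf_eq_1 flip: sum_distrib_left)
  then obtain q where q: "\<And>i. pmf q i = (if i \<in> ?I then g i else 0)"
    using embed_finite_pmf[of ?I g] fin g0 by blast
  have "set_pmf q \<subseteq> ?I" "j \<notin> set_pmf q"
    using q gj by (auto simp: set_pmf_iff split: if_splits)
  then have sub: "set_pmf q \<subset> ?I" using j by auto
  have "ex p (v k) \<le> ex q (v k)" if k: "k \<in> {1..6}" for k
  proof -
    have "ex q (v k) = (\<Sum>i\<in>?I. g i * v k i)"
      using sub fin by (subst ex_superset[of ?I]) (auto simp: q)
    also have "\<dots> = ex p (v k) + t * (\<Sum>i\<in>?I. c i * v k i)"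
      by (simp add: g_def ex_def algebra_simps sum.distrib sum_distrib_left)
    finally show ?thesis using t0 cv[OF k] by simp
  qed
  then show ?thesis using sub by blast
qed

lemma reduce_support:
  fixes v :: "nat \<Rightarrow> 'i \<Rightarrow> real"
  assumes "finite (set_pmf p)"
  shows "\<exists>q. finite (set_pmf q) \<and> card (set_pmf q) \<le> 6 \<and> (\<forall>k\<in>{1..6}. ex p (v k) \<le> ex q (v k))"
  using assms
proof (induction "card (set_pmf p)" arbitrary: p rule: less_induct)
  case less
  show ?case
  proof (cases "card (set_pmf p) \<le> 6")
    case True
    then show ?thesis using less.prems by blast
  next
    case False
    then obtain q where q: "set_pmf q \<subset> set_pmf p" "\<And>k. k \<in> {1..6} \<Longrightarrow> ex p (v k) \<le> ex q (v k)"
      using reduce_step[OF less.prems, of v] by (meson linorder_not_le)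
    have "card (set_pmf q) < card (set_pmf p)" "finite (set_pmf q)"
      using q less.prems by (auto intro: psubset_card_mono finite_subset)
    then show ?thesis using less.hyps q by (meson order_trans)
  qed
qed

section \<open>Compactness\<close>

text \<open>Bolzano-Weierstrass for the vector of all probabilities; finiteness of the alphabet lets
  the total mass 1 pass to the limit. Families over \<open>'i\<close> cover transition
  kernels.\<close>

lemma pmf_family_compact:
  fixes P :: "nat \<Rightarrow> 'i::finite \<Rightarrow> 'a::finite pmf"
  shows "\<exists>r Q. strict_mono r \<and> (\<forall>i a. (\<lambda>k. pmf (P (r k) i) a) \<longlonglongrightarrow> pmf (Q i) a)"
proof -
  define z :: "nat \<Rightarrow> real ^ ('i \<times> 'a)" where "z k = (\<chi> ia. pmf (P k (fst ia)) (snd ia))" for k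
  have "bounded (range z)"
  proof (rule boundedI)
    fix x assume "x \<in> range z"
    then obtain k where x: "x = z k" by auto
    have "norm x \<le> (\<Sum>i\<in>UNIV. \<bar>x $ i\<bar>)"
      by (rule norm_le_l1_cart)
    also have "\<dots> \<le> real (card (UNIV :: ('i \<times> 'a) set)) * 1"
      by (intro sum_bounded_above) (simp add: x z_def pmf_le_1)
    finally show "norm x \<le> real (card (UNIV :: ('i \<times> 'a) set)) * 1" .
  qed
  then obtain l r where r: "strict_mono r" and l: "(z \<circ> r) \<longlonglongrightarrow> l"
    using bounded_imp_convergent_subsequence by blast
  have lim: "(\<lambda>k. pmf (P (r k) i) a) \<longlonglongrightarrow> l $ (i, a)" for i a
    using tendsto_vec_nth[OF l, of "(i, a)"] by (simp add: z_def)
  have "\<exists>Q. \<forall>a. pmf Q a = l $ (i, a)" for i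
  proof -
    have "(\<lambda>k. \<Sum>a\<in>UNIV. pmf (P (r k) i) a) \<longlonglongrightarrow> (\<Sum>a\<in>UNIV. l $ (i, a))"
      by (intro tendsto_sum lim)
    then have "(\<Sum>a\<in>UNIV. l $ (i, a)) = 1"
      by (simp add: sum_pmf_eq_1 LIMSEQ_const_iff)
    moreover have "0 \<le> l $ (i, a)" for a
      using LIMSEQ_le_const[OF lim, of 0] by simp
    ultimately show ?thesis using embed_finite_pmf[of UNIV "\<lambda>a. l $ (i, a)"] by auto
  qed
  then obtain Q where "\<And>i a. pmf (Q i) a = l $ (i, a)" by metis
  then show ?thesis using r lim by (intro exI[of _ r] exI[of _ Q]) simp
qed

text \<open>Only continuity at 0 needs care; the value there is 0 whatever \<open>log 2 0\<close>
  is.\<close>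

lemma tendsto_x_log_x:
  assumes x: "x \<longlonglongrightarrow> l" and nonneg: "\<And>k. 0 \<le> x k"
  shows "(\<lambda>k. x k * - log 2 (x k)) \<longlonglongrightarrow> l * - log 2 (l :: real)"
proof -
  have "0 \<le> l" using LIMSEQ_le_const[OF x, of 0] nonneg by simp
  have "continuous_on {0..} (\<lambda>x::real. x * - log 2 x)"
    unfolding continuous_on_def
  proof
    fix y :: real assume "y \<in> {0..}"
    show "((\<lambda>x. x * - log 2 x) \<longlongrightarrow> y * - log 2 y) (at y within {0..})"
    proof (cases "y = 0")
      case True
      have "((\<lambda>x::real. x * - log 2 x) \<longlongrightarrow> 0) (at_right 0)" by real_asymp
      then show ?thesis using True by (simp add: at_within_Ici_at_right)
    next
      case False
      then show ?thesis using \<open>y \<in> {0..}\<close> by (intro tendsto_intros) auto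
    qed
  qed
  then show ?thesis
    by (rule continuous_on_tendsto_compose[OF _ x]) (use nonneg \<open>0 \<le> l\<close> in auto)
qed

lemma tendsto_ent:
  fixes P :: "nat \<Rightarrow> 'a::finite pmf"
  assumes lim: "\<And>\<omega>. (\<lambda>k. pmf (P k) \<omega>) \<longlonglongrightarrow> pmf Q \<omega>"
  shows "(\<lambda>k. ent (P k) X) \<longlonglongrightarrow> ent Q X"
proof -
  have pm: "pmf (map_pmf X p) x = (\<Sum>\<omega>\<in>X -` {x}. pmf p \<omega>)" for p :: "'a pmf" and x
    by (simp add: pmf_map measure_measure_pmf_finite)
  have e: "ent p X = (\<Sum>x\<in>range X. pmf (map_pmf X p) x * - log 2 (pmf (map_pmf X p) x))" for p :: "'a
    pmf"
    unfolding ent_def by (rule ex_range)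
  have "(\<lambda>k. pmf (map_pmf X (P k)) x) \<longlonglongrightarrow> pmf (map_pmf X Q) x" for x
    unfolding pm by (intro tendsto_sum lim)
  then show ?thesis
    unfolding e by (intro tendsto_sum tendsto_x_log_x) auto
qed

lemma pmf_single:
  fixes ps :: "'s::finite pmf" and a :: "'s \<Rightarrow> 'x1::finite pmf" and b :: "'x2::finite pmf"
  shows "pmf (single ps a b) (s, x1, x2) = pmf ps s * (pmf (a s) x1 * pmf b x2)"
proof -
  have "pmf (single ps a b) (s, x1, x2) = ex (single ps a b) (\<lambda>\<omega>. of_bool (\<omega> \<in> {(s, x1, x2)}))"
    by (subst ex_of_bool) (auto simp: measure_pmf_single)
  also have "\<dots> = ex ps (\<lambda>s'. ex (a s') (\<lambda>x1'. ex b (\<lambda>x2'. of_bool (s' = s) * (of_bool (x1' = x1) *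
    of_bool (x2' = x2)))))"
    unfolding single_def by (simp add: ex_bind ex_map flip: of_bool_conj)
  also have "\<dots> = pmf ps s * (pmf (a s) x1 * pmf b x2)"
  proof -
    have d: "ex p (\<lambda>y. of_bool (y = x) * f y) = pmf p x * f x" for p :: "'b::finite pmf" and x f
    proof -
      have "ex p (\<lambda>y. of_bool (y = x) * f y) = (\<Sum>y\<in>UNIV. if y = x then pmf p x * f x else 0)"
        unfolding ex_superset[OF finite_class.finite_UNIV subset_UNIV] by (rule sum.cong) auto
      then show ?thesis by simp
    qed
    have d1: "ex p (\<lambda>y. of_bool (y = x)) = pmf p x" for p :: "'b::finite pmf" and x
      using d[of p x "\<lambda>_. 1"] by simp
    show ?thesis by (simp only: ex_cmult ex_cmult_right d d1)
  qed
  finally show ?thesis .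
qed

lemma tendsto_entropies:
  fixes J :: "nat \<Rightarrow> ('s::finite \<times> 'x1::finite \<times> 'x2::finite) pmf"
  assumes "\<And>\<omega>. (\<lambda>k. pmf (J k) \<omega>) \<longlonglongrightarrow> pmf Q \<omega>"
  shows "(\<lambda>k. entropies y1 t1 y2 (J k) j) \<longlonglongrightarrow> entropies y1 t1 y2 Q j"
  unfolding entropies_def Let_def cent_def
  by (auto intro!: tendsto_diff tendsto_ent assms)

text \<open>Successive subsequences make \<open>pq\<close>, \<open>px1\<close> and
  \<open>px2\<close> converge, and the entropies are continuous. The lemma serves twice: it removes
  the slack in the converse and shows that the region is closed.\<close>

lemma rate_constraints_limit:
  fixes ps :: "'s::finite pmf" and y1 :: "'x1::finite \<Rightarrow> 's \<Rightarrow> 'y1" and t1 :: "'x1 \<Rightarrow> 's \<Rightarrow> 't"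
    and y2 :: "'x2::finite \<Rightarrow> 't \<Rightarrow> 'y2" and pq :: "nat \<Rightarrow> 'q::finite pmf"
  assumes rc: "\<And>k. rate_constraints ps y1 t1 y2 (pq k) (px1 k) (px2 k) (A k) (B k) (C k)"
    and lim: "A \<longlonglongrightarrow> R1" "B \<longlonglongrightarrow> R21" "C \<longlonglongrightarrow> R2"
  shows "\<exists>(pq :: 'q pmf) px1 px2. rate_constraints ps y1 t1 y2 pq px1 px2 R1 R21 R2"
proof -
  obtain r1 Q where r1: "strict_mono r1" and Q: "\<And>i a. (\<lambda>k. pmf (pq (r1 k)) a) \<longlonglongrightarrow> pmf (Q (i :: unit))
    a"
    using pmf_family_compact[of "\<lambda>k (_ :: unit). pq k"] by blast
  obtain r2 W1 where r2: "strict_mono r2"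
    and W1: "\<And>i a. (\<lambda>k. pmf ((\<lambda>(s, q). px1 (r1 (r2 k)) s q) i) a) \<longlonglongrightarrow> pmf (W1 i) a"
    using pmf_family_compact[of "\<lambda>k (s, q). px1 (r1 k) s q"] by blast
  obtain r3 W2 where r3: "strict_mono r3"
    and W2: "\<And>i a. (\<lambda>k. pmf (px2 (r1 (r2 (r3 k))) i) a) \<longlonglongrightarrow> pmf (W2 i) a"
    using pmf_family_compact[of "\<lambda>k. px2 (r1 (r2 k))"] by blast
  define r where "r k = r1 (r2 (r3 k))" for k
  have sm: "strict_mono r" using r1 r2 r3 by (simp add: r_def strict_mono_def)
  have l0: "(\<lambda>k. pmf (pq (r k)) a) \<longlonglongrightarrow> pmf (Q ()) a" for a
    unfolding r_def using LIMSEQ_subseq_LIMSEQ[OF Q[of a "()"] strict_mono_o[OF r2 r3]]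
    by (simp add: comp_def)
  have l1: "(\<lambda>k. pmf (px1 (r k) s q) a) \<longlonglongrightarrow> pmf (W1 (s, q)) a" for s q a
    unfolding r_def using LIMSEQ_subseq_LIMSEQ[OF W1[of "(s, q)"] r3] by (simp add: comp_def)
  have l2: "(\<lambda>k. pmf (px2 (r k) q) a) \<longlonglongrightarrow> pmf (W2 q) a" for q a
    unfolding r_def by (rule W2)
  define g where "g k j = ex (pq k) (\<lambda>q. entropies y1 t1 y2 (single ps (\<lambda>s. px1 k s q) (px2 k q))
    j)" for k j
  define h where "h j = ex (Q ()) (\<lambda>q. entropies y1 t1 y2 (single ps (\<lambda>s. W1 (s, q)) (W2 q)) j)" for
    j
  have gh: "(\<lambda>k. g (r k) j) \<longlonglongrightarrow> h j" for j
  proof -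
    have "(\<lambda>k. pmf (single ps (\<lambda>s. px1 (r k) s q) (px2 (r k) q)) \<omega>) \<longlonglongrightarrow> pmf (single ps (\<lambda>s. W1 (s, q))
      (W2 q)) \<omega>" for \<omega> q
      by (cases \<omega>) (auto simp: pmf_single intro!: tendsto_mult tendsto_const l1 l2)
    then show ?thesis
      unfolding g_def h_def ex_superset[OF finite_class.finite_UNIV subset_UNIV]
      by (intro tendsto_sum tendsto_mult l0 tendsto_entropies)
  qed
  have AR: "(\<lambda>k. A (r k)) \<longlonglongrightarrow> R1" "(\<lambda>k. B (r k)) \<longlonglongrightarrow> R21" "(\<lambda>k. C (r k)) \<longlonglongrightarrow> R2"
    using lim[THEN LIMSEQ_subseq_LIMSEQ, OF sm] by (simp_all add: comp_def)
  have b: "bounds (g k) (A k) (B k) (C k)" for k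
    using rc[of k] unfolding rate_constraints_iff g_def .
  note bk = b[unfolded bounds_def]
  have "R1 \<le> h 1" "R2 \<le> h 4" "R21 \<le> h 2"
    using LIMSEQ_le[OF AR(1) gh[of 1]] LIMSEQ_le[OF AR(3) gh[of 4]] LIMSEQ_le[OF AR(2) gh[of 2]] bk
      by auto
  moreover have "R1 + R21 \<le> h 3"
    by (rule LIMSEQ_le[OF tendsto_add[OF AR(1,2)] gh]) (use bk in auto)
  moreover have "R2 + R21 \<le> h 5 - h 6 + h 2"
    by (rule LIMSEQ_le[OF tendsto_add[OF AR(3,2)] tendsto_add[OF tendsto_diff[OF gh gh] gh]]) (use
      bk in auto)
  moreover have "R1 + R2 + R21 \<le> h 3 + h 5 - h 6"
    by (rule LIMSEQ_le[OF tendsto_add[OF tendsto_add[OF AR(1,3)] AR(2)] tendsto_diff[OF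
      tendsto_add[OF gh gh] gh]])
      (use bk in auto)
  ultimately have "bounds h R1 R21 R2" by (simp add: bounds_def)
  then show ?thesis
    unfolding h_def by (intro exI[of _ "Q ()"] exI[of _ "\<lambda>s q. W1 (s, q)"] exI[of _ W2])
      (simp add: rate_constraints_iff)
qed

section \<open>The capacity region\<close>

text \<open>\<open>g 6\<close> enters with a negative sign, so monotonicity is asked of the two
  combinations in which it occurs and not of \<open>g 5\<close> and \<open>g 6\<close>
  themselves.\<close>

lemma bounds_mono:
  assumes "bounds g R1 R21 R2" "R1' \<le> R1" "R21' \<le> R21" "R2' \<le> R2"
    and "\<And>j. j \<in> {1, 2, 3, 4} \<Longrightarrow> g j \<le> g' j"
    and "g 5 - g 6 + g 2 \<le> g' 5 - g' 6 + g' 2" "g 3 + g 5 - g 6 \<le> g' 3 + g' 5 - g' 6"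
  shows "bounds g' R1' R21' R2'"
  using assms(1-4) assms(5)[of 1] assms(5)[of 2] assms(5)[of 3] assms(5)[of 4] assms(6,7)
  unfolding bounds_def by auto

lemma bounds_six:
  fixes a :: "nat \<Rightarrow> 's::finite \<Rightarrow> 'x1::finite pmf" and b :: "nat \<Rightarrow> 'x2::finite pmf"
  assumes n: "0 < n"
    and bd: "bounds (\<lambda>j. (\<Sum>i<n. entropies y1 t1 y2 (single ps (a i) (b i)) j) / n) R1 R21 R2"
  shows "\<exists>(pq :: 6 pmf) px1 px2. rate_constraints ps y1 t1 y2 pq px1 px2 R1 R21 R2"
proof -
  define g where "g j i = entropies y1 t1 y2 (single ps (a i) (b i)) j" for j i
  \<comment> \<open>\<open>v\<close> lists the six right-hand sides themselves; it is these, and not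
    the entropies one by one, that must not decrease.\<close>
  define v where "v k i = (if k = 5 then g 5 i - g 6 i + g 2 i else if k = 6 then g 3 i + g 5 i - g
    6 i else g k i)"
    for k :: nat and i
  define p where "p = pmf_of_set {..<n}"
  have ne: "{..<n} \<noteq> {}" using n by auto
  have fin: "finite (set_pmf p)" using ne by (simp add: p_def)
  have av: "(\<Sum>i<n. f i) / n = ex p f" for f
    unfolding ex_def p_def using ne by (simp add: sum_divide_distrib)
  obtain q where q: "finite (set_pmf q)" "card (set_pmf q) \<le> 6"
    and qv: "\<And>k. k \<in> {1..6} \<Longrightarrow> ex p (v k) \<le> ex q (v k)"
    using reduce_support[OF fin, of v] by blast
  have "bounds (\<lambda>j. ex p (g j)) R1 R21 R2"
    using bd unfolding g_def[symmetric] av .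
  then have bq: "bounds (\<lambda>j. ex q (g j)) R1 R21 R2"
    using qv[of 1] qv[of 2] qv[of 3] qv[of 4] qv[of 5] qv[of 6]
    by (elim bounds_mono) (auto simp: v_def[abs_def] ex_add ex_diff)
  have "card (set_pmf q) \<le> card (UNIV :: 6 set)" using q by simp
  \<comment> \<open>At most six values carry mass, so they embed into the type \<open>6\<close>;
    \<open>h\<close> undoes the relabelling.\<close>
  then obtain f :: "nat \<Rightarrow> 6" where f: "inj_on f (set_pmf q)"
    using q(1) card_le_inj[of "set_pmf q" "UNIV :: 6 set"] by auto
  define h where "h = inv_into (set_pmf q) f"
  have "ex (map_pmf f q) (\<lambda>z. g j (h z)) = ex q (g j)" for j
    using q(1) f by (subst ex_map) (auto simp: h_def intro!: ex_cong)
  then have "rate_constraints ps y1 t1 y2 (map_pmf f q) (\<lambda>s z. a (h z) s) (\<lambda>z. b (h z)) R1 R21 R2"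
    using bq unfolding rate_constraints_iff g_def by simp
  then show ?thesis by blast
qed

lemma achievable_constraints:
  fixes ps :: "'s::finite pmf"
    and y1 :: "'x1::finite \<Rightarrow> 's \<Rightarrow> 'y1::finite"
    and t1 :: "'x1 \<Rightarrow> 's \<Rightarrow> 't::finite"
    and y2 :: "'x2::finite \<Rightarrow> 't \<Rightarrow> 'y2::finite"
  assumes inj: "\<And>x2. inj (y2 x2)" and ach: "achievable ps y1 t1 y2 R1 R21 R2"
  shows "\<exists>(pq :: 6 pmf) px1 px2. rate_constraints ps y1 t1 y2 pq px1 px2 R1 R21 R2"
proof -
  have R: "0 \<le> R1" "0 \<le> R21" "0 \<le> R2" using ach by (auto simp: achievable_def)
  \<comment> \<open>An upper bound for the \<open>\<tau>\<close> of \<open>code_bounds\<close> when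
    \<open>e = 1 / (k + 1)\<close> and \<open>n \<ge> k + 1\<close>; the 5 bounds
    \<open>2 + 3 * e\<close>.\<close>
  define \<sigma> where "\<sigma> k = (5 + (R1 + R21 + R2)) * (1 / real (Suc k))" for k
  have "\<exists>(pq :: 6 pmf) px1 px2. rate_constraints ps y1 t1 y2 pq px1 px2 (R1 - \<sigma> k) (R21 - \<sigma> k) (R2 -
    \<sigma> k)" for k
  proof -
    define e where "e = 1 / real (Suc k)"
    have e: "0 < e" "e \<le> 1" by (auto simp: e_def)
    have "\<forall>\<^sub>F n in sequentially. \<exists>enc1 enc2 dec1 dec2.
        error_prob1 ps y1 n R1 R21 R2 enc1 dec1 \<le> e \<and> error_prob2 ps t1 y2 n R1 R21 R2 enc1 enc2
          dec2 \<le> e"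
      using ach e unfolding achievable_def by blast
    then have "\<forall>\<^sub>F n in sequentially. Suc k \<le> n \<and> (\<exists>enc1 enc2 dec1 dec2.
        error_prob1 ps y1 n R1 R21 R2 enc1 dec1 \<le> e \<and> error_prob2 ps t1 y2 n R1 R21 R2 enc1 enc2
          dec2 \<le> e)"
      by (intro eventually_conj eventually_ge_at_top)
    from eventually_happens'[OF sequentially_bot this]
    obtain n enc1 enc2 dec1 dec2 where n: "Suc k \<le> n"
      and code: "error_prob1 ps y1 n R1 R21 R2 enc1 dec1 \<le> e" "error_prob2 ps t1 y2 n R1 R21 R2 enc1
        enc2 dec2 \<le> e"
      by blast
    define \<tau> where "\<tau> = (2 + e * (n * (R1 + R21 + R2) + 3)) / n"
    have n0: "0 < n" using n by simp
    obtain a b where ab: "bounds (\<lambda>j. (\<Sum>i<n. entropies y1 t1 y2 (single ps (a i) (b i)) j) / n) (R1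
      - \<tau>) (R21 - \<tau>) (R2 - \<tau>)"
      using code_bounds[OF inj n0 R less_imp_le[OF e(1)] code] unfolding \<tau>_def by blast
    have "\<tau> = (2 + 3 * e) * (1 / n) + e * (R1 + R21 + R2)"
      using n0 by (simp add: \<tau>_def field_simps)
    also have "\<dots> \<le> 5 * e + e * (R1 + R21 + R2)"
    proof -
      have "1 / real n \<le> e" unfolding e_def using n by (intro divide_left_mono) auto
      then show ?thesis using e by (intro add_right_mono mult_mono) auto
    qed
    also have "\<dots> = \<sigma> k" unfolding \<sigma>_def e_def[symmetric] by (simp add: algebra_simps)
    finally have "\<tau> \<le> \<sigma> k" .
    then have "bounds (\<lambda>j. (\<Sum>i<n. entropies y1 t1 y2 (single ps (a i) (b i)) j) / n) (R1 - \<sigma> k) (R21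
      - \<sigma> k) (R2 - \<sigma> k)"
      using ab by (elim bounds_mono) auto
    then show ?thesis by (rule bounds_six[OF n0])
  qed
  then obtain pq :: "nat \<Rightarrow> 6 pmf" and px1 px2 where
    rc: "\<And>k. rate_constraints ps y1 t1 y2 (pq k) (px1 k) (px2 k) (R1 - \<sigma> k) (R21 - \<sigma> k) (R2 - \<sigma> k)"
    by metis
  have "\<sigma> \<longlonglongrightarrow> (5 + (R1 + R21 + R2)) * 0"
    unfolding \<sigma>_def by (intro tendsto_mult tendsto_const lim_1_over_n[THEN LIMSEQ_Suc])
  then have "(\<lambda>k. R - \<sigma> k) \<longlonglongrightarrow> R" for R
    using tendsto_diff[OF tendsto_const, of \<sigma> 0 sequentially R] by simp
  then show ?thesis by (intro rate_constraints_limit[OF rc])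
qed

theorem theorem6:
  fixes ps :: "'s::finite pmf"
    and y1 :: "'x1::finite \<Rightarrow> 's \<Rightarrow> 'y1::finite"
    and t1 :: "'x1 \<Rightarrow> 's \<Rightarrow> 't::finite"
    and y2 :: "'x2::finite \<Rightarrow> 't \<Rightarrow> 'y2::finite"
  assumes "\<And>x2. inj (y2 x2)"
  shows "capacity_region ps y1 t1 y2 =
    {(R1, R21, R2). 0 \<le> R1 \<and> 0 \<le> R21 \<and> 0 \<le> R2 \<and>
      (\<exists>(pq :: 6 pmf) (px1 :: 's \<Rightarrow> 6 \<Rightarrow> 'x1 pmf) (px2 :: 6 \<Rightarrow> 'x2 pmf).
         rate_constraints ps y1 t1 y2 pq px1 px2 R1 R21 R2)}"
    (is "_ = ?R")
proof
  \<comment> \<open>The capacity region is a closure, so for this inclusion the right-hand side has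
    to be closed and contain every achievable triple.\<close>
  have "closed ?R"
    unfolding closed_sequential_limits
  proof (intro allI impI, elim conjE)
    fix x :: "nat \<Rightarrow> real \<times> real \<times> real" and l assume x: "\<forall>k. x k \<in> ?R" and l: "x \<longlonglongrightarrow> l"
    define A B C where "A k = fst (x k)" and "B k = fst (snd (x k))" and "C k = snd (snd (x k))" for
      k
    have lims: "A \<longlonglongrightarrow> fst l" "B \<longlonglongrightarrow> fst (snd l)" "C \<longlonglongrightarrow> snd (snd l)"
      unfolding A_def B_def C_def by (intro tendsto_fst tendsto_snd l)+
    have nonneg: "0 \<le> A k" "0 \<le> B k" "0 \<le> C k" for k
      using x by (auto simp: A_def B_def C_def case_prod_unfold)
    have "\<forall>k. \<exists>(pq :: 6 pmf) px1 px2. rate_constraints ps y1 t1 y2 pq px1 px2 (A k) (B k) (C k)"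
      using x by (auto simp: A_def B_def C_def case_prod_unfold)
    then obtain pq :: "nat \<Rightarrow> 6 pmf" and px1 px2 where
      "\<And>k. rate_constraints ps y1 t1 y2 (pq k) (px1 k) (px2 k) (A k) (B k) (C k)" by metis
    from rate_constraints_limit[OF this lims]
    have "\<exists>(pq :: 6 pmf) px1 px2. rate_constraints ps y1 t1 y2 pq px1 px2 (fst l) (fst (snd l)) (snd
      (snd l))" .
    moreover have "0 \<le> fst l" "0 \<le> fst (snd l)" "0 \<le> snd (snd l)"
      using lims[THEN LIMSEQ_le_const] nonneg by auto
    ultimately show "l \<in> ?R" by (simp add: case_prod_unfold)
  qed
  moreover have "{(R1, R21, R2). achievable ps y1 t1 y2 R1 R21 R2} \<subseteq> ?R"
  proof clarify
    fix R1 R21 R2 assume a: "achievable ps y1 t1 y2 R1 R21 R2"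
    then have "0 \<le> R1 \<and> 0 \<le> R21 \<and> 0 \<le> R2" by (auto simp: achievable_def)
    then show "0 \<le> R1 \<and> 0 \<le> R21 \<and> 0 \<le> R2 \<and> (\<exists>(pq :: 6 pmf) px1 px2. rate_constraints ps y1 t1 y2 pq
      px1 px2 R1 R21 R2)"
      using achievable_constraints[OF assms a] by blast
  qed
  ultimately show "capacity_region ps y1 t1 y2 \<subseteq> ?R"
    unfolding capacity_region_def by (intro closure_minimal)
  show "?R \<subseteq> capacity_region ps y1 t1 y2"
  proof clarify
    fix R1 R21 R2 :: real and pq :: "6 pmf" and px1 px2
    assume R: "0 \<le> R1" "0 \<le> R21" "0 \<le> R2" and rc: "rate_constraints ps y1 t1 y2 pq px1 px2 R1 R21
      R2"
    interpret coding ps y1 t1 y2 pq px1 px2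
      by unfold_locales (rule assms)
    show "(R1, R21, R2) \<in> capacity_region ps y1 t1 y2"
      using rc R by (rule rate_constraints_capacity)
  qed
qed

end
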